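(* Let $B=B_q(\mathfrak g)$ be the Kashiwara algebra over $R=\mathbb Q[[\hbar]]$ of a symmetrizable Kac-Moody algebra $\mathfrak g$. The assignments on generators ($i\in I$, $h\in P$; products written inside the tensor factors are products in $B$) $$\mu_B(e'_i)=1\otimes1\otimes e'_i-1\otimes e'_it_i\otimes t_i^{-1}+e'_i\otimes t_i\otimes t_i^{-1},$$ $$\mu_B(f_i)=1\otimes1\otimes f_i-1\otimes f_it_i\otimes t_i^{-1}+f_i\otimes t_i\otimes t_i^{-1},\qquad \mu_B(q^h)=q^h\otimes q^{-h}\otimes q^h,$$ and $$\theta_B(e'_i)=t_i^{-1}e'_it_i,\qquad \theta_B(f_i)=t_i^{-1}f_it_i,\qquad \theta_B(q^h)=q^h$$ give well-defined algebra morphisms $\mu_B:B\to B\otimes B^{\mathrm{op}}\otimes B$ and $\theta_B:B\to B$, and $(B,\mu_B,\theta_B)$ is an autonomous quantum torsor over $R$.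
   Context: Notation. $\mathfrak g$ is a symmetrizable Kac-Moody algebra over $\mathbb Q$ with Cartan subalgebra $\mathfrak t$, simple roots $\alpha_i\in\mathfrak t^*$ and coroots $h_i\in\mathfrak t$ ($i\in I$, $I$ finite). Fix an inner product on $\mathfrak t^*$ with $(\alpha_i,\alpha_i)$ a positive even integer and $\langle h_i,\lambda\rangle=2(\alpha_i,\lambda)/(\alpha_i,\alpha_i)$ for $\lambda\in\mathfrak t^*$. Put $P=\bigoplus_i\mathbb Zh_i$, $R=\mathbb Q[[\hbar]]$, $q=\exp(\hbar)$, $q_i=q^{(\alpha_i,\alpha_i)/2}$, $t_i=q^{(\alpha_i,\alpha_i)h_i/2}$ (i.e. $q^h$ for $h=(\alpha_i,\alpha_i)h_i/2\in P$), $[n]_i=(q_i^n-q_i^{-n})/(q_i-q_i^{-1})$, $[n]_i!=\prod_{k=1}^n[k]_i$ (invertible in $R$). Kashiwara algebra. $B=B_q(\mathfrak g)$ is the associative unital $R$-algebra generated by $e'_i,f_i$ ($i\in I$) and $q^h$ ($h\in P$) with relations $q^0=1$, $q^hq^{h'}=q^{h+h'}$, $q^he'_iq^{-h}=q^{\langle h,\alpha_i\rangle}e'_i$, $q^hf_iq^{-h}=q^{-\langle h,\alpha_i\rangle}f_i$, $e'_if_j=q_i^{\langle h_i,\alpha_j\rangle}f_je'_i+\delta_{i,j}$, and for $i\ne j$ the Serre relations $\sum_{k=0}^{1-\langle h_i,\alpha_j\rangle}(-1)^kX_i^{(k)}X_jX_i^{(1-\langle h_i,\alpha_j\rangle-k)}=0$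 for $X=e'$ and $X=f$, where $X_i^{(n)}=X_i^n/[n]_i!$. Quantum torsor. A quantum torsor $(T,\mu,\theta)$ over a commutative ring $k$ is a $k$-algebra $T$ with algebra morphisms $\mu:T\to T\otimes T^{\mathrm{op}}\otimes T$ and $\theta:T\to T$ such that, writing $\mu(x)=x^{(1)}\otimes x^{(2)}\otimes x^{(3)}$ and $\mu^{\mathrm{op}}(x)=x^{(3)}\otimes x^{(2)}\otimes x^{(1)}$, and letting $T$ also denote $\mathrm{Id}_T$ and $m$ the multiplication of $T$: $(T\otimes m)\mu(x)=x\otimes1$; $(m\otimes T)\mu(x)=1\otimes x$; $(T\otimes T\otimes\mu)\mu=(\mu\otimes T\otimes T)\mu$; $(T\otimes T\otimes\theta\otimes T\otimes T)(\mu\otimes T\otimes T)\mu=(T\otimes\mu^{\mathrm{op}}\otimes T)\mu$; $(\theta\otimes\theta\otimes\theta)\mu=\mu\theta$. It is autonomous if $\theta$ is bijective. *)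

theory Defs
  imports
    "HOL-Algebra.Algebra"
    "HOL-Algebra.Algebraic_Closure_Type"
    "HOL-Library.Poly_Mapping"
    "HOL-Computational_Algebra.Formal_Power_Series"
begin

section \<open>Associative algebras\<close>

text \<open>
  Scalars are the elements of a type of class \<^class>\<open>comm_ring_1\<close>, regarded as a ring record
  through \<open>ring_of_type_algebra\<close>; algebras are records of type \<open>('k, 'a) module\<close> with explicit
  carriers. The locale \<^locale>\<open>algebra\<close> of the library covers commutative algebras only.
\<close>

locale assoc_algebra = module + ring M +
  assumes smult_mult_left:
      "\<lbrakk>a \<in> carrier R; x \<in> carrier M; y \<in> carrier M\<rbrakk> \<Longrightarrow>
        (a \<odot>\<^bsub>M\<^esub> x) \<otimes>\<^bsub>M\<^esub> y = a \<odot>\<^bsub>M\<^esub> (x \<otimes>\<^bsub>M\<^esub> y)"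
    and smult_mult_right:
      "\<lbrakk>a \<in> carrier R; x \<in> carrier M; y \<in> carrier M\<rbrakk> \<Longrightarrow>
        x \<otimes>\<^bsub>M\<^esub> (a \<odot>\<^bsub>M\<^esub> y) = a \<odot>\<^bsub>M\<^esub> (x \<otimes>\<^bsub>M\<^esub> y)"

definition algebra_hom :: "('k, 'a) module \<Rightarrow> ('k, 'b) module \<Rightarrow> ('a \<Rightarrow> 'b) set" where
  "algebra_hom A B =
    {f \<in> ring_hom A B. \<forall>c. \<forall>x \<in> carrier A. f (c \<odot>\<^bsub>A\<^esub> x) = c \<odot>\<^bsub>B\<^esub> f x}"

definition opposite :: "('k, 'a) module \<Rightarrow> ('k, 'a) module" where
  "opposite A = A\<lparr>monoid.mult := (\<lambda>x y. y \<otimes>\<^bsub>A\<^esub> x)\<rparr>"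

definition gen_submodule :: "('k::comm_ring_1, 'a) module \<Rightarrow> 'a set \<Rightarrow> 'a set" where
  "gen_submodule M S = \<Inter>{H. submodule H (ring_of_type_algebra :: 'k ring) M \<and> S \<subseteq> H}"

text \<open>The ring \<^term>\<open>A Quot J\<close> with its induced scalar multiplication.\<close>

definition quot_algebra :: "('k, 'a) module \<Rightarrow> 'a set \<Rightarrow> ('k, 'a set) module" where
  "quot_algebra A J =
    \<lparr>carrier = carrier (A Quot J), monoid.mult = monoid.mult (A Quot J), one = one (A Quot J),
     ring.zero = ring.zero (A Quot J), add = add (A Quot J),
     module.smult = (\<lambda>c C. \<Union>x\<in>C. J +>\<^bsub>A\<^esub> (c \<odot>\<^bsub>A\<^esub> x))\<rparr>"

text \<open>
  The free module on the carrier of a monoid \<open>G\<close>, with the multiplication extending that of \<open>G\<close>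
  bilinearly.
\<close>

definition monoid_algebra :: "'m monoid \<Rightarrow> ('k::comm_ring_1, 'm \<Rightarrow>\<^sub>0 'k) module" where
  "monoid_algebra G =
    \<lparr>carrier = {p. Poly_Mapping.keys p \<subseteq> carrier G},
     monoid.mult = (\<lambda>p q. \<Sum>x\<in>Poly_Mapping.keys p. \<Sum>y\<in>Poly_Mapping.keys q.
       Poly_Mapping.single (x \<otimes>\<^bsub>G\<^esub> y) (Poly_Mapping.lookup p x * Poly_Mapping.lookup q y)),
     one = Poly_Mapping.single \<one>\<^bsub>G\<^esub> 1,
     ring.zero = 0,
     add = (+),
     module.smult = (\<lambda>c. Poly_Mapping.map ((*) c))\<rparr>"

definition free_algebra :: "'g set \<Rightarrow> ('k::comm_ring_1, 'g list \<Rightarrow>\<^sub>0 'k) module" where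
  "free_algebra S = monoid_algebra \<lparr>carrier = lists S, monoid.mult = (@), one = []\<rparr>"

definition free_gen :: "'g \<Rightarrow> ('g list \<Rightarrow>\<^sub>0 'k::comm_ring_1)" where
  "free_gen g = Poly_Mapping.single [g] 1"


section \<open>Tensor products of algebras\<close>

text \<open>
  The tensor product of a list \<open>[A\<^sub>1, \<dots>, A\<^sub>n]\<close> of algebras: the free module on the tuples in
  \<open>A\<^sub>1 \<times> \<dots> \<times> A\<^sub>n\<close> (lists of length \<open>n\<close>) modulo the submodule spanned by the multilinearity
  relations, with the componentwise multiplication. That submodule is a two-sided ideal of the
  monoid algebra of the multiplicative monoid \<open>A\<^sub>1 \<times> \<dots> \<times> A\<^sub>n\<close>.
\<close>

definition tuple_monoid :: "('k, 'a) module list \<Rightarrow> 'a list monoid" where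
  "tuple_monoid As =
    \<lparr>carrier = listset (map carrier As),
     monoid.mult = (\<lambda>xs ys. map (\<lambda>(A, x, y). x \<otimes>\<^bsub>A\<^esub> y) (zip As (zip xs ys))),
     one = map one As\<rparr>"

definition tuple_algebra :: "('k::comm_ring_1, 'a) module list \<Rightarrow> ('k, 'a list \<Rightarrow>\<^sub>0 'k) module" where
  "tuple_algebra As = monoid_algebra (tuple_monoid As)"

inductive_set multilinear_rels :: "('k::comm_ring_1, 'a) module list \<Rightarrow> ('a list \<Rightarrow>\<^sub>0 'k) set"
  for As :: "('k::comm_ring_1, 'a) module list" where
  additive:
    "\<lbrakk>xs \<in> listset (map carrier As); i < length As; x \<in> carrier (As ! i); y \<in> carrier (As ! i)\<rbrakk> \<Longrightarrow>
      Poly_Mapping.single (xs[i := x \<oplus>\<^bsub>As ! i\<^esub> y]) 1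
        - Poly_Mapping.single (xs[i := x]) 1 - Poly_Mapping.single (xs[i := y]) 1
      \<in> multilinear_rels As"
| homogeneous:
    "\<lbrakk>xs \<in> listset (map carrier As); i < length As; x \<in> carrier (As ! i)\<rbrakk> \<Longrightarrow>
      Poly_Mapping.single (xs[i := c \<odot>\<^bsub>As ! i\<^esub> x]) 1 - Poly_Mapping.single (xs[i := x]) c
      \<in> multilinear_rels As"

definition tensor_null :: "('k::comm_ring_1, 'a) module list \<Rightarrow> ('a list \<Rightarrow>\<^sub>0 'k) set" where
  "tensor_null As = gen_submodule (tuple_algebra As) (multilinear_rels As)"

definition tensor_algebra ::
    "('k::comm_ring_1, 'a) module list \<Rightarrow> ('k, ('a list \<Rightarrow>\<^sub>0 'k) set) module" where
  "tensor_algebra As = quot_algebra (tuple_algebra As) (tensor_null As)"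

definition pure_tensor ::
    "('k::comm_ring_1, 'a) module list \<Rightarrow> 'a list \<Rightarrow> ('a list \<Rightarrow>\<^sub>0 'k) set" where
  "pure_tensor As xs = tensor_null As +>\<^bsub>tuple_algebra As\<^esub> Poly_Mapping.single xs 1"

text \<open>
  For multilinear \<open>g\<close>, the linear map from the tensor product of \<open>As\<close> to \<open>N\<close> that sends the pure
  tensor of a tuple \<open>xs\<close> to \<open>g xs\<close>. The value does not depend on the representative of the coset
  \<open>C\<close>, so the image below is a singleton.
\<close>

definition tensor_lift ::
    "('k::comm_ring_1, 'b) module \<Rightarrow> ('a list \<Rightarrow> 'b) \<Rightarrow> ('a list \<Rightarrow>\<^sub>0 'k) set \<Rightarrow> 'b" where
  "tensor_lift N g C = the_elem
    ((\<lambda>p. \<Oplus>\<^bsub>N\<^esub>xs\<in>Poly_Mapping.keys p. Poly_Mapping.lookup p xs \<odot>\<^bsub>N\<^esub> g xs) ` C)"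


section \<open>Quantum torsors\<close>

abbreviation torsor_factors3 :: "('k, 'a) module \<Rightarrow> ('k, 'a) module list" where
  "torsor_factors3 T \<equiv> [T, opposite T, T]"

abbreviation torsor_factors5 :: "('k, 'a) module \<Rightarrow> ('k, 'a) module list" where
  "torsor_factors5 T \<equiv> [T, opposite T, T, opposite T, T]"

definition tensor3 :: "('k::comm_ring_1, 'a) module \<Rightarrow> ('k, ('a list \<Rightarrow>\<^sub>0 'k) set) module" where
  "tensor3 T = tensor_algebra (torsor_factors3 T)"

text \<open>
  The maps below are the linear extensions of functions on pure tensors \<open>w\<^sub>0 \<otimes> w\<^sub>1 \<otimes> \<dots>\<close>. An inner
  \<^const>\<open>tensor_lift\<close> expands \<open>\<mu>(w\<^sub>k)\<close> as a sum of pure tensors \<open>u\<^sub>0 \<otimes> u\<^sub>1 \<otimes> u\<^sub>2\<close>; in \<open>id_muop_id\<close> the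
  order of the three factors is reversed.
\<close>

definition id_m :: "('k::comm_ring_1, 'a) module \<Rightarrow> ('a list \<Rightarrow>\<^sub>0 'k) set \<Rightarrow> ('a list \<Rightarrow>\<^sub>0 'k) set" where
  "id_m T = tensor_lift (tensor_algebra [T, T])
    (\<lambda>w. pure_tensor [T, T] [w ! 0, w ! 1 \<otimes>\<^bsub>T\<^esub> w ! 2])"

definition m_id :: "('k::comm_ring_1, 'a) module \<Rightarrow> ('a list \<Rightarrow>\<^sub>0 'k) set \<Rightarrow> ('a list \<Rightarrow>\<^sub>0 'k) set" where
  "m_id T = tensor_lift (tensor_algebra [T, T])
    (\<lambda>w. pure_tensor [T, T] [w ! 0 \<otimes>\<^bsub>T\<^esub> w ! 1, w ! 2])"

definition id_id_mu :: "('k::comm_ring_1, 'a) module \<Rightarrow> ('a \<Rightarrow> ('a list \<Rightarrow>\<^sub>0 'k) set) \<Rightarrow>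
    ('a list \<Rightarrow>\<^sub>0 'k) set \<Rightarrow> ('a list \<Rightarrow>\<^sub>0 'k) set" where
  "id_id_mu T \<mu> = tensor_lift (tensor_algebra (torsor_factors5 T))
    (\<lambda>w. tensor_lift (tensor_algebra (torsor_factors5 T))
      (\<lambda>u. pure_tensor (torsor_factors5 T) [w ! 0, w ! 1, u ! 0, u ! 1, u ! 2]) (\<mu> (w ! 2)))"

definition mu_id_id :: "('k::comm_ring_1, 'a) module \<Rightarrow> ('a \<Rightarrow> ('a list \<Rightarrow>\<^sub>0 'k) set) \<Rightarrow>
    ('a list \<Rightarrow>\<^sub>0 'k) set \<Rightarrow> ('a list \<Rightarrow>\<^sub>0 'k) set" where
  "mu_id_id T \<mu> = tensor_lift (tensor_algebra (torsor_factors5 T))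
    (\<lambda>w. tensor_lift (tensor_algebra (torsor_factors5 T))
      (\<lambda>u. pure_tensor (torsor_factors5 T) [u ! 0, u ! 1, u ! 2, w ! 1, w ! 2]) (\<mu> (w ! 0)))"

definition id_muop_id :: "('k::comm_ring_1, 'a) module \<Rightarrow> ('a \<Rightarrow> ('a list \<Rightarrow>\<^sub>0 'k) set) \<Rightarrow>
    ('a list \<Rightarrow>\<^sub>0 'k) set \<Rightarrow> ('a list \<Rightarrow>\<^sub>0 'k) set" where
  "id_muop_id T \<mu> = tensor_lift (tensor_algebra (torsor_factors5 T))
    (\<lambda>w. tensor_lift (tensor_algebra (torsor_factors5 T))
      (\<lambda>u. pure_tensor (torsor_factors5 T) [w ! 0, u ! 2, u ! 1, u ! 0, w ! 2]) (\<mu> (w ! 1)))"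

definition theta_middle :: "('k::comm_ring_1, 'a) module \<Rightarrow> ('a \<Rightarrow> 'a) \<Rightarrow>
    ('a list \<Rightarrow>\<^sub>0 'k) set \<Rightarrow> ('a list \<Rightarrow>\<^sub>0 'k) set" where
  "theta_middle T \<theta> = tensor_lift (tensor_algebra (torsor_factors5 T))
    (\<lambda>w. pure_tensor (torsor_factors5 T) [w ! 0, w ! 1, \<theta> (w ! 2), w ! 3, w ! 4])"

definition theta_all :: "('k::comm_ring_1, 'a) module \<Rightarrow> ('a \<Rightarrow> 'a) \<Rightarrow>
    ('a list \<Rightarrow>\<^sub>0 'k) set \<Rightarrow> ('a list \<Rightarrow>\<^sub>0 'k) set" where
  "theta_all T \<theta> = tensor_lift (tensor3 T)
    (\<lambda>w. pure_tensor (torsor_factors3 T) [\<theta> (w ! 0), \<theta> (w ! 1), \<theta> (w ! 2)])"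

locale quantum_torsor =
  assoc_algebra "ring_of_type_algebra :: 'k::comm_ring_1 ring" T
  for T :: "('k::comm_ring_1, 'a) module" (structure) +
  fixes \<mu> :: "'a \<Rightarrow> ('a list \<Rightarrow>\<^sub>0 'k) set" and \<theta> :: "'a \<Rightarrow> 'a"
  assumes mu_hom: "\<mu> \<in> algebra_hom T (tensor3 T)"
    and theta_hom: "\<theta> \<in> algebra_hom T T"
    and right_unit: "x \<in> carrier T \<Longrightarrow> id_m T (\<mu> x) = pure_tensor [T, T] [x, \<one>\<^bsub>T\<^esub>]"
    and left_unit: "x \<in> carrier T \<Longrightarrow> m_id T (\<mu> x) = pure_tensor [T, T] [\<one>\<^bsub>T\<^esub>, x]"
    and coassoc: "x \<in> carrier T \<Longrightarrow> id_id_mu T \<mu> (\<mu> x) = mu_id_id T \<mu> (\<mu> x)"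
    and theta_law:
      "x \<in> carrier T \<Longrightarrow> theta_middle T \<theta> (mu_id_id T \<mu> (\<mu> x)) = id_muop_id T \<mu> (\<mu> x)"
    and theta_mu: "x \<in> carrier T \<Longrightarrow> theta_all T \<theta> (\<mu> x) = \<mu> (\<theta> x)"

locale autonomous_quantum_torsor = quantum_torsor +
  assumes theta_bij: "bij_betw \<theta> (carrier T) (carrier T)"


section \<open>Symmetrizable Kac-Moody data\<close>

text \<open>
  The Cartan subalgebra \<open>\<tt>\<close> is the rational vector space given by the type \<open>'v\<close> with scalar
  multiplication \<open>scl\<close>; its dual consists of the linear functionals \<open>'v \<Rightarrow> rat\<close>, and the pairing
  of \<open>h\<close> with \<open>\<lambda>\<close> is \<open>\<lambda> h\<close>.
\<close>

record ('i, 'v) km_datum =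
  idx :: "'i set"
  scl :: "rat \<Rightarrow> 'v \<Rightarrow> 'v"
  coroot :: "'i \<Rightarrow> 'v"
  simple_root :: "'i \<Rightarrow> 'v \<Rightarrow> rat"
  form :: "('v \<Rightarrow> rat) \<Rightarrow> ('v \<Rightarrow> rat) \<Rightarrow> rat"

definition dual_space :: "('i, 'v::ab_group_add) km_datum \<Rightarrow> ('v \<Rightarrow> rat) set" where
  "dual_space D = {l. Vector_Spaces.linear (scl D) (*) l}"

text \<open>
  The remaining axioms of a generalized Cartan matrix \<open>(simple_root j (coroot i))\<close>, namely that its
  diagonal entries are \<open>2\<close> and that its zero pattern is symmetric, follow from
  \<open>coroot_form\<close> and the symmetry of the form.
  Minimality of the dimension of \<open>\<tt>\<close> is not imposed.
\<close>

locale symmetrizable_km_datum =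
  fixes D :: "('i, 'v::ab_group_add) km_datum"
  assumes finite_idx: "finite (idx D)"
    and finite_dim: "\<exists>Basis. finite_dimensional_vector_space (scl D) Basis"
    and root_dual: "i \<in> idx D \<Longrightarrow> simple_root D i \<in> dual_space D"
    and coroots_independent:
      "(\<Sum>i\<in>idx D. scl D (c i) (coroot D i)) = 0 \<Longrightarrow> i \<in> idx D \<Longrightarrow> c i = 0"
    and roots_independent:
      "(\<And>v. (\<Sum>i\<in>idx D. c i * simple_root D i v) = 0) \<Longrightarrow> i \<in> idx D \<Longrightarrow> c i = 0"
    and cartan_off_diagonal:
      "\<lbrakk>i \<in> idx D; j \<in> idx D; i \<noteq> j\<rbrakk> \<Longrightarrow>
        simple_root D j (coroot D i) \<in> \<int> \<and> simple_root D j (coroot D i) \<le> 0"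
    and form_add:
      "\<lbrakk>l \<in> dual_space D; l' \<in> dual_space D; m \<in> dual_space D\<rbrakk> \<Longrightarrow>
        form D (\<lambda>v. l v + l' v) m = form D l m + form D l' m"
    and form_scale:
      "\<lbrakk>l \<in> dual_space D; m \<in> dual_space D\<rbrakk> \<Longrightarrow> form D (\<lambda>v. r * l v) m = r * form D l m"
    and form_sym: "\<lbrakk>l \<in> dual_space D; m \<in> dual_space D\<rbrakk> \<Longrightarrow> form D l m = form D m l"
    and form_nondegenerate:
      "\<lbrakk>l \<in> dual_space D; \<And>m. m \<in> dual_space D \<Longrightarrow> form D l m = 0\<rbrakk> \<Longrightarrow> l = (\<lambda>v. 0)"
    and form_root_even:
      "i \<in> idx D \<Longrightarrow> \<exists>n::nat. n > 0 \<and> form D (simple_root D i) (simple_root D i) = 2 * of_nat n"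
    and coroot_form:
      "\<lbrakk>i \<in> idx D; l \<in> dual_space D\<rbrakk> \<Longrightarrow>
        l (coroot D i) = 2 * form D (simple_root D i) l / form D (simple_root D i) (simple_root D i)"

definition coroot_lattice :: "('i, 'v::ab_group_add) km_datum \<Rightarrow> 'v set" where
  "coroot_lattice D = {\<Sum>i\<in>idx D. scl D (of_int (n i)) (coroot D i) |n :: 'i \<Rightarrow> int. True}"


section \<open>The Kashiwara algebra\<close>

text \<open>
  \<open>q_pow r\<close> is \<open>q\<^sup>r = exp (r\<hbar>)\<close> in \<open>\<rat>[[\<hbar>]]\<close>, which allows the exponents below to be written as
  rational numbers although all of them are integers.
\<close>

definition q_pow :: "rat \<Rightarrow> rat fps" where
  "q_pow r = fps_exp r"

definition half_norm :: "('i, 'v) km_datum \<Rightarrow> 'i \<Rightarrow> rat" where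
  "half_norm D i = form D (simple_root D i) (simple_root D i) / 2"

definition qi_pow :: "('i, 'v) km_datum \<Rightarrow> 'i \<Rightarrow> rat \<Rightarrow> rat fps" where
  "qi_pow D i r = q_pow (half_norm D i * r)"

text \<open>
  For \<open>n > 0\<close> the numerator and the denominator both have subdegree 1, and the division of power
  series is exact.
\<close>

definition q_int :: "('i, 'v) km_datum \<Rightarrow> 'i \<Rightarrow> nat \<Rightarrow> rat fps" where
  "q_int D i n = (qi_pow D i (of_nat n) - qi_pow D i (- of_nat n))
    div (qi_pow D i 1 - qi_pow D i (- 1))"

definition q_fact :: "('i, 'v) km_datum \<Rightarrow> 'i \<Rightarrow> nat \<Rightarrow> rat fps" where
  "q_fact D i n = (\<Prod>k = 1..n. q_int D i k)"

datatype ('i, 'v) kgen = Gen_e 'i | Gen_f 'i | Gen_q 'v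

type_synonym ('i, 'v) kfree = "('i, 'v) kgen list \<Rightarrow>\<^sub>0 rat fps"

definition kgens :: "('i, 'v::ab_group_add) km_datum \<Rightarrow> ('i, 'v) kgen set" where
  "kgens D = Gen_e ` idx D \<union> Gen_f ` idx D \<union> Gen_q ` coroot_lattice D"

definition kfree_algebra ::
    "('i, 'v::ab_group_add) km_datum \<Rightarrow> (rat fps, ('i, 'v) kfree) module" where
  "kfree_algebra D = free_algebra (kgens D)"

definition divided_power ::
    "('i, 'v::ab_group_add) km_datum \<Rightarrow> ('i \<Rightarrow> ('i, 'v) kgen) \<Rightarrow> 'i \<Rightarrow> nat \<Rightarrow> ('i, 'v) kfree" where
  "divided_power D G i n =
    inverse (q_fact D i n) \<odot>\<^bsub>kfree_algebra D\<^esub> (free_gen (G i) [^]\<^bsub>kfree_algebra D\<^esub> n)"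

definition serre_element ::
    "('i, 'v::ab_group_add) km_datum \<Rightarrow> ('i \<Rightarrow> ('i, 'v) kgen) \<Rightarrow> 'i \<Rightarrow> 'i \<Rightarrow> ('i, 'v) kfree" where
  "serre_element D G i j =
    (let A = kfree_algebra D; N = nat \<lfloor>1 - simple_root D j (coroot D i)\<rfloor> in
      \<Oplus>\<^bsub>A\<^esub>k\<in>{0..N}. (- 1) ^ k \<odot>\<^bsub>A\<^esub>
        (divided_power D G i k \<otimes>\<^bsub>A\<^esub> free_gen (G j) \<otimes>\<^bsub>A\<^esub> divided_power D G i (N - k)))"

text \<open>A relation \<open>a = b\<close> is represented by the element \<open>a - b\<close> of the free algebra.\<close>

inductive_set kashiwara_rels :: "('i, 'v::ab_group_add) km_datum \<Rightarrow> ('i, 'v) kfree set"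
  for D :: "('i, 'v::ab_group_add) km_datum" where
  q_zero: "free_gen (Gen_q 0) - \<one>\<^bsub>kfree_algebra D\<^esub> \<in> kashiwara_rels D"
| q_add:
    "\<lbrakk>h \<in> coroot_lattice D; h' \<in> coroot_lattice D\<rbrakk> \<Longrightarrow>
      free_gen (Gen_q h) \<otimes>\<^bsub>kfree_algebra D\<^esub> free_gen (Gen_q h') - free_gen (Gen_q (h + h'))
        \<in> kashiwara_rels D"
| q_e:
    "\<lbrakk>h \<in> coroot_lattice D; i \<in> idx D\<rbrakk> \<Longrightarrow>
      free_gen (Gen_q h) \<otimes>\<^bsub>kfree_algebra D\<^esub> free_gen (Gen_e i) \<otimes>\<^bsub>kfree_algebra D\<^esub> free_gen (Gen_q (- h))
        - q_pow (simple_root D i h) \<odot>\<^bsub>kfree_algebra D\<^esub> free_gen (Gen_e i) \<in> kashiwara_rels D"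
| q_f:
    "\<lbrakk>h \<in> coroot_lattice D; i \<in> idx D\<rbrakk> \<Longrightarrow>
      free_gen (Gen_q h) \<otimes>\<^bsub>kfree_algebra D\<^esub> free_gen (Gen_f i) \<otimes>\<^bsub>kfree_algebra D\<^esub> free_gen (Gen_q (- h))
        - q_pow (- simple_root D i h) \<odot>\<^bsub>kfree_algebra D\<^esub> free_gen (Gen_f i) \<in> kashiwara_rels D"
| e_f:
    "\<lbrakk>i \<in> idx D; j \<in> idx D\<rbrakk> \<Longrightarrow>
      free_gen (Gen_e i) \<otimes>\<^bsub>kfree_algebra D\<^esub> free_gen (Gen_f j)
        - (qi_pow D i (simple_root D j (coroot D i)) \<odot>\<^bsub>kfree_algebra D\<^esub>
            (free_gen (Gen_f j) \<otimes>\<^bsub>kfree_algebra D\<^esub> free_gen (Gen_e i))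
          + (if i = j then \<one>\<^bsub>kfree_algebra D\<^esub> else 0)) \<in> kashiwara_rels D"
| serre_e: "\<lbrakk>i \<in> idx D; j \<in> idx D; i \<noteq> j\<rbrakk> \<Longrightarrow> serre_element D Gen_e i j \<in> kashiwara_rels D"
| serre_f: "\<lbrakk>i \<in> idx D; j \<in> idx D; i \<noteq> j\<rbrakk> \<Longrightarrow> serre_element D Gen_f i j \<in> kashiwara_rels D"

definition kashiwara_ideal :: "('i, 'v::ab_group_add) km_datum \<Rightarrow> ('i, 'v) kfree set" where
  "kashiwara_ideal D = genideal (kfree_algebra D) (kashiwara_rels D)"

definition kashiwara_algebra ::
    "('i, 'v::ab_group_add) km_datum \<Rightarrow> (rat fps, ('i, 'v) kfree set) module" where
  "kashiwara_algebra D = quot_algebra (kfree_algebra D) (kashiwara_ideal D)"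

definition kashiwara_gen ::
    "('i, 'v::ab_group_add) km_datum \<Rightarrow> ('i, 'v) kgen \<Rightarrow> ('i, 'v) kfree set" where
  "kashiwara_gen D g = kashiwara_ideal D +>\<^bsub>kfree_algebra D\<^esub> free_gen g"

definition gen_e :: "('i, 'v::ab_group_add) km_datum \<Rightarrow> 'i \<Rightarrow> ('i, 'v) kfree set" where
  "gen_e D i = kashiwara_gen D (Gen_e i)"

definition gen_f :: "('i, 'v::ab_group_add) km_datum \<Rightarrow> 'i \<Rightarrow> ('i, 'v) kfree set" where
  "gen_f D i = kashiwara_gen D (Gen_f i)"

definition gen_q :: "('i, 'v::ab_group_add) km_datum \<Rightarrow> 'v \<Rightarrow> ('i, 'v) kfree set" where
  "gen_q D h = kashiwara_gen D (Gen_q h)"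

definition gen_t :: "('i, 'v::ab_group_add) km_datum \<Rightarrow> 'i \<Rightarrow> ('i, 'v) kfree set" where
  "gen_t D i = gen_q D (scl D (half_norm D i) (coroot D i))"

definition gen_t_inv :: "('i, 'v::ab_group_add) km_datum \<Rightarrow> 'i \<Rightarrow> ('i, 'v) kfree set" where
  "gen_t_inv D i = gen_q D (- scl D (half_norm D i) (coroot D i))"

definition pure3 :: "('i, 'v::ab_group_add) km_datum \<Rightarrow> ('i, 'v) kfree set \<Rightarrow>
    ('i, 'v) kfree set \<Rightarrow> ('i, 'v) kfree set \<Rightarrow> (('i, 'v) kfree set list \<Rightarrow>\<^sub>0 rat fps) set" where
  "pure3 D x y z = pure_tensor (torsor_factors3 (kashiwara_algebra D)) [x, y, z]"

definition kashiwara_mu :: "('i, 'v::ab_group_add) km_datum \<Rightarrow>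
    (('i, 'v) kfree set \<Rightarrow> (('i, 'v) kfree set list \<Rightarrow>\<^sub>0 rat fps) set) \<Rightarrow> bool" where
  "kashiwara_mu D \<mu> \<longleftrightarrow>
    (let B = kashiwara_algebra D; B3 = tensor3 B in
      \<mu> \<in> algebra_hom B B3 \<and>
      (\<forall>i\<in>idx D. \<mu> (gen_e D i) =
        pure3 D \<one>\<^bsub>B\<^esub> \<one>\<^bsub>B\<^esub> (gen_e D i)
        \<ominus>\<^bsub>B3\<^esub> pure3 D \<one>\<^bsub>B\<^esub> (gen_e D i \<otimes>\<^bsub>B\<^esub> gen_t D i) (gen_t_inv D i)
        \<oplus>\<^bsub>B3\<^esub> pure3 D (gen_e D i) (gen_t D i) (gen_t_inv D i)) \<and>
      (\<forall>i\<in>idx D. \<mu> (gen_f D i) =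
        pure3 D \<one>\<^bsub>B\<^esub> \<one>\<^bsub>B\<^esub> (gen_f D i)
        \<ominus>\<^bsub>B3\<^esub> pure3 D \<one>\<^bsub>B\<^esub> (gen_f D i \<otimes>\<^bsub>B\<^esub> gen_t D i) (gen_t_inv D i)
        \<oplus>\<^bsub>B3\<^esub> pure3 D (gen_f D i) (gen_t D i) (gen_t_inv D i)) \<and>
      (\<forall>h\<in>coroot_lattice D. \<mu> (gen_q D h) =
        pure3 D (gen_q D h) (gen_q D (- h)) (gen_q D h)))"

definition kashiwara_theta :: "('i, 'v::ab_group_add) km_datum \<Rightarrow>
    (('i, 'v) kfree set \<Rightarrow> ('i, 'v) kfree set) \<Rightarrow> bool" where
  "kashiwara_theta D \<theta> \<longleftrightarrow>
    (let B = kashiwara_algebra D in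
      \<theta> \<in> algebra_hom B B \<and>
      (\<forall>i\<in>idx D. \<theta> (gen_e D i) = gen_t_inv D i \<otimes>\<^bsub>B\<^esub> gen_e D i \<otimes>\<^bsub>B\<^esub> gen_t D i) \<and>
      (\<forall>i\<in>idx D. \<theta> (gen_f D i) = gen_t_inv D i \<otimes>\<^bsub>B\<^esub> gen_f D i \<otimes>\<^bsub>B\<^esub> gen_t D i) \<and>
      (\<forall>h\<in>coroot_lattice D. \<theta> (gen_q D h) = gen_q D h))"

end

theory Submission
  imports Defs
begin

text \<open>
  The algebra \<open>B\<close> is given by generators and relations, so a morphism out of \<open>B\<close> is the same as a
  choice of images that satisfy the relations (\<open>B_universal\<close>), and two morphisms are equal as soon as
  they agree on generators (\<open>B_hom_eqI\<close>). With these two tools the theorem becomes a verification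
  on generators; the work lies in the relations for \<open>\<mu>\<close>, and in showing that the composite maps in
  the axioms of a torsor are morphisms at all.

  Write \<open>\<mu>(x\<^sub>i) = a\<^sub>3 - a\<^sub>2 + a\<^sub>1\<close> for \<open>x = e'\<close> or \<open>x = f\<close>, with
  \<open>a\<^sub>3 = 1 \<otimes> 1 \<otimes> x\<^sub>i\<close>, \<open>a\<^sub>2 = 1 \<otimes> x\<^sub>i t\<^sub>i \<otimes> t\<^sub>i\<^sup>-\<^sup>1\<close> and \<open>a\<^sub>1 = x\<^sub>i \<otimes> t\<^sub>i \<otimes> t\<^sub>i\<^sup>-\<^sup>1\<close>. Since \<open>t\<^sub>j\<close> moves past \<open>x\<^sub>i\<close> at
  the cost of a power of \<open>q\<close>, a summand with a larger index \<open>q\<close>-commutes with every summand with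
  a smaller one, and the power of \<open>q\<close> depends only on the two simple roots and on whether \<open>x\<close> is \<open>e'\<close>
  or \<open>f\<close> (\<open>torsor_summands_commute\<close>). This has two consequences.

  In the relation between \<open>e'\<^sub>i\<close> and \<open>f\<^sub>j\<close> the mixed terms cancel. The three diagonal terms produce
  the constants \<open>\<delta>\<close>, \<open>-\<delta> (1 \<otimes> t\<^sub>i\<^sup>2 \<otimes> t\<^sub>i\<^sup>-\<^sup>2)\<close> and \<open>\<delta> (1 \<otimes> t\<^sub>i\<^sup>2 \<otimes> t\<^sub>i\<^sup>-\<^sup>2)\<close>, whose sum is \<open>\<delta>\<close>
  (\<open>torsor_sum_e_f\<close>).

  In the Serre relations each of the three families satisfies the relation by itself, and the
  relation is inherited by the sum of two \<open>q\<close>-commuting families (\<open>serre_sum_zero\<close>). For the latter,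
  the Serre element is obtained from \<open>x\<^sub>j\<close> by applying the operators \<open>u \<mapsto> u x\<^sub>i - q\<^sub>i\<^bsup>a+2m\<^esup> x\<^sub>i u\<close> for
  \<open>m = 0, \<dots>, -a\<close> in succession, where \<open>a\<close> is the entry of the Cartan matrix. These operators commute,
  so they may also be applied in the opposite order. When \<open>x\<^sub>i = y\<^sub>i + z\<^sub>i\<close>, one order makes every
  operator for \<open>z\<^sub>i\<close> vanish on the element built so far from \<open>y\<^sub>j\<close>, and the other order does the
  same with \<open>y\<close> and \<open>z\<close> exchanged (\<open>serre_absorb\<close>). No mixed terms arise.

  The map \<open>\<theta>\<close> multiplies \<open>e'\<^sub>i\<close> and \<open>f\<^sub>i\<close> by inverse powers of \<open>q\<close>. Such a rescaling respects the
  relations, and the inverse rescaling is its inverse. Coassociativity and both laws on \<open>\<theta>\<close> are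
  equations between morphisms, hence hold because they hold on generators. The two unit axioms
  involve the multiplication \<open>T\<^sup>o\<^sup>p \<otimes> T \<rightarrow> T\<close>, which is no morphism; here the elements that
  satisfy the axiom are shown to be closed under products (\<open>id_m_mult\<close>, \<open>m_id_mult\<close>).
\<close>

section \<open>Associative algebras over a commutative ring\<close>

text \<open>
  The locale \<^locale>\<open>assoc_algebra\<close> over \<open>ring_of_type_algebra\<close>, with the operations of the type class
  in place of those of the ring record: scalar identities can then be handed to the
  simplifier for commutative rings.
\<close>

locale type_algebra = ring M for M :: "('k::comm_ring_1, 'a) module" (structure) +
  assumes smult_closed [simp, intro]: "x \<in> carrier M \<Longrightarrow> c \<odot> x \<in> carrier M"
    and smult_add_left: "x \<in> carrier M \<Longrightarrow> (a + b) \<odot> x = a \<odot> x \<oplus> b \<odot> x"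
    and smult_add_right: "\<lbrakk>x \<in> carrier M; y \<in> carrier M\<rbrakk> \<Longrightarrow> c \<odot> (x \<oplus> y) = c \<odot> x \<oplus> c \<odot> y"
    and smult_smult: "x \<in> carrier M \<Longrightarrow> a \<odot> (b \<odot> x) = (a * b) \<odot> x"
    and smult_one [simp]: "x \<in> carrier M \<Longrightarrow> 1 \<odot> x = x"
    and smult_mult_left: "\<lbrakk>x \<in> carrier M; y \<in> carrier M\<rbrakk> \<Longrightarrow> (c \<odot> x) \<otimes> y = c \<odot> (x \<otimes> y)"
    and smult_mult_right: "\<lbrakk>x \<in> carrier M; y \<in> carrier M\<rbrakk> \<Longrightarrow> x \<otimes> (c \<odot> y) = c \<odot> (x \<otimes> y)"

lemma ring_of_type_simps:
  "carrier (ring_of_type_algebra :: 'k::comm_ring_1 ring) = UNIV"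
  "x \<otimes>\<^bsub>ring_of_type_algebra\<^esub> y = x * (y::'k)"
  "x \<oplus>\<^bsub>ring_of_type_algebra\<^esub> y = x + (y::'k)"
  "\<one>\<^bsub>ring_of_type_algebra :: 'k ring\<^esub> = 1"
  "\<zero>\<^bsub>ring_of_type_algebra :: 'k ring\<^esub> = 0"
  by (simp_all add: ring_of_type_algebra_def)

lemma type_algebra_iff:
  "assoc_algebra (ring_of_type_algebra :: 'k::comm_ring_1 ring) M \<longleftrightarrow> type_algebra M"
proof
  assume "assoc_algebra (ring_of_type_algebra :: 'k ring) M"
  then interpret assoc_algebra "ring_of_type_algebra :: 'k ring" M .
  show "type_algebra M"
  proof (intro type_algebra.intro type_algebra_axioms.intro)
    show "ring M" by unfold_locales
  qed (use smult_closed smult_l_distr smult_r_distr smult_assoc1 smult_one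
         smult_mult_left smult_mult_right in \<open>simp_all add: ring_of_type_simps\<close>)
next
  assume "type_algebra M"
  then interpret type_algebra M .
  have "module (ring_of_type_algebra :: 'k ring) M"
    by (rule moduleI)
      (auto simp: ring_of_type_simps smult_add_left smult_add_right smult_smult
        intro: abelian_group_axioms)
  then show "assoc_algebra (ring_of_type_algebra :: 'k ring) M"
    by (intro assoc_algebra.intro assoc_algebra_axioms.intro ring_axioms)
      (auto simp: ring_of_type_simps smult_mult_left smult_mult_right)
qed

context type_algebra
begin

lemma smult_zero_left [simp]: "x \<in> carrier M \<Longrightarrow> 0 \<odot> x = \<zero>"
  using smult_add_left[of x 0 0] by (metis add.r_cancel_one' add_0 smult_closed)

lemma smult_zero_right [simp]: "c \<odot> \<zero> = \<zero>"
  using smult_add_right[of \<zero> \<zero> c] by (metis add.r_cancel_one' l_zero smult_closed zero_closed)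

lemma smult_minus_left: "x \<in> carrier M \<Longrightarrow> (- c) \<odot> x = \<ominus> (c \<odot> x)"
  using smult_add_left[of x c "- c"] by (metis add.inv_equality add.m_comm right_minus smult_closed smult_zero_left)

lemma smult_minus_right: "x \<in> carrier M \<Longrightarrow> c \<odot> (\<ominus> x) = \<ominus> (c \<odot> x)"
  by (metis add.inv_equality add.inv_closed l_neg smult_add_right smult_closed smult_zero_right)

lemma smult_diff_right: "\<lbrakk>x \<in> carrier M; y \<in> carrier M\<rbrakk> \<Longrightarrow> c \<odot> (x \<ominus> y) = c \<odot> x \<ominus> c \<odot> y"
  by (simp add: minus_eq smult_add_right smult_minus_right)

lemma smult_finsum:
  "finite A \<Longrightarrow> f \<in> A \<rightarrow> carrier M \<Longrightarrow> c \<odot> (\<Oplus>i\<in>A. f i) = (\<Oplus>i\<in>A. c \<odot> f i)"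
  by (induct set: finite) (simp_all add: Pi_def smult_add_right)

lemma minus_eq_zero_iff: "\<lbrakk>x \<in> carrier M; y \<in> carrier M\<rbrakk> \<Longrightarrow> x \<ominus> y = \<zero> \<longleftrightarrow> x = y"
  by (metis minus_eq r_neg add.inv_equality add.inv_closed minus_minus)

lemma smult_unit_cancel:
  assumes "c * d = 1" "x \<in> carrier M" "y \<in> carrier M" "c \<odot> x = c \<odot> y"
  shows "x = y"
  by (metis assms mult.commute smult_one smult_smult)

end

lemma ring_cong:
  assumes "ring M" "carrier N = carrier M" "monoid.mult N = monoid.mult M" "one N = one M"
    "ring.zero N = ring.zero M" "add N = add M"
  shows "ring N"
proof -
  interpret M: ring M by fact
  show ?thesis
  proof (rule ringI)
    show "abelian_group N"
      using M.add.l_inv_ex by (intro abelian_groupI) (auto simp: assms(2-) M.a_assoc M.a_comm M.a_lcomm)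
    show "Group.monoid N"
      by (rule monoidI) (auto simp: assms(2-) M.m_assoc)
  qed (auto simp: assms(2-) M.l_distr M.r_distr)
qed

lemma opposite_simps [simp]:
  "carrier (opposite A) = carrier A" "x \<otimes>\<^bsub>opposite A\<^esub> y = y \<otimes>\<^bsub>A\<^esub> x"
  "\<one>\<^bsub>opposite A\<^esub> = \<one>\<^bsub>A\<^esub>" "\<zero>\<^bsub>opposite A\<^esub> = \<zero>\<^bsub>A\<^esub>"
  "add (opposite A) = add A" "module.smult (opposite A) = module.smult A"
  by (simp_all add: opposite_def)

lemma opposite_type_algebra:
  assumes "type_algebra A"
  shows "type_algebra (opposite A)"
proof -
  interpret type_algebra A by fact
  have "ring (opposite A)"
  proof (rule ringI)
    show "abelian_group (opposite A)"
      using abelian_group_axioms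
      unfolding abelian_group_def abelian_monoid_def abelian_group_axioms_def by simp
    show "Group.monoid (opposite A)"
      by (rule monoidI) (auto simp: m_assoc)
  qed (auto simp: l_distr r_distr)
  then show ?thesis
    by (intro type_algebra.intro type_algebra_axioms.intro)
      (auto simp: smult_add_left smult_add_right smult_smult smult_mult_left smult_mult_right)
qed

section \<open>Homomorphisms\<close>

locale algebra_morphism = A: type_algebra A + B: type_algebra B
  for A :: "('k::comm_ring_1, 'a) module" and B :: "('k, 'b) module" +
  fixes f
  assumes in_algebra_hom: "f \<in> algebra_hom A B"
begin

lemma
  shows closed [simp, intro]: "x \<in> carrier A \<Longrightarrow> f x \<in> carrier B"
    and hom_add: "\<lbrakk>x \<in> carrier A; y \<in> carrier A\<rbrakk> \<Longrightarrow> f (x \<oplus>\<^bsub>A\<^esub> y) = f x \<oplus>\<^bsub>B\<^esub> f y"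
    and hom_mult: "\<lbrakk>x \<in> carrier A; y \<in> carrier A\<rbrakk> \<Longrightarrow> f (x \<otimes>\<^bsub>A\<^esub> y) = f x \<otimes>\<^bsub>B\<^esub> f y"
    and hom_one: "f \<one>\<^bsub>A\<^esub> = \<one>\<^bsub>B\<^esub>"
    and hom_smult: "x \<in> carrier A \<Longrightarrow> f (c \<odot>\<^bsub>A\<^esub> x) = c \<odot>\<^bsub>B\<^esub> f x"
  using in_algebra_hom
  by (auto simp: algebra_hom_def ring_hom_memE)

lemma hom_zero: "f \<zero>\<^bsub>A\<^esub> = \<zero>\<^bsub>B\<^esub>"
  using hom_smult[of "\<zero>\<^bsub>A\<^esub>" 0] by simp

lemma hom_minus: "\<lbrakk>x \<in> carrier A; y \<in> carrier A\<rbrakk> \<Longrightarrow> f (x \<ominus>\<^bsub>A\<^esub> y) = f x \<ominus>\<^bsub>B\<^esub> f y"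
  using hom_smult[of y "-1"]
  by (simp add: A.minus_eq B.minus_eq hom_add A.smult_minus_left B.smult_minus_left)

lemma hom_pow: "x \<in> carrier A \<Longrightarrow> f (x [^]\<^bsub>A\<^esub> (n::nat)) = f x [^]\<^bsub>B\<^esub> n"
  by (induction n) (simp_all add: hom_one hom_mult)

lemma hom_finsum:
  "finite I \<Longrightarrow> g \<in> I \<rightarrow> carrier A \<Longrightarrow> f (\<Oplus>\<^bsub>A\<^esub>i\<in>I. g i) = (\<Oplus>\<^bsub>B\<^esub>i\<in>I. f (g i))"
  by (induct set: finite) (simp_all add: Pi_def hom_zero hom_add)

end

lemma algebra_homI:
  assumes "\<And>x. x \<in> carrier A \<Longrightarrow> f x \<in> carrier B"
    "\<And>x y. \<lbrakk>x \<in> carrier A; y \<in> carrier A\<rbrakk> \<Longrightarrow> f (x \<oplus>\<^bsub>A\<^esub> y) = f x \<oplus>\<^bsub>B\<^esub> f y"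
    "\<And>x y. \<lbrakk>x \<in> carrier A; y \<in> carrier A\<rbrakk> \<Longrightarrow> f (x \<otimes>\<^bsub>A\<^esub> y) = f x \<otimes>\<^bsub>B\<^esub> f y"
    "f \<one>\<^bsub>A\<^esub> = \<one>\<^bsub>B\<^esub>"
    "\<And>c x. x \<in> carrier A \<Longrightarrow> f (c \<odot>\<^bsub>A\<^esub> x) = c \<odot>\<^bsub>B\<^esub> f x"
  shows "f \<in> algebra_hom A B"
  using assms by (auto simp: algebra_hom_def ring_hom_def)

lemma algebra_morphism_comp:
  assumes "algebra_morphism A B f" "algebra_morphism B C g"
  shows "algebra_morphism A C (\<lambda>x. g (f x))"
proof -
  interpret f: algebra_morphism A B f by fact
  interpret g: algebra_morphism B C g by fact
  show ?thesis
    by unfold_locales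
      (rule algebra_homI; simp add: f.hom_add g.hom_add f.hom_mult g.hom_mult f.hom_one g.hom_one
        f.hom_smult g.hom_smult)
qed

section \<open>Linear combinations\<close>

text \<open>
  The linear extension of \<open>g\<close> to the free module; \<^const>\<open>tensor_lift\<close> applies it to the elements of a coset.
\<close>

definition lincomb :: "('k::comm_ring_1, 'b) module \<Rightarrow> ('m \<Rightarrow> 'b) \<Rightarrow> ('m \<Rightarrow>\<^sub>0 'k) \<Rightarrow> 'b" where
  "lincomb N g p = (\<Oplus>\<^bsub>N\<^esub>x\<in>Poly_Mapping.keys p. Poly_Mapping.lookup p x \<odot>\<^bsub>N\<^esub> g x)"

lemma poly_mapping_span_induct [consumes 1, case_names zero add]:
  fixes p :: "'m \<Rightarrow>\<^sub>0 'k::comm_monoid_add"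
  assumes "Poly_Mapping.keys p \<subseteq> S" "P 0"
    and "\<And>x c p. \<lbrakk>x \<in> S; Poly_Mapping.keys p \<subseteq> S; P p\<rbrakk> \<Longrightarrow> P (Poly_Mapping.single x c + p)"
  shows "P p"
proof -
  have eq: "p = (\<Sum>x\<in>Poly_Mapping.keys p. Poly_Mapping.single x (Poly_Mapping.lookup p x))"
    by (rule poly_mapping_eqI)
      (simp add: lookup_sum lookup_single when_def in_keys_iff)
  have "Poly_Mapping.keys (\<Sum>x\<in>A. Poly_Mapping.single x (c x)) \<subseteq> S \<and>
      P (\<Sum>x\<in>A. Poly_Mapping.single x (c x))" if "finite A" "A \<subseteq> S" for A c
    using that
  proof (induction A)
    case (insert x A)
    have "Poly_Mapping.keys (Poly_Mapping.single x (c x) + q) \<subseteq> S"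
      if "Poly_Mapping.keys q \<subseteq> S" for q
      using that insert.prems keys_add[of "Poly_Mapping.single x (c x)" q] by (auto split: if_splits)
    with insert assms(3) show ?case by simp
  qed (simp add: assms(2))
  from this[OF finite_keys assms(1)] show ?thesis using eq by metis
qed

context type_algebra
begin

lemma lincomb_zero: "lincomb M g 0 = \<zero>"
  by (simp add: lincomb_def)

lemma lincomb_superset:
  assumes "finite K" "Poly_Mapping.keys p \<subseteq> K" "g \<in> K \<rightarrow> carrier M"
  shows "lincomb M g p = (\<Oplus>x\<in>K. Poly_Mapping.lookup p x \<odot> g x)"
  unfolding lincomb_def
  by (rule add.finprod_mono_neutral_cong_left)
    (use assms in \<open>auto simp: Pi_iff in_keys_iff\<close>)

context
  fixes S g
  assumes g: "g \<in> S \<rightarrow> carrier M"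
begin

lemma lincomb_closed: "Poly_Mapping.keys p \<subseteq> S \<Longrightarrow> lincomb M g p \<in> carrier M"
  unfolding lincomb_def using g by (auto intro!: finsum_closed)

lemma lincomb_add:
  assumes "Poly_Mapping.keys p \<subseteq> S" "Poly_Mapping.keys q \<subseteq> S"
  shows "lincomb M g (p + q) = lincomb M g p \<oplus> lincomb M g q"
proof -
  let ?K = "Poly_Mapping.keys p \<union> Poly_Mapping.keys q"
  have K: "finite ?K" "g \<in> ?K \<rightarrow> carrier M" using assms g by auto
  show ?thesis
    using K keys_add[of p q]
    by (simp add: lincomb_superset[of ?K] lookup_add smult_add_left Pi_iff finsum_addf
        cong: finsum_cong)
qed

lemma lincomb_single: "x \<in> S \<Longrightarrow> lincomb M g (Poly_Mapping.single x c) = c \<odot> g x"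
  using g lincomb_superset[of "{x}" "Poly_Mapping.single x c" g] by (auto simp: Pi_iff)

lemma lincomb_smult:
  assumes "Poly_Mapping.keys p \<subseteq> S"
  shows "lincomb M g (Poly_Mapping.map ((*) c) p) = c \<odot> lincomb M g p"
proof -
  have "g \<in> Poly_Mapping.keys p \<rightarrow> carrier M" using assms g by auto
  moreover have "Poly_Mapping.keys (Poly_Mapping.map ((*) c) p) \<subseteq> Poly_Mapping.keys p"
    by (auto simp: in_keys_iff map.rep_eq when_def)
  ultimately show ?thesis
    by (subst (1 2) lincomb_superset[of "Poly_Mapping.keys p"])
      (auto simp: map.rep_eq when_def smult_finsum Pi_iff smult_smult intro!: finsum_cong')
qed

end

end

section \<open>Monoid algebras\<close>

lemma monoid_algebra_simps:
  "carrier (monoid_algebra G) = {p. Poly_Mapping.keys p \<subseteq> carrier G}"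
  "\<one>\<^bsub>monoid_algebra G\<^esub> = Poly_Mapping.single \<one>\<^bsub>G\<^esub> 1"
  "\<zero>\<^bsub>monoid_algebra G\<^esub> = 0"
  "p \<oplus>\<^bsub>monoid_algebra G\<^esub> q = p + q"
  "c \<odot>\<^bsub>monoid_algebra G\<^esub> p = Poly_Mapping.map ((*) c) p"
  by (simp_all add: monoid_algebra_def)

lemma lookup_map_mult: "Poly_Mapping.lookup (Poly_Mapping.map ((*) c) p) x = c * Poly_Mapping.lookup p x"
  for c :: "'k::comm_ring_1"
  by (simp add: map.rep_eq when_def)

lemma map_mult_diff: "Poly_Mapping.map ((*) c) (p - q) = Poly_Mapping.map ((*) c) p - Poly_Mapping.map ((*) c) q"
  for c :: "'k::comm_ring_1"
  by (rule poly_mapping_eqI) (simp add: lookup_map_mult lookup_minus algebra_simps)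

lemma map_mult_simps:
  fixes c :: "'k::comm_ring_1"
  shows "Poly_Mapping.map ((*) c) (p + q) = Poly_Mapping.map ((*) c) p + Poly_Mapping.map ((*) c) q"
    and "Poly_Mapping.map ((*) (c + d)) p = Poly_Mapping.map ((*) c) p + Poly_Mapping.map ((*) d) p"
    and "Poly_Mapping.map ((*) c) (Poly_Mapping.map ((*) d) p) = Poly_Mapping.map ((*) (c * d)) p"
    and "Poly_Mapping.map ((*) 1) p = p"
    and "Poly_Mapping.map ((*) c) (Poly_Mapping.single x d) = Poly_Mapping.single x (c * d)"
    and "Poly_Mapping.map ((*) c) 0 = 0"
  by (auto intro!: poly_mapping_eqI
      simp: lookup_map_mult lookup_add algebra_simps when_def lookup_single)

lemma keys_map_mult: "Poly_Mapping.keys (Poly_Mapping.map ((*) c) p) \<subseteq> Poly_Mapping.keys p"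
  for c :: "'k::comm_ring_1"
  by (auto simp: in_keys_iff map.rep_eq when_def)

context
  fixes G :: "'m monoid"
begin

text \<open>
  The definition sums over the supports of the factors, which change under addition. Over fixed
  finite sets that contain the supports, bilinearity is visible.
\<close>

lemma monoid_algebra_mult_superset:
  fixes p q :: "'m \<Rightarrow>\<^sub>0 'k::comm_ring_1"
  assumes "finite K" "Poly_Mapping.keys p \<subseteq> K" "finite L" "Poly_Mapping.keys q \<subseteq> L"
  shows "p \<otimes>\<^bsub>monoid_algebra G\<^esub> q = (\<Sum>x\<in>K. \<Sum>y\<in>L.
       Poly_Mapping.single (x \<otimes>\<^bsub>G\<^esub> y) (Poly_Mapping.lookup p x * Poly_Mapping.lookup q y))"
proof -
  have "p \<otimes>\<^bsub>monoid_algebra G\<^esub> q = (\<Sum>x\<in>Poly_Mapping.keys p. \<Sum>y\<in>Poly_Mapping.keys q.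
       Poly_Mapping.single (x \<otimes>\<^bsub>G\<^esub> y) (Poly_Mapping.lookup p x * Poly_Mapping.lookup q y))"
    by (simp add: monoid_algebra_def)
  also have "\<dots> = (\<Sum>x\<in>Poly_Mapping.keys p. \<Sum>y\<in>L.
       Poly_Mapping.single (x \<otimes>\<^bsub>G\<^esub> y) (Poly_Mapping.lookup p x * Poly_Mapping.lookup q y))"
    by (intro sum.cong refl sum.mono_neutral_left) (use assms in \<open>auto simp: in_keys_iff\<close>)
  also have "\<dots> = (\<Sum>x\<in>K. \<Sum>y\<in>L.
       Poly_Mapping.single (x \<otimes>\<^bsub>G\<^esub> y) (Poly_Mapping.lookup p x * Poly_Mapping.lookup q y))"
    by (intro sum.mono_neutral_left) (use assms in \<open>auto simp: in_keys_iff\<close>)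
  finally show ?thesis .
qed

lemma monoid_algebra_distrib:
  fixes p q r :: "'m \<Rightarrow>\<^sub>0 'k::comm_ring_1"
  shows "(p + q) \<otimes>\<^bsub>monoid_algebra G\<^esub> r = p \<otimes>\<^bsub>monoid_algebra G\<^esub> r + q \<otimes>\<^bsub>monoid_algebra G\<^esub> r" "r \<otimes>\<^bsub>monoid_algebra G\<^esub> (p + q) = r \<otimes>\<^bsub>monoid_algebra G\<^esub> p + r \<otimes>\<^bsub>monoid_algebra G\<^esub> q"
proof -
  let ?X = "Poly_Mapping.keys p \<union> Poly_Mapping.keys q" and ?Y = "Poly_Mapping.keys r"
  note * = monoid_algebra_mult_superset[of ?X _ ?Y] monoid_algebra_mult_superset[of ?Y _ ?X]
    keys_add[of p q] lookup_add distrib_left distrib_right single_add sum.distrib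
  show "(p + q) \<otimes>\<^bsub>monoid_algebra G\<^esub> r = p \<otimes>\<^bsub>monoid_algebra G\<^esub> r + q \<otimes>\<^bsub>monoid_algebra G\<^esub> r" "r \<otimes>\<^bsub>monoid_algebra G\<^esub> (p + q) = r \<otimes>\<^bsub>monoid_algebra G\<^esub> p + r \<otimes>\<^bsub>monoid_algebra G\<^esub> q"
    by (simp_all add: *)
qed

lemma monoid_algebra_single:
  "Poly_Mapping.single x c \<otimes>\<^bsub>monoid_algebra G\<^esub> Poly_Mapping.single y d
    = Poly_Mapping.single (x \<otimes>\<^bsub>G\<^esub> y) (c * d :: 'k::comm_ring_1)"
  by (subst monoid_algebra_mult_superset[of "{x}" _ "{y}"]) auto

lemma monoid_algebra_zero: "p \<otimes>\<^bsub>monoid_algebra G\<^esub> 0 = (0 :: 'm \<Rightarrow>\<^sub>0 'k::comm_ring_1)" "0 \<otimes>\<^bsub>monoid_algebra G\<^esub> p = (0 :: 'm \<Rightarrow>\<^sub>0 'k)"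
  by (simp_all add: monoid_algebra_def)

lemma monoid_algebra_mult_smult:
  fixes p q :: "'m \<Rightarrow>\<^sub>0 'k::comm_ring_1"
  shows "Poly_Mapping.map ((*) c) p \<otimes>\<^bsub>monoid_algebra G\<^esub> q = Poly_Mapping.map ((*) c) (p \<otimes>\<^bsub>monoid_algebra G\<^esub> q)"
    "p \<otimes>\<^bsub>monoid_algebra G\<^esub> Poly_Mapping.map ((*) c) q = Poly_Mapping.map ((*) c) (p \<otimes>\<^bsub>monoid_algebra G\<^esub> q)"
proof -
  have map_sum: "Poly_Mapping.map ((*) c) (sum f A) = (\<Sum>x\<in>A. Poly_Mapping.map ((*) c) (f x))"
    for f :: "_ \<Rightarrow> 'm \<Rightarrow>\<^sub>0 'k" and A
    by (induction A rule: infinite_finite_induct) (simp_all add: map_mult_simps)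
  show "Poly_Mapping.map ((*) c) p \<otimes>\<^bsub>monoid_algebra G\<^esub> q = Poly_Mapping.map ((*) c) (p \<otimes>\<^bsub>monoid_algebra G\<^esub> q)"
    "p \<otimes>\<^bsub>monoid_algebra G\<^esub> Poly_Mapping.map ((*) c) q = Poly_Mapping.map ((*) c) (p \<otimes>\<^bsub>monoid_algebra G\<^esub> q)"
    using keys_map_mult[of c p] keys_map_mult[of c q]
    by (simp_all add: monoid_algebra_mult_superset[of "Poly_Mapping.keys p" _ "Poly_Mapping.keys q"]
      map_sum map_mult_simps map.rep_eq when_def)
      (intro sum.cong refl; auto simp: mult.assoc mult.left_commute)+
qed

end

lemma monoid_algebra_type_algebra:
  assumes "Group.monoid G"
  shows "type_algebra (monoid_algebra G :: ('k::comm_ring_1, 'm \<Rightarrow>\<^sub>0 'k) module)"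
    (is "type_algebra ?A")
proof -
  interpret G: Group.monoid G by fact
  note s = monoid_algebra_simps monoid_algebra_distrib monoid_algebra_zero
  have single_closed: "Poly_Mapping.single x c \<in> carrier ?A" if "x \<in> carrier G" for x c
    using that by (auto simp: s split: if_splits)
  have add_closed: "p + q \<in> carrier ?A" if "p \<in> carrier ?A" "q \<in> carrier ?A" for p q
    using that keys_add[of p q] by (auto simp: s)
  have "p \<in> carrier ?A \<Longrightarrow> q \<in> carrier ?A \<Longrightarrow> p \<otimes>\<^bsub>?A\<^esub> q \<in> carrier ?A" for p q
  proof -
    assume "p \<in> carrier ?A" "q \<in> carrier ?A"
    then have "Poly_Mapping.keys p \<subseteq> carrier G" "Poly_Mapping.keys q \<subseteq> carrier G"
      by (simp_all add: s)
    then show ?thesis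
    proof (induction p rule: poly_mapping_span_induct)
      case (add x c p)
      from add(4) have "Poly_Mapping.single x c \<otimes>\<^bsub>?A\<^esub> q \<in> carrier ?A"
      proof (induction q rule: poly_mapping_span_induct)
        case (add y d q)
        then show ?case using \<open>x \<in> carrier G\<close>
          by (auto simp: s(6-) monoid_algebra_single intro!: add_closed single_closed)
      qed (simp add: s)
      then show ?case using add by (auto simp: s(6-) intro!: add_closed)
    qed (simp add: s)
  qed
  note mult_closed = this
  have assoc: "(p \<otimes>\<^bsub>?A\<^esub> q) \<otimes>\<^bsub>?A\<^esub> r = p \<otimes>\<^bsub>?A\<^esub> (q \<otimes>\<^bsub>?A\<^esub> r)"
    if "p \<in> carrier ?A" "q \<in> carrier ?A" "r \<in> carrier ?A" for p q r
  proof -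
    from that have K: "Poly_Mapping.keys p \<subseteq> carrier G" "Poly_Mapping.keys q \<subseteq> carrier G"
       "Poly_Mapping.keys r \<subseteq> carrier G"
      by (simp_all add: s)
    have 1: "(Poly_Mapping.single x c \<otimes>\<^bsub>?A\<^esub> Poly_Mapping.single y d) \<otimes>\<^bsub>?A\<^esub> r
      = Poly_Mapping.single x c \<otimes>\<^bsub>?A\<^esub> (Poly_Mapping.single y d \<otimes>\<^bsub>?A\<^esub> r)"
      if "x \<in> carrier G" "y \<in> carrier G" for x y c d
      using K(3) that
      by (induction r rule: poly_mapping_span_induct)
        (simp_all add: s(6-) monoid_algebra_single G.m_assoc mult.assoc)
    have 2: "(Poly_Mapping.single x c \<otimes>\<^bsub>?A\<^esub> q) \<otimes>\<^bsub>?A\<^esub> r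
      = Poly_Mapping.single x c \<otimes>\<^bsub>?A\<^esub> (q \<otimes>\<^bsub>?A\<^esub> r)"
      if "x \<in> carrier G" for x c
      using K(2) that
      by (induction q rule: poly_mapping_span_induct) (simp_all add: s(6-) 1)
    show ?thesis
      using K(1) by (induction p rule: poly_mapping_span_induct) (simp_all add: s(6-) 2)
  qed
  have unit: "\<one>\<^bsub>?A\<^esub> \<otimes>\<^bsub>?A\<^esub> p = p" "p \<otimes>\<^bsub>?A\<^esub> \<one>\<^bsub>?A\<^esub> = p" if "p \<in> carrier ?A" for p
  proof -
    from that have "Poly_Mapping.keys p \<subseteq> carrier G" by (simp add: s)
    then have "\<one>\<^bsub>?A\<^esub> \<otimes>\<^bsub>?A\<^esub> p = p \<and> p \<otimes>\<^bsub>?A\<^esub> \<one>\<^bsub>?A\<^esub> = p"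
      by (induction p rule: poly_mapping_span_induct) (simp_all add: s monoid_algebra_single)
    then show "\<one>\<^bsub>?A\<^esub> \<otimes>\<^bsub>?A\<^esub> p = p" "p \<otimes>\<^bsub>?A\<^esub> \<one>\<^bsub>?A\<^esub> = p" by blast+
  qed
  have "ring ?A"
  proof (rule ringI)
    show "abelian_group ?A"
    proof (rule abelian_groupI)
      fix p assume "p \<in> carrier ?A"
      then show "\<exists>q\<in>carrier ?A. q \<oplus>\<^bsub>?A\<^esub> p = \<zero>\<^bsub>?A\<^esub>"
        by (intro bexI[of _ "- p"]) (auto simp: s in_keys_iff)
    qed (use add_closed in \<open>auto simp: s\<close>)
    show "Group.monoid ?A"
      using mult_closed assoc unit single_closed by (intro monoidI) (auto simp: s(2))
  qed (simp_all add: s)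
  then show ?thesis
    by (intro type_algebra.intro type_algebra_axioms.intro)
      (use keys_map_mult in \<open>fastforce simp: s map_mult_simps monoid_algebra_mult_smult\<close>)+
qed

text \<open>
  The universal property of a monoid algebra: by bilinearity, multiplicativity needs to hold for
  monoid elements only.
\<close>

lemma lincomb_monoid_algebra_hom:
  assumes "Group.monoid G" and N: "type_algebra (N :: ('k::comm_ring_1, 'b) module)"
    and g: "g \<in> carrier G \<rightarrow> carrier N"
    and g_mult: "\<And>x y. \<lbrakk>x \<in> carrier G; y \<in> carrier G\<rbrakk> \<Longrightarrow> g (x \<otimes>\<^bsub>G\<^esub> y) = g x \<otimes>\<^bsub>N\<^esub> g y"
    and g_one: "g \<one>\<^bsub>G\<^esub> = \<one>\<^bsub>N\<^esub>"
  shows "algebra_morphism (monoid_algebra G) N (lincomb N g)"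
proof -
  interpret G: Group.monoid G by fact
  interpret N: type_algebra N by fact
  interpret A: type_algebra "monoid_algebra G :: ('k, _) module"
    by (rule monoid_algebra_type_algebra) fact
  let ?A = "monoid_algebra G :: ('k, _) module"
  note lc = N.lincomb_add[OF g] N.lincomb_single[OF g] N.lincomb_zero N.lincomb_closed[OF g]
  have mult_closed: "Poly_Mapping.keys (p \<otimes>\<^bsub>?A\<^esub> q) \<subseteq> carrier G"
    if "Poly_Mapping.keys p \<subseteq> carrier G" "Poly_Mapping.keys q \<subseteq> carrier G" for p q
    using A.m_closed[of p q] that by (simp add: monoid_algebra_simps)
  have sc: "Poly_Mapping.keys (Poly_Mapping.single x c) \<subseteq> carrier G" if "x \<in> carrier G" for x and c :: 'k
    using that by auto
  note s = monoid_algebra_distrib monoid_algebra_zero monoid_algebra_single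
  have 1: "lincomb N g (Poly_Mapping.single x c \<otimes>\<^bsub>?A\<^esub> q)
      = lincomb N g (Poly_Mapping.single x c) \<otimes>\<^bsub>N\<^esub> lincomb N g q"
    if "Poly_Mapping.keys q \<subseteq> carrier G" "x \<in> carrier G" for x c q
    using that g
    by (induction q rule: poly_mapping_span_induct)
      (auto simp: s lc sc mult_closed g_mult N.smult_mult_left N.smult_mult_right N.smult_smult
        N.r_distr Pi_iff mult.commute simp del: keys_single)
  have 2: "lincomb N g (p \<otimes>\<^bsub>?A\<^esub> q) = lincomb N g p \<otimes>\<^bsub>N\<^esub> lincomb N g q"
    if "Poly_Mapping.keys p \<subseteq> carrier G" "Poly_Mapping.keys q \<subseteq> carrier G" for p q
    using that g
    by (induction p rule: poly_mapping_span_induct)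
      (auto simp: 1 s lc sc mult_closed N.l_distr Pi_iff simp del: keys_single)
  show ?thesis
    by unfold_locales
      (rule algebra_homI; use g in \<open>simp add: monoid_algebra_simps lc 2 N.lincomb_smult[OF g] g_one\<close>)
qed

section \<open>Quotient algebras\<close>

lemma quot_algebra_simps:
  "carrier (quot_algebra A J) = (\<lambda>x. J +>\<^bsub>A\<^esub> x) ` carrier A"
  "monoid.mult (quot_algebra A J) = rcoset_mult A J"
  "\<one>\<^bsub>quot_algebra A J\<^esub> = J +>\<^bsub>A\<^esub> \<one>\<^bsub>A\<^esub>"
  "\<zero>\<^bsub>quot_algebra A J\<^esub> = J"
  "add (quot_algebra A J) = set_add A"
  "c \<odot>\<^bsub>quot_algebra A J\<^esub> C = (\<Union>x\<in>C. J +>\<^bsub>A\<^esub> (c \<odot>\<^bsub>A\<^esub> x))"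
  by (auto simp: quot_algebra_def FactRing_def A_RCOSETS_def' a_r_coset_def')

locale algebra_ideal = type_algebra A + ideal J A
  for A :: "('k::comm_ring_1, 'a) module" (structure) and J
begin

lemma ideal_smult: "x \<in> J \<Longrightarrow> c \<odot> x \<in> J"
  using I_l_closed[of x "c \<odot> \<one>"] a_Hcarr[of x] by (simp add: smult_mult_left)

lemma coset_eq_iff: "\<lbrakk>x \<in> carrier A; y \<in> carrier A\<rbrakk> \<Longrightarrow> J +> x = J +> y \<longleftrightarrow> x \<ominus> y \<in> J"
  using a_rcos_module_minus[OF ring_axioms, of y x] a_rcos_self[of x] a_repr_independence'[of x y]
  by auto

text \<open>
  All members of a coset give the same multiple, because an ideal of an algebra is a submodule; so
  the union in \<^const>\<open>quot_algebra\<close> has a single distinct member.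
\<close>

lemma coset_smult: "x \<in> carrier A \<Longrightarrow> c \<odot>\<^bsub>quot_algebra A J\<^esub> (J +> x) = J +> (c \<odot> x)"
proof -
  assume x: "x \<in> carrier A"
  have "J +> (c \<odot> y) = J +> (c \<odot> x)" if "y \<in> J +> x" for y
  proof -
    from that x obtain z where z: "z \<in> J" "y = z \<oplus> x" by (auto simp: a_r_coset_def')
    then have "c \<odot> y \<ominus> c \<odot> x = c \<odot> z"
      using x a_Hcarr by (simp add: smult_add_right minus_eq a_assoc r_neg)
    then show ?thesis
      using x z a_Hcarr ideal_smult by (subst coset_eq_iff) auto
  qed
  moreover have "x \<in> J +> x" using x by (rule a_rcos_self)
  ultimately show ?thesis unfolding quot_algebra_simps by blast
qed

lemma quot_type_algebra: "type_algebra (quot_algebra A J)"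
proof -
  note s = quot_algebra_simps(1-5) rcoset_mult_add a_rcos_sum coset_smult
  have "ring (quot_algebra A J)"
    by (rule ring_cong[OF quotient_is_ring]) (simp_all add: quot_algebra_def)
  then show ?thesis
    by (intro type_algebra.intro type_algebra_axioms.intro)
      (auto simp: s smult_add_left smult_add_right smult_smult smult_mult_left smult_mult_right)
qed

lemma coset_morphism: "algebra_morphism A (quot_algebra A J) (\<lambda>x. J +> x)"
  by (intro algebra_morphism.intro algebra_morphism_axioms.intro quot_type_algebra type_algebra_axioms
      algebra_homI)
    (auto simp: quot_algebra_simps(1-5) rcoset_mult_add a_rcos_sum coset_smult)

text \<open>
  Evaluates the maps on cosets that are written with \<^const>\<open>the_elem\<close>, both \<^const>\<open>tensor_lift\<close> and the
  map induced by a morphism that vanishes on \<open>J\<close>.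
\<close>

lemma the_elem_image_coset:
  assumes x: "x \<in> carrier A"
    and f: "\<And>z. z \<in> J \<Longrightarrow> f (z \<oplus> x) = f x"
  shows "the_elem (f ` (J +> x)) = f x"
proof -
  have "f ` (J +> x) = {f x}"
    using f a_rcos_self[OF x] by (auto simp: a_r_coset_def')
  then show ?thesis by simp
qed

end

context algebra_morphism
begin

lemma kernel_ideal: "ideal {x \<in> carrier A. f x = \<zero>\<^bsub>B\<^esub>} A"
proof -
  have "ring_hom_ring A B f"
    using in_algebra_hom by (intro ring_hom_ringI2) (auto simp: algebra_hom_def A.ring_axioms B.ring_axioms)
  then show ?thesis using ring_hom_ring.kernel_is_ideal by (fastforce simp: a_kernel_def')
qed

lemma factor_through_quotient:
  assumes "algebra_ideal A J" and zero: "\<And>z. z \<in> J \<Longrightarrow> f z = \<zero>\<^bsub>B\<^esub>"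
  shows "\<exists>g. algebra_morphism (quot_algebra A J) B g \<and> (\<forall>x\<in>carrier A. g (J +>\<^bsub>A\<^esub> x) = f x)"
proof -
  interpret J: algebra_ideal A J by fact
  let ?g = "\<lambda>C. the_elem (f ` C)"
  have g: "?g (J +>\<^bsub>A\<^esub> x) = f x" if "x \<in> carrier A" for x
    using that zero J.a_Hcarr by (intro J.the_elem_image_coset) (auto simp: hom_add)
  have "?g \<in> algebra_hom (quot_algebra A J) B"
    by (rule algebra_homI)
      (auto simp: g quot_algebra_simps(1-5) J.rcoset_mult_add J.a_rcos_sum J.coset_smult
        hom_add hom_mult hom_smult hom_one)
  then show ?thesis
    using g J.quot_type_algebra B.type_algebra_axioms
    by (auto simp: algebra_morphism_def algebra_morphism_axioms_def)
qed

end

section \<open>Generated submodules\<close>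

context type_algebra
begin

lemma type_submodule_iff:
  "submodule H (ring_of_type_algebra :: 'k ring) M \<longleftrightarrow>
    H \<subseteq> carrier M \<and> \<zero> \<in> H \<and> (\<forall>x\<in>H. \<forall>y\<in>H. x \<oplus> y \<in> H) \<and> (\<forall>c. \<forall>x\<in>H. c \<odot> x \<in> H)"
    (is "?l \<longleftrightarrow> ?r")
proof
  assume ?l
  then interpret submodule H "ring_of_type_algebra :: 'k ring" M .
  show ?r
    using subset one_closed m_closed smult_closed by (auto simp: ring_of_type_simps)
next
  assume r: ?r
  show ?l
  proof (intro submodule.intro submodule_axioms.intro add.subgroupI)
    show "\<ominus> x \<in> H" if "x \<in> H" for x
      using r that smult_minus_left[of x 1] by (metis smult_one subsetD)
  qed (use r in auto)
qed

context
  fixes S assumes S: "S \<subseteq> carrier M"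
begin

lemma gen_submodule_submodule: "submodule (gen_submodule M S) (ring_of_type_algebra :: 'k ring) M"
proof -
  have "submodule (carrier M) (ring_of_type_algebra :: 'k ring) M"
    by (simp add: type_submodule_iff)
  then show ?thesis
    using S unfolding gen_submodule_def type_submodule_iff by blast
qed

lemma gen_submodule_incl: "S \<subseteq> gen_submodule M S"
  unfolding gen_submodule_def by blast

lemma gen_submodule_minimal:
  "\<lbrakk>submodule H (ring_of_type_algebra :: 'k ring) M; S \<subseteq> H\<rbrakk> \<Longrightarrow> gen_submodule M S \<subseteq> H"
  unfolding gen_submodule_def by blast

end

end

section \<open>Tensor products\<close>

lemma listset_iff_nth:
  "xs \<in> listset Ss \<longleftrightarrow> length xs = length Ss \<and> (\<forall>i<length Ss. xs ! i \<in> Ss ! i)"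
proof (induction Ss arbitrary: xs)
  case (Cons S Ss)
  then show ?case
    by (cases xs) (auto simp: set_Cons_def All_less_Suc2 nth_Cons')
qed simp

definition multilinear ::
  "('k::comm_ring_1, 'a) module list \<Rightarrow> ('k, 'b) module \<Rightarrow> ('a list \<Rightarrow> 'b) \<Rightarrow> bool" where
  "multilinear As N g \<longleftrightarrow>
    (\<forall>xs \<in> listset (map carrier As). g xs \<in> carrier N \<and>
      (\<forall>i<length As. \<forall>x\<in>carrier (As ! i).
        (\<forall>y\<in>carrier (As ! i).
          g (xs[i := x \<oplus>\<^bsub>As ! i\<^esub> y]) = g (xs[i := x]) \<oplus>\<^bsub>N\<^esub> g (xs[i := y])) \<and>
        (\<forall>c. g (xs[i := c \<odot>\<^bsub>As ! i\<^esub> x]) = c \<odot>\<^bsub>N\<^esub> g (xs[i := x]))))"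

text \<open>
  At least one factor is required: only then can a scalar be moved into a pure tensor, so that every
  element is a sum of pure tensors.
\<close>

locale tensor_factors =
  fixes As :: "('k::comm_ring_1, 'a) module list"
  assumes factor_type_algebra: "i < length As \<Longrightarrow> type_algebra (As ! i)"
    and nonempty: "As \<noteq> []"
begin

abbreviation (input) tuples where "tuples \<equiv> listset (map carrier As)"
abbreviation (input) tmult (infixl "\<star>" 70) where "tmult \<equiv> monoid.mult (tuple_monoid As)"

lemma tuples_iff: "xs \<in> tuples \<longleftrightarrow> length xs = length As \<and> (\<forall>i<length As. xs ! i \<in> carrier (As ! i))"
  by (simp add: listset_iff_nth)

lemma tuple_mult_nth:
  assumes "xs \<in> tuples" "ys \<in> tuples"
  shows "length (xs \<star> ys) = length As"
    "i < length As \<Longrightarrow> (xs \<star> ys) ! i = xs ! i \<otimes>\<^bsub>As ! i\<^esub> ys ! i"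
  using assms by (auto simp: tuple_monoid_def tuples_iff)

lemma tuple_monoid_carrier: "carrier (tuple_monoid As) = tuples"
  by (simp add: tuple_monoid_def)

lemma tuple_monoid_one: "\<one>\<^bsub>tuple_monoid As\<^esub> = map one As"
  by (simp add: tuple_monoid_def)

lemma tuple_mult_closed: "\<lbrakk>xs \<in> tuples; ys \<in> tuples\<rbrakk> \<Longrightarrow> xs \<star> ys \<in> tuples"
  unfolding tuples_iff[of "xs \<star> ys"]
  by (auto simp: tuple_mult_nth tuples_iff intro!: ring.ring_simprules(5)
      type_algebra.axioms(1)[OF factor_type_algebra])

lemma one_tuple: "map one As \<in> tuples"
  by (auto simp: tuples_iff intro!: ring.ring_simprules(6) type_algebra.axioms(1)[OF factor_type_algebra])

lemma tuple_monoid: "Group.monoid (tuple_monoid As)"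
proof (rule monoidI; unfold tuple_monoid_carrier tuple_monoid_one)
  fix xs ys zs assume t: "xs \<in> tuples" "ys \<in> tuples" "zs \<in> tuples"
  show "xs \<star> ys \<star> zs = xs \<star> (ys \<star> zs)"
  proof (rule nth_equalityI)
    fix i assume "i < length (xs \<star> ys \<star> zs)"
    then have i: "i < length As" using t by (simp add: tuple_mult_nth tuple_mult_closed)
    interpret type_algebra "As ! i" by (rule factor_type_algebra) fact
    show "(xs \<star> ys \<star> zs) ! i = (xs \<star> (ys \<star> zs)) ! i"
      using t i by (simp add: tuple_mult_nth tuple_mult_closed) (simp add: tuples_iff m_assoc)
  qed (use t in \<open>simp add: tuple_mult_nth tuple_mult_closed\<close>)
next
  fix xs assume t: "xs \<in> tuples"
  show "map one As \<star> xs = xs" "xs \<star> map one As = xs"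
  proof -
    have "map one As ! i \<otimes>\<^bsub>As ! i\<^esub> xs ! i = xs ! i \<and> xs ! i \<otimes>\<^bsub>As ! i\<^esub> map one As ! i = xs ! i"
      if i: "i < length As" for i
    proof -
      interpret type_algebra "As ! i" by (rule factor_type_algebra) fact
      show ?thesis using t i by (simp add: tuples_iff)
    qed
    then show "map one As \<star> xs = xs" "xs \<star> map one As = xs"
      using t one_tuple by (auto intro!: nth_equalityI simp: tuple_mult_nth) (simp_all add: tuples_iff)
  qed
qed (auto simp: tuple_mult_closed one_tuple)

sublocale tuple: type_algebra "tuple_algebra As"
  unfolding tuple_algebra_def by (rule monoid_algebra_type_algebra[OF tuple_monoid])

lemma tuple_algebra_simps:
  fixes p q r :: "'a list \<Rightarrow>\<^sub>0 'k"
  shows "carrier (tuple_algebra As) = {p. Poly_Mapping.keys p \<subseteq> tuples}"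
    and "\<one>\<^bsub>tuple_algebra As\<^esub> = Poly_Mapping.single (map one As) 1"
    and "\<zero>\<^bsub>tuple_algebra As\<^esub> = 0"
    and "p \<oplus>\<^bsub>tuple_algebra As\<^esub> q = p + q"
    and "c \<odot>\<^bsub>tuple_algebra As\<^esub> p = Poly_Mapping.map ((*) c) p"
    and "(p + q) \<otimes>\<^bsub>tuple_algebra As\<^esub> r = p \<otimes>\<^bsub>tuple_algebra As\<^esub> r + q \<otimes>\<^bsub>tuple_algebra As\<^esub> r"
    and "r \<otimes>\<^bsub>tuple_algebra As\<^esub> (p + q) = r \<otimes>\<^bsub>tuple_algebra As\<^esub> p + r \<otimes>\<^bsub>tuple_algebra As\<^esub> q"
    and "p \<otimes>\<^bsub>tuple_algebra As\<^esub> 0 = 0" and "0 \<otimes>\<^bsub>tuple_algebra As\<^esub> p = 0"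
    and "Poly_Mapping.single xs c \<otimes>\<^bsub>tuple_algebra As\<^esub> Poly_Mapping.single ys d
      = Poly_Mapping.single (xs \<star> ys) (c * d)"
  by (simp_all add: tuple_algebra_def monoid_algebra_simps monoid_algebra_distrib monoid_algebra_zero
      monoid_algebra_single tuple_monoid_carrier tuple_monoid_one)

lemma monoid_algebra_diff:
  fixes p q r :: "'a list \<Rightarrow>\<^sub>0 'k"
  shows "(p - q) \<otimes>\<^bsub>tuple_algebra As\<^esub> r = p \<otimes>\<^bsub>tuple_algebra As\<^esub> r - q \<otimes>\<^bsub>tuple_algebra As\<^esub> r"
    "r \<otimes>\<^bsub>tuple_algebra As\<^esub> (p - q) = r \<otimes>\<^bsub>tuple_algebra As\<^esub> p - r \<otimes>\<^bsub>tuple_algebra As\<^esub> q"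
  using tuple_algebra_simps(6)[of "p - q" q r] tuple_algebra_simps(7)[of r "p - q" q]
  by (simp_all add: algebra_simps)

lemma update_tuple: "\<lbrakk>xs \<in> tuples; x \<in> carrier (As ! i)\<rbrakk> \<Longrightarrow> xs[i := x] \<in> tuples"
  by (cases "i < length xs") (auto simp: tuples_iff nth_list_update)

lemma tuple_mult_update:
  assumes "xs \<in> tuples" "zs \<in> tuples" "i < length As" "x \<in> carrier (As ! i)"
  shows "zs \<star> xs[i := x] = (zs \<star> xs)[i := zs ! i \<otimes>\<^bsub>As ! i\<^esub> x]"
    "xs[i := x] \<star> zs = (xs \<star> zs)[i := x \<otimes>\<^bsub>As ! i\<^esub> zs ! i]"
proof -
  have u: "xs[i := x] \<in> tuples" using assms by (simp add: update_tuple)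
  have l: "length xs = length As" using assms by (simp add: tuples_iff)
  show "zs \<star> xs[i := x] = (zs \<star> xs)[i := zs ! i \<otimes>\<^bsub>As ! i\<^esub> x]"
    "xs[i := x] \<star> zs = (xs \<star> zs)[i := x \<otimes>\<^bsub>As ! i\<^esub> zs ! i]"
    using assms(1-3) u l
    by (intro nth_equalityI; simp add: tuple_mult_nth nth_list_update)+
qed

lemma factor_closed:
  assumes "i < length As" "x \<in> carrier (As ! i)"
  shows "y \<in> carrier (As ! i) \<Longrightarrow> x \<oplus>\<^bsub>As ! i\<^esub> y \<in> carrier (As ! i)"
    "c \<odot>\<^bsub>As ! i\<^esub> x \<in> carrier (As ! i)"
proof -
  interpret type_algebra "As ! i" by (rule factor_type_algebra) fact
  show "y \<in> carrier (As ! i) \<Longrightarrow> x \<oplus>\<^bsub>As ! i\<^esub> y \<in> carrier (As ! i)"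
    "c \<odot>\<^bsub>As ! i\<^esub> x \<in> carrier (As ! i)"
    using assms by auto
qed

lemma multilinear_rels_carrier: "multilinear_rels As \<subseteq> carrier (tuple_algebra As)"
proof
  have single: "Poly_Mapping.single xs c \<in> carrier (tuple_algebra As)" if "xs \<in> tuples" for xs and c :: 'k
    using that by (simp add: tuple_algebra_simps)
  have diff: "p - q \<in> carrier (tuple_algebra As)"
    if "p \<in> carrier (tuple_algebra As)" "q \<in> carrier (tuple_algebra As)" for p q :: "'a list \<Rightarrow>\<^sub>0 'k"
    using that keys_diff[of p q] by (auto simp: tuple_algebra_simps)
  fix r assume "r \<in> multilinear_rels As"
  then show "r \<in> carrier (tuple_algebra As)"
    by induction (intro diff single update_tuple factor_closed; assumption)+
qed

lemmas tensor_null_submodule =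
  tuple.gen_submodule_submodule[OF multilinear_rels_carrier, folded tensor_null_def, unfolded tuple.type_submodule_iff]

text \<open>
  Multiplying a pure tensor by another one multiplies each slot by a fixed element, which is a linear
  operation on that slot. A multilinearity relation is therefore sent to a multilinearity relation,
  up to the scalar of the multiplier.
\<close>

lemma multilinear_rels_mult:
  assumes r: "r \<in> multilinear_rels As" and p: "p \<in> carrier (tuple_algebra As)"
  shows "p \<otimes>\<^bsub>tuple_algebra As\<^esub> r \<in> tensor_null As \<and> r \<otimes>\<^bsub>tuple_algebra As\<^esub> p \<in> tensor_null As"
proof -
  have incl: "multilinear_rels As \<subseteq> tensor_null As"
    unfolding tensor_null_def by (rule tuple.gen_submodule_incl[OF multilinear_rels_carrier])
  have null_smult: "d \<odot>\<^bsub>tuple_algebra As\<^esub> s \<in> tensor_null As" if "s \<in> multilinear_rels As" for d s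
    using incl that tensor_null_submodule by (auto simp only:)
  have "Poly_Mapping.keys p \<subseteq> tuples" using p by (simp add: tuple_algebra_simps)
  then show ?thesis
  proof (induction rule: poly_mapping_span_induct)
    case zero
    then show ?case using tensor_null_submodule by (simp add: tuple_algebra_simps)
  next
    case (add zs d p)
    have "Poly_Mapping.single zs d \<otimes>\<^bsub>tuple_algebra As\<^esub> r \<in> (\<lambda>p. d \<odot>\<^bsub>tuple_algebra As\<^esub> p) ` multilinear_rels As
      \<and> r \<otimes>\<^bsub>tuple_algebra As\<^esub> Poly_Mapping.single zs d \<in> (\<lambda>p. d \<odot>\<^bsub>tuple_algebra As\<^esub> p) ` multilinear_rels As"
      using r
    proof cases
      case (additive xs i x y)
      interpret type_algebra "As ! i" by (rule factor_type_algebra) fact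
      have z: "zs ! i \<in> carrier (As ! i)" using add(1) additive by (simp add: tuples_iff)
      note c = tuple_mult_closed[OF add(1) additive(2)] tuple_mult_closed[OF additive(2) add(1)]
      have L: "Poly_Mapping.single ((zs \<star> xs)[i := zs ! i \<otimes>\<^bsub>As ! i\<^esub> x \<oplus>\<^bsub>As ! i\<^esub> zs ! i \<otimes>\<^bsub>As ! i\<^esub> y]) 1
          - Poly_Mapping.single ((zs \<star> xs)[i := zs ! i \<otimes>\<^bsub>As ! i\<^esub> x]) 1
          - Poly_Mapping.single ((zs \<star> xs)[i := zs ! i \<otimes>\<^bsub>As ! i\<^esub> y]) 1 \<in> multilinear_rels As"
        and R: "Poly_Mapping.single ((xs \<star> zs)[i := x \<otimes>\<^bsub>As ! i\<^esub> zs ! i \<oplus>\<^bsub>As ! i\<^esub> y \<otimes>\<^bsub>As ! i\<^esub> zs ! i]) 1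
          - Poly_Mapping.single ((xs \<star> zs)[i := x \<otimes>\<^bsub>As ! i\<^esub> zs ! i]) 1
          - Poly_Mapping.single ((xs \<star> zs)[i := y \<otimes>\<^bsub>As ! i\<^esub> zs ! i]) 1 \<in> multilinear_rels As"
        using additive z c by (auto intro!: multilinear_rels.additive)
      note s = monoid_algebra_diff tuple_algebra_simps tuple_mult_update r_distr l_distr
        map_mult_simps map_mult_diff
      show ?thesis
      proof
        show "Poly_Mapping.single zs d \<otimes>\<^bsub>tuple_algebra As\<^esub> r
            \<in> (\<lambda>p. d \<odot>\<^bsub>tuple_algebra As\<^esub> p) ` multilinear_rels As"
          by (rule image_eqI[OF _ L]) (use additive add(1) z in \<open>simp add: s\<close>)
        show "r \<otimes>\<^bsub>tuple_algebra As\<^esub> Poly_Mapping.single zs d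
            \<in> (\<lambda>p. d \<odot>\<^bsub>tuple_algebra As\<^esub> p) ` multilinear_rels As"
          by (rule image_eqI[OF _ R]) (use additive add(1) z in \<open>simp add: s\<close>)
      qed
    next
      case (homogeneous xs i x c)
      interpret type_algebra "As ! i" by (rule factor_type_algebra) fact
      have z: "zs ! i \<in> carrier (As ! i)" using add(1) homogeneous by (simp add: tuples_iff)
      note cl = tuple_mult_closed[OF add(1) homogeneous(2)] tuple_mult_closed[OF homogeneous(2) add(1)]
      have L: "Poly_Mapping.single ((zs \<star> xs)[i := c \<odot>\<^bsub>As ! i\<^esub> (zs ! i \<otimes>\<^bsub>As ! i\<^esub> x)]) 1
          - Poly_Mapping.single ((zs \<star> xs)[i := zs ! i \<otimes>\<^bsub>As ! i\<^esub> x]) c \<in> multilinear_rels As"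
        and R: "Poly_Mapping.single ((xs \<star> zs)[i := c \<odot>\<^bsub>As ! i\<^esub> (x \<otimes>\<^bsub>As ! i\<^esub> zs ! i)]) 1
          - Poly_Mapping.single ((xs \<star> zs)[i := x \<otimes>\<^bsub>As ! i\<^esub> zs ! i]) c \<in> multilinear_rels As"
        using homogeneous z cl by (auto intro!: multilinear_rels.homogeneous)
      note s = monoid_algebra_diff tuple_algebra_simps tuple_mult_update smult_mult_left
        smult_mult_right map_mult_simps map_mult_diff mult.commute[of d c]
      show ?thesis
      proof
        show "Poly_Mapping.single zs d \<otimes>\<^bsub>tuple_algebra As\<^esub> r
            \<in> (\<lambda>p. d \<odot>\<^bsub>tuple_algebra As\<^esub> p) ` multilinear_rels As"
          by (rule image_eqI[OF _ L]) (use homogeneous add(1) z in \<open>simp add: s\<close>)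
        show "r \<otimes>\<^bsub>tuple_algebra As\<^esub> Poly_Mapping.single zs d
            \<in> (\<lambda>p. d \<odot>\<^bsub>tuple_algebra As\<^esub> p) ` multilinear_rels As"
          by (rule image_eqI[OF _ R]) (use homogeneous add(1) z in \<open>simp add: s\<close>)
      qed
    qed
    then have "Poly_Mapping.single zs d \<otimes>\<^bsub>tuple_algebra As\<^esub> r \<in> tensor_null As"
       "r \<otimes>\<^bsub>tuple_algebra As\<^esub> Poly_Mapping.single zs d \<in> tensor_null As"
      using null_smult by auto
    with add.IH show ?case
      using tensor_null_submodule by (simp add: tuple_algebra_simps(4,6,7))
  qed
qed

sublocale null: algebra_ideal "tuple_algebra As" "tensor_null As"
proof (intro algebra_ideal.intro tuple.type_algebra_axioms idealI tuple.ring_axioms)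
  let ?T = "tuple_algebra As"
  show "subgroup (tensor_null As) (add_monoid ?T)"
    using tuple.gen_submodule_submodule[OF multilinear_rels_carrier]
    by (simp add: tensor_null_def submodule_def)
  let ?H = "{r \<in> carrier ?T. \<forall>p\<in>carrier ?T.
    p \<otimes>\<^bsub>?T\<^esub> r \<in> tensor_null As \<and> r \<otimes>\<^bsub>?T\<^esub> p \<in> tensor_null As}"
  have "submodule ?H (ring_of_type_algebra :: 'k ring) ?T"
    using tensor_null_submodule
    by (auto simp: tuple.type_submodule_iff tuple.l_distr tuple.r_distr tuple.smult_mult_left
        tuple.smult_mult_right)
  moreover have "multilinear_rels As \<subseteq> ?H"
    using multilinear_rels_mult multilinear_rels_carrier by blast
  ultimately have "tensor_null As \<subseteq> ?H"
    unfolding tensor_null_def by (rule tuple.gen_submodule_minimal[OF multilinear_rels_carrier])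
  then show "\<And>a x. \<lbrakk>a \<in> tensor_null As; x \<in> carrier ?T\<rbrakk> \<Longrightarrow> x \<otimes>\<^bsub>?T\<^esub> a \<in> tensor_null As"
    "\<And>a x. \<lbrakk>a \<in> tensor_null As; x \<in> carrier ?T\<rbrakk> \<Longrightarrow> a \<otimes>\<^bsub>?T\<^esub> x \<in> tensor_null As"
    by blast+
qed

sublocale T: type_algebra "tensor_algebra As"
  unfolding tensor_algebra_def by (rule null.quot_type_algebra)

sublocale proj: algebra_morphism "tuple_algebra As" "tensor_algebra As"
    "\<lambda>p. tensor_null As +>\<^bsub>tuple_algebra As\<^esub> p"
  unfolding tensor_algebra_def by (rule null.coset_morphism)

lemma tensor_carrier:
  "carrier (tensor_algebra As) = (\<lambda>p. tensor_null As +>\<^bsub>tuple_algebra As\<^esub> p) ` carrier (tuple_algebra As)"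
  by (simp add: tensor_algebra_def quot_algebra_simps)

lemma single_closed: "xs \<in> tuples \<Longrightarrow> Poly_Mapping.single xs c \<in> carrier (tuple_algebra As)"
  by (simp add: tuple_algebra_simps)

lemma pure_closed [simp, intro]: "xs \<in> tuples \<Longrightarrow> pure_tensor As xs \<in> carrier (tensor_algebra As)"
  unfolding pure_tensor_def by (intro proj.closed single_closed)

lemma pure_one: "\<one>\<^bsub>tensor_algebra As\<^esub> = pure_tensor As (map one As)"
  using proj.hom_one by (simp add: pure_tensor_def tuple_algebra_simps tuple_monoid_one)

lemma pure_mult:
  "\<lbrakk>xs \<in> tuples; ys \<in> tuples\<rbrakk> \<Longrightarrow>
    pure_tensor As xs \<otimes>\<^bsub>tensor_algebra As\<^esub> pure_tensor As ys = pure_tensor As (xs \<star> ys)"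
  unfolding pure_tensor_def
  by (subst proj.hom_mult[symmetric]) (auto simp: single_closed tuple_algebra_simps(10))

lemma pure_multilinear: "multilinear As (tensor_algebra As) (pure_tensor As)"
proof -
  let ?T = "tuple_algebra As"
  let ?p = "\<lambda>p. tensor_null As +>\<^bsub>?T\<^esub> p"
  have rel: "?p u = ?p v" if "u - v \<in> multilinear_rels As" "u \<in> carrier ?T" "v \<in> carrier ?T" for u v
  proof -
    have "u \<ominus>\<^bsub>?T\<^esub> v = u - v"
      using that tuple.minus_closed[of u v] tuple.minus_eq[of u v]
      by (metis add_diff_cancel_right' tuple.a_assoc tuple.add.inv_closed tuple.l_neg tuple.r_zero
          tuple_algebra_simps(4))
    then show ?thesis
      using that tuple.gen_submodule_incl[OF multilinear_rels_carrier]
      by (subst null.coset_eq_iff) (auto simp: tensor_null_def)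
  qed
  show ?thesis
    unfolding multilinear_def
  proof (intro ballI allI impI conjI)
    fix xs i x assume t: "xs \<in> tuples" "i < length As" "x \<in> carrier (As ! i)"
    { fix y assume y: "y \<in> carrier (As ! i)"
      have "?p (Poly_Mapping.single (xs[i := x \<oplus>\<^bsub>As ! i\<^esub> y]) 1) =
        ?p (Poly_Mapping.single (xs[i := x]) 1 \<oplus>\<^bsub>?T\<^esub> Poly_Mapping.single (xs[i := y]) 1)"
        using t y multilinear_rels.additive[OF t(1,2,3) y]
        by (intro rel tuple.a_closed single_closed update_tuple factor_closed)
          (simp_all add: tuple_algebra_simps(4) diff_diff_eq)
      then show "pure_tensor As (xs[i := x \<oplus>\<^bsub>As ! i\<^esub> y]) =
         pure_tensor As (xs[i := x]) \<oplus>\<^bsub>tensor_algebra As\<^esub> pure_tensor As (xs[i := y])"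
        using t y by (simp add: pure_tensor_def proj.hom_add single_closed update_tuple) }
    fix c
    have "?p (Poly_Mapping.single (xs[i := c \<odot>\<^bsub>As ! i\<^esub> x]) 1) =
      ?p (c \<odot>\<^bsub>?T\<^esub> Poly_Mapping.single (xs[i := x]) 1)"
      using t multilinear_rels.homogeneous[OF t(1,2,3)]
      by (intro rel tuple.smult_closed single_closed update_tuple factor_closed)
        (simp_all add: tuple_algebra_simps(5) map_mult_simps)
    then show "pure_tensor As (xs[i := c \<odot>\<^bsub>As ! i\<^esub> x]) =
       c \<odot>\<^bsub>tensor_algebra As\<^esub> pure_tensor As (xs[i := x])"
      using t by (simp add: pure_tensor_def proj.hom_smult single_closed update_tuple)
  qed auto
qed

text \<open>
  Pure tensors are closed under scalar multiples and include zero, so sums of them exhaust the tensor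
  product.
\<close>

lemma tensor_induct [consumes 1, case_names pure add]:
  assumes U: "U \<in> carrier (tensor_algebra As)"
    and pure: "\<And>xs. xs \<in> tuples \<Longrightarrow> P (pure_tensor As xs)"
    and add: "\<And>U V. \<lbrakk>U \<in> carrier (tensor_algebra As); V \<in> carrier (tensor_algebra As); P U; P V\<rbrakk> \<Longrightarrow>
      P (U \<oplus>\<^bsub>tensor_algebra As\<^esub> V)"
  shows "P U"
proof -
  let ?T = "tuple_algebra As"
  let ?p = "\<lambda>p. tensor_null As +>\<^bsub>?T\<^esub> p"
  have smult: "P (c \<odot>\<^bsub>tensor_algebra As\<^esub> pure_tensor As xs)" if "xs \<in> tuples" for c xs
  proof -
    have 0: "0 < length As" using nonempty by simp
    then have x: "xs ! 0 \<in> carrier (As ! 0)" using that by (simp add: tuples_iff)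
    have "c \<odot>\<^bsub>tensor_algebra As\<^esub> pure_tensor As (xs[0 := xs ! 0])
        = pure_tensor As (xs[0 := c \<odot>\<^bsub>As ! 0\<^esub> xs ! 0])"
      using pure_multilinear that 0 x unfolding multilinear_def by metis
    then show ?thesis using pure[of "xs[0 := c \<odot>\<^bsub>As ! 0\<^esub> xs ! 0]"] that 0 x
      by (simp add: update_tuple factor_closed)
  qed
  from U obtain p where p: "p \<in> carrier ?T" "U = ?p p" by (auto simp: tensor_carrier)
  then have "Poly_Mapping.keys p \<subseteq> tuples" by (simp add: tuple_algebra_simps)
  then have "P (?p p)"
  proof (induction p rule: poly_mapping_span_induct)
    case zero
    have "?p 0 = 0 \<odot>\<^bsub>tensor_algebra As\<^esub> pure_tensor As (map one As)"
      using proj.hom_zero one_tuple by (simp add: tuple_algebra_simps)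
    then show ?case using smult[OF one_tuple, of 0] one_tuple by simp
  next
    case (add xs c p)
    have "?p (Poly_Mapping.single xs c) = c \<odot>\<^bsub>tensor_algebra As\<^esub> pure_tensor As xs"
      using proj.hom_smult[OF single_closed[OF add(1)], of c 1]
      by (simp add: pure_tensor_def tuple_algebra_simps map_mult_simps)
    moreover have "?p (Poly_Mapping.single xs c + p) =
        ?p (Poly_Mapping.single xs c) \<oplus>\<^bsub>tensor_algebra As\<^esub> ?p p"
      using proj.hom_add[OF single_closed[OF add(1)], of p c] add(2) by (simp add: tuple_algebra_simps)
    ultimately show ?case
      using smult[OF add(1)] add assms(3) by (simp add: tuple_algebra_simps)
  qed
  with p show ?thesis by simp
qed

context
  fixes N :: "('k, 'b) module" and g
  assumes N: "type_algebra N" and g: "multilinear As N g"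
begin

interpretation N: type_algebra N by (rule N)

text \<open>
  The kernel of the linear extension of a multilinear map is a submodule that contains the generators
  of \<open>tensor_null As\<close>.
\<close>

lemma lincomb_tensor_null: "z \<in> tensor_null As \<Longrightarrow> lincomb N g z = \<zero>\<^bsub>N\<^esub>"
proof -
  have gc: "g \<in> tuples \<rightarrow> carrier N" using g by (auto simp: multilinear_def)
  let ?T = "tuple_algebra As"
  let ?H = "{p \<in> carrier ?T. lincomb N g p = \<zero>\<^bsub>N\<^esub>}"
  note lc = N.lincomb_add[OF gc] N.lincomb_single[OF gc] N.lincomb_zero N.lincomb_closed[OF gc]
     N.lincomb_smult[OF gc]
  have H: "submodule ?H (ring_of_type_algebra :: 'k ring) ?T"
    using tuple.a_closed tuple.smult_closed unfolding tuple.type_submodule_iff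
    by (auto simp: tuple_algebra_simps(1-5) lc)
  have lc_diff: "lincomb N g (p - q) = lincomb N g p \<ominus>\<^bsub>N\<^esub> lincomb N g q"
    if "Poly_Mapping.keys p \<subseteq> tuples" "Poly_Mapping.keys q \<subseteq> tuples" for p q
  proof -
    have eq: "p - q = p + Poly_Mapping.map ((*) (- 1)) q"
      by (rule poly_mapping_eqI) (simp add: lookup_add lookup_minus lookup_map_mult)
    have "Poly_Mapping.keys (Poly_Mapping.map ((*) (- 1)) q) \<subseteq> tuples"
      using that keys_map_mult[of "-1" q] by blast
    then show ?thesis
      unfolding eq using that by (simp add: lc N.smult_minus_left N.minus_eq)
  qed
  have cancel: "a \<oplus>\<^bsub>N\<^esub> (b \<oplus>\<^bsub>N\<^esub> \<ominus>\<^bsub>N\<^esub> a) = b" if "a \<in> carrier N" "b \<in> carrier N" for a b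
    using that by (metis N.a_lcomm N.add.inv_closed N.r_neg N.r_zero)
  have "multilinear_rels As \<subseteq> ?H"
  proof
    fix r assume r: "r \<in> multilinear_rels As"
    then have "lincomb N g r = \<zero>\<^bsub>N\<^esub>"
    proof cases
      case (additive xs i x y)
      let ?s = "\<lambda>z. Poly_Mapping.single (xs[i := z]) (1::'k)"
      have K: "Poly_Mapping.keys (?s x) \<subseteq> tuples" "Poly_Mapping.keys (?s y) \<subseteq> tuples"
        "Poly_Mapping.keys (?s (x \<oplus>\<^bsub>As ! i\<^esub> y)) \<subseteq> tuples"
        using additive by (auto simp: update_tuple factor_closed)
      moreover have "Poly_Mapping.keys (?s (x \<oplus>\<^bsub>As ! i\<^esub> y) - ?s x) \<subseteq> tuples"
        using K keys_diff[of "?s (x \<oplus>\<^bsub>As ! i\<^esub> y)" "?s x"] by blast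
      moreover have "g (xs[i := x \<oplus>\<^bsub>As ! i\<^esub> y]) = g (xs[i := x]) \<oplus>\<^bsub>N\<^esub> g (xs[i := y])"
        using g additive unfolding multilinear_def by blast
      moreover have "g (xs[i := x]) \<in> carrier N" "g (xs[i := y]) \<in> carrier N"
        using gc additive by (auto simp: update_tuple)
      ultimately show ?thesis
        using additive
        by (simp add: lc_diff lc update_tuple factor_closed del: keys_single)
          (simp add: N.minus_eq N.a_ac N.r_neg cancel)
    next
      case (homogeneous xs i x c)
      have "g (xs[i := c \<odot>\<^bsub>As ! i\<^esub> x]) = c \<odot>\<^bsub>N\<^esub> g (xs[i := x])"
        using g homogeneous unfolding multilinear_def by blast
      moreover have "g (xs[i := x]) \<in> carrier N"
        using gc homogeneous by (auto simp: update_tuple)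
      ultimately show ?thesis
        using homogeneous
        by (simp add: lc_diff lc update_tuple factor_closed N.minus_eq N.r_neg)
    qed
    then show "r \<in> ?H" using r multilinear_rels_carrier by blast
  qed
  then have "tensor_null As \<subseteq> ?H"
    unfolding tensor_null_def by (rule tuple.gen_submodule_minimal[OF multilinear_rels_carrier H])
  then show "z \<in> tensor_null As \<Longrightarrow> lincomb N g z = \<zero>\<^bsub>N\<^esub>" by blast
qed

lemma tensor_lift_coset:
  assumes "p \<in> carrier (tuple_algebra As)"
  shows "tensor_lift N g (tensor_null As +>\<^bsub>tuple_algebra As\<^esub> p) = lincomb N g p"
proof -
  have gc: "g \<in> tuples \<rightarrow> carrier N" using g by (auto simp: multilinear_def)
  have "lincomb N g (z \<oplus>\<^bsub>tuple_algebra As\<^esub> p) = lincomb N g p" if "z \<in> tensor_null As" for z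
    using assms null.a_Hcarr[OF that] N.lincomb_add[OF gc, of z p] lincomb_tensor_null[OF that]
      N.lincomb_closed[OF gc, of p]
    by (simp add: tuple_algebra_simps)
  from null.the_elem_image_coset[OF assms this] show ?thesis
    by (simp add: tensor_lift_def lincomb_def[abs_def])
qed

lemma tensor_lift_pure: "xs \<in> tuples \<Longrightarrow> tensor_lift N g (pure_tensor As xs) = g xs"
proof -
  have gc: "g \<in> tuples \<rightarrow> carrier N" using g by (auto simp: multilinear_def)
  show "xs \<in> tuples \<Longrightarrow> tensor_lift N g (pure_tensor As xs) = g xs"
    using gc by (auto simp: pure_tensor_def tensor_lift_coset single_closed N.lincomb_single[OF gc] Pi_iff)
qed

lemma tensor_lift_linear:
  assumes "U \<in> carrier (tensor_algebra As)"
  shows "tensor_lift N g U \<in> carrier N"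
    "V \<in> carrier (tensor_algebra As) \<Longrightarrow>
      tensor_lift N g (U \<oplus>\<^bsub>tensor_algebra As\<^esub> V) = tensor_lift N g U \<oplus>\<^bsub>N\<^esub> tensor_lift N g V"
    "tensor_lift N g (c \<odot>\<^bsub>tensor_algebra As\<^esub> U) = c \<odot>\<^bsub>N\<^esub> tensor_lift N g U"
proof -
  have gc: "g \<in> tuples \<rightarrow> carrier N" using g by (auto simp: multilinear_def)
  note s = tensor_lift_coset proj.hom_add[symmetric] proj.hom_smult[symmetric]
    N.lincomb_add[OF gc] N.lincomb_closed[OF gc] N.lincomb_smult[OF gc]
  show "tensor_lift N g U \<in> carrier N"
    "V \<in> carrier (tensor_algebra As) \<Longrightarrow>
      tensor_lift N g (U \<oplus>\<^bsub>tensor_algebra As\<^esub> V) = tensor_lift N g U \<oplus>\<^bsub>N\<^esub> tensor_lift N g V"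
    "tensor_lift N g (c \<odot>\<^bsub>tensor_algebra As\<^esub> U) = c \<odot>\<^bsub>N\<^esub> tensor_lift N g U"
    using assms by (auto simp: tensor_carrier s) (simp_all add: s tuple_algebra_simps(1-5))
qed

end

end

section \<open>Quantum integers\<close>

lemma qi_pow_add: "qi_pow D i (r + s) = qi_pow D i r * qi_pow D i s"
  by (simp add: qi_pow_def q_pow_def distrib_left fps_exp_add_mult)

lemma qi_pow_zero [simp]: "qi_pow D i 0 = 1"
  by (simp add: qi_pow_def q_pow_def)

lemma qi_pow_inverse: "qi_pow D i r * qi_pow D i (- r) = 1"
  by (simp flip: qi_pow_add)

lemma qi_pow_power: "qi_pow D i r ^ n = qi_pow D i (r * of_nat n)"
  by (induction n) (simp_all add: qi_pow_add distrib_left mult.commute)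

lemma q_int_zero [simp]: "q_int D i 0 = 0"
  by (simp add: q_int_def)

context
  fixes D :: "('i, 'v) km_datum" and i
  assumes half_norm: "half_norm D i \<noteq> 0"
begin

lemma q_denominator:
  shows "fps_nth (qi_pow D i 1 - qi_pow D i (- 1)) 1 = 2 * half_norm D i"
    and "subdegree (qi_pow D i 1 - qi_pow D i (- 1)) = 1"
    and "qi_pow D i 1 - qi_pow D i (- 1) \<noteq> 0"
proof -
  show 1: "fps_nth (qi_pow D i 1 - qi_pow D i (- 1)) 1 = 2 * half_norm D i"
    by (simp add: qi_pow_def q_pow_def)
  show "subdegree (qi_pow D i 1 - qi_pow D i (- 1)) = 1"
    by (rule subdegreeI) (use 1 half_norm in \<open>simp_all add: qi_pow_def q_pow_def\<close>)
  show "qi_pow D i 1 - qi_pow D i (- 1) \<noteq> 0"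
    using 1 half_norm by (metis fps_zero_nth mult_eq_0_iff zero_neq_numeral)
qed

lemma q_int_mult:
  "q_int D i n * (qi_pow D i 1 - qi_pow D i (- 1)) = qi_pow D i (of_nat n) - qi_pow D i (- of_nat n)"
proof -
  let ?d = "qi_pow D i 1 - qi_pow D i (- 1)" and ?n = "qi_pow D i (of_nat n) - qi_pow D i (- of_nat n)"
  \<comment> \<open>In a power series ring over a field, divisibility is a comparison of subdegrees.\<close>
  have "?d dvd ?n"
  proof (cases "?n = 0")
    case False
    have "fps_nth ?n 0 = 0" by (simp add: qi_pow_def q_pow_def)
    then have "subdegree ?n \<ge> 1"
      using False by (metis One_nat_def Suc_leI gr_zeroI nth_subdegree_nonzero)
    then show ?thesis
      using False q_denominator by (subst fps_dvd_iff) auto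
  qed simp
  then show ?thesis by (simp add: q_int_def)
qed

text \<open>
  Compare the coefficients of \<open>\<hbar>\<close> in \<open>q_int_mult\<close>. In particular quantum integers and factorials
  are invertible.
\<close>

lemma q_int_const: "fps_nth (q_int D i n) 0 = of_nat n"
proof -
  have "fps_nth (q_int D i n * (qi_pow D i 1 - qi_pow D i (- 1))) 1 = 2 * half_norm D i * of_nat n"
    unfolding q_int_mult by (simp add: qi_pow_def q_pow_def)
  moreover have "fps_nth (q_int D i n * (qi_pow D i 1 - qi_pow D i (- 1))) 1
      = fps_nth (q_int D i n) 0 * (2 * half_norm D i)"
    by (simp add: fps_mult_nth qi_pow_def q_pow_def)
  ultimately show ?thesis using half_norm by simp
qed

text \<open>
  The quantum analogue of \<open>n = (n - k) + k\<close>. Both signs are needed, since the Serre element is built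
  up by two recursions that differ by \<open>q \<mapsto> q\<^sup>-\<^sup>1\<close>.
\<close>

lemma q_int_split:
  assumes "k \<le> n" and s: "s = 1 \<or> s = - 1"
  shows "q_int D i n = qi_pow D i (- (s * of_nat k)) * q_int D i (n - k)
    + qi_pow D i (s * of_nat (n - k)) * q_int D i k"
proof -
  let ?d = "qi_pow D i 1 - qi_pow D i (- 1)"
  have "(qi_pow D i (- (s * of_nat k)) * q_int D i (n - k)
      + qi_pow D i (s * of_nat (n - k)) * q_int D i k) * ?d
    = qi_pow D i (- (s * of_nat k)) * (q_int D i (n - k) * ?d)
      + qi_pow D i (s * of_nat (n - k)) * (q_int D i k * ?d)"
    by (simp add: algebra_simps)
  also have "\<dots> = q_int D i n * ?d"
    using assms unfolding q_int_mult by (auto simp: right_diff_distrib of_nat_diff simp flip: qi_pow_add)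
  finally show ?thesis using q_denominator(3) by simp
qed

lemma q_fact_Suc: "q_fact D i (Suc n) = q_int D i (Suc n) * q_fact D i n"
  by (simp add: q_fact_def mult.commute)

lemma inverse_q_fact_Suc: "inverse (q_fact D i n) = q_int D i (Suc n) * inverse (q_fact D i (Suc n))"
proof -
  have "inverse (q_int D i (Suc n)) * q_int D i (Suc n) = 1"
    by (rule inverse_mult_eq_1) (simp add: q_int_const del: of_nat_Suc)
  then show ?thesis
    by (simp add: q_fact_Suc fps_inverse_mult mult.assoc[symmetric] mult.commute[of "q_int D i (Suc n)"])
qed

lemma q_int_unit: "\<exists>c. q_int D i (Suc n) * c = 1"
  by (rule exI[of _ "inverse (q_int D i (Suc n))"])
    (rule inverse_mult_eq_1'; simp add: q_int_const del: of_nat_Suc)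

end

lemma minus_one_power_split: "k \<le> n \<Longrightarrow> (- 1) ^ k * (- 1) ^ (n - k) = ((- 1) ^ n :: 'k::comm_ring_1)"
  by (simp flip: power_add)

section \<open>Quantum Serre elements\<close>

text \<open>
  For \<open>r = 0\<close> and \<open>n = 1 - a\<close> this is the element of the quantum Serre relation. The parameter \<open>r\<close>
  makes room for its predecessors: by the \<open>q\<close>-binomial theorem, \<open>r = a + n - 1\<close> gives the product of
  the operators \<open>u \<mapsto> u x - q\<^sub>i\<^bsup>a+2m\<^esup> x u\<close> for \<open>m < n\<close> applied to \<open>y\<close> and divided by \<open>[n]\<^sub>i!\<close>, and
  \<open>r = - (a + n - 1)\<close> gives the same with \<open>q\<close> replaced by \<open>q\<^sup>-\<^sup>1\<close>. At \<open>n = 1 - a\<close> both values of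
  \<open>r\<close> are zero.
\<close>

definition q_serre ::
  "(rat fps, 'b) module \<Rightarrow> ('i, 'v) km_datum \<Rightarrow> 'i \<Rightarrow> rat \<Rightarrow> nat \<Rightarrow> 'b \<Rightarrow> 'b \<Rightarrow> 'b" where
  "q_serre M D i r n x y = (\<Oplus>\<^bsub>M\<^esub>k\<in>{..n}.
    ((- 1) ^ k * qi_pow D i (r * of_nat k) * inverse (q_fact D i k) * inverse (q_fact D i (n - k)))
      \<odot>\<^bsub>M\<^esub> (x [^]\<^bsub>M\<^esub> k \<otimes>\<^bsub>M\<^esub> y \<otimes>\<^bsub>M\<^esub> x [^]\<^bsub>M\<^esub> (n - k)))"

lemma hom_q_serre:
  assumes "algebra_morphism A B f" "x \<in> carrier A" "y \<in> carrier A"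
  shows "f (q_serre A D i r n x y) = q_serre B D i r n (f x) (f y)"
proof -
  interpret algebra_morphism A B f by fact
  show ?thesis
    using assms(2,3) unfolding q_serre_def
    by (subst hom_finsum) (auto simp: hom_smult hom_mult hom_pow intro!: B.finsum_cong')
qed

locale q_algebra = type_algebra M for M :: "(rat fps, 'a) module" (structure) +
  fixes D :: "('i, 'v) km_datum" and i :: 'i
  assumes half_norm: "half_norm D i \<noteq> 0"
begin

abbreviation "serre \<equiv> q_serre M D i"
abbreviation "qp \<equiv> qi_pow D i"

lemma pow_commute: "x \<in> carrier M \<Longrightarrow> x \<otimes> x [^] (n::nat) = x [^] Suc n"
  using nat_pow_Suc2 by simp

lemma serre_closed [simp, intro]: "\<lbrakk>x \<in> carrier M; y \<in> carrier M\<rbrakk> \<Longrightarrow> serre r n x y \<in> carrier M"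
  unfolding q_serre_def by (intro finsum_closed) auto

lemma serre_zero: "\<lbrakk>x \<in> carrier M; y \<in> carrier M\<rbrakk> \<Longrightarrow> serre r 0 x y = y"
  by (simp add: q_serre_def q_fact_def)

lemma serre_add:
  assumes "x \<in> carrier M" "y \<in> carrier M" "z \<in> carrier M"
  shows "serre r n x (y \<oplus> z) = serre r n x y \<oplus> serre r n x z"
  using assms unfolding q_serre_def
  by (subst finsum_addf[symmetric]) (auto simp: l_distr r_distr smult_add_right intro!: finsum_cong')

lemma finsum_smult_combine:
  assumes "finite A" "t \<in> A \<rightarrow> carrier M"
  shows "(\<Oplus>k\<in>A. (f k + d * g k) \<odot> t k) = (\<Oplus>k\<in>A. f k \<odot> t k) \<oplus> d \<odot> (\<Oplus>k\<in>A. g k \<odot> t k)"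
proof -
  have "(\<Oplus>k\<in>A. (f k + d * g k) \<odot> t k) = (\<Oplus>k\<in>A. f k \<odot> t k \<oplus> d \<odot> (g k \<odot> t k))"
    by (rule finsum_cong') (use assms in \<open>auto simp: smult_add_left smult_smult Pi_iff\<close>)
  then show ?thesis
    using assms by (simp add: smult_finsum finsum_addf Pi_def)
qed

text \<open>
  The inductive form of the \<open>q\<close>-binomial theorem. In terms of the monomials \<open>x\<^sup>k y x\<^sup>n\<^sup>+\<^sup>1\<^sup>-\<^sup>k\<close>, comparing
  coefficients amounts to \<open>q_int_split\<close>; the sign \<open>s\<close> selects one of the two orders of the operators.
\<close>

lemma serre_recursion:
  assumes s: "s = 1 \<or> s = - 1" and x: "x \<in> carrier M" and y: "y \<in> carrier M"
  shows "q_int D i (Suc n) \<odot> serre (s * (a + of_nat n)) (Suc n) x y =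
    serre (s * (a + of_nat n - 1)) n x y \<otimes> x
      \<ominus> qp (s * (a + 2 * of_nat n)) \<odot> (x \<otimes> serre (s * (a + of_nat n - 1)) n x y)"
proof -
  let ?I = "\<lambda>k. inverse (q_fact D i k)"
  let ?r = "s * (a + of_nat n - 1)"
  define t where "t k = x [^] k \<otimes> y \<otimes> x [^] (Suc n - k)" for k
  define c where "c k = (- 1) ^ k * qp (?r * of_nat k) * ?I k * ?I (n - k)" for k
  \<comment> \<open>The coefficients of both products, written so that they vanish at the one index where the
    monomial does not occur: there the factor is the quantum integer of zero.\<close>
  define c1 where "c1 k = (- 1) ^ k * qp (?r * of_nat k) * ?I k * ?I (Suc n - k) * q_int D i (Suc n - k)" for k
  define c2 where "c2 k = - ((- 1) ^ k * qp (?r * (of_nat k - 1)) * ?I k * ?I (Suc n - k) * q_int D i k)" for k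
  have t: "t k \<in> carrier M" for k using x y by (simp add: t_def)
  have c1: "c1 k = c k" if "k \<le> n" for k
    using inverse_q_fact_Suc[OF half_norm, of "n - k"] that
    by (simp add: c1_def c_def Suc_diff_le mult.commute mult.left_commute)
  have c2: "c2 (Suc k) = c k" if "k \<le> n" for k
    using inverse_q_fact_Suc[OF half_norm, of k] that
    by (simp add: c2_def c_def mult.commute mult.left_commute)
  have "serre ?r n x y \<otimes> x = (\<Oplus>k\<in>{..n}. c k \<odot> t k)"
    unfolding q_serre_def using x y
    by (subst finsum_ldistr)
      (auto simp: c_def t_def smult_mult_left m_assoc Suc_diff_le intro!: finsum_cong')
  also have "\<dots> = (\<Oplus>k\<in>{..Suc n}. c1 k \<odot> t k)"
    using t c1 by (simp add: c1_def[of "Suc n"] cong: finsum_cong)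
  finally have 1: "serre ?r n x y \<otimes> x = (\<Oplus>k\<in>{..Suc n}. c1 k \<odot> t k)" .
  have "x \<otimes> serre ?r n x y = (\<Oplus>k\<in>{..n}. c k \<odot> t (Suc k))"
    unfolding q_serre_def using x y
    by (subst finsum_rdistr)
      (auto simp: c_def t_def smult_mult_right pow_commute simp del: nat_pow_Suc
        simp flip: m_assoc intro!: finsum_cong')
  also have "\<dots> = (\<Oplus>k\<in>{..Suc n}. c2 k \<odot> t k)"
    using t c2 by (subst finsum_Suc2) (simp_all add: c2_def[of 0] cong: finsum_cong)
  finally have 2: "x \<otimes> serre ?r n x y = (\<Oplus>k\<in>{..Suc n}. c2 k \<odot> t k)" .
  have coeff: "q_int D i (Suc n) * ((- 1) ^ k * qp (s * (a + of_nat n) * of_nat k) * ?I k * ?I (Suc n - k))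
      = c1 k + (- qp (s * (a + 2 * of_nat n))) * c2 k" if "k \<le> Suc n" for k
  proof -
    let ?u = "(- 1) ^ k * ?I k * ?I (Suc n - k)"
    have "qp (s * (a + of_nat n) * of_nat k) * q_int D i (Suc n)
      = qp (s * (a + of_nat n) * of_nat k) * qp (- (s * of_nat k)) * q_int D i (Suc n - k)
      + qp (s * (a + of_nat n) * of_nat k) * qp (s * of_nat (Suc n - k)) * q_int D i k"
      by (subst q_int_split[OF half_norm that s]) (simp add: distrib_left mult.assoc)
    also have "qp (s * (a + of_nat n) * of_nat k) * qp (- (s * of_nat k)) = qp (?r * of_nat k)"
      by (simp add: algebra_simps flip: qi_pow_add)
    also have "qp (s * (a + of_nat n) * of_nat k) * qp (s * of_nat (Suc n - k))
        = qp (s * (a + 2 * of_nat n)) * qp (?r * (of_nat k - 1))"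
      using that by (simp add: algebra_simps of_nat_diff flip: qi_pow_add)
    finally have "?u * (qp (s * (a + of_nat n) * of_nat k) * q_int D i (Suc n))
      = ?u * (qp (?r * of_nat k) * q_int D i (Suc n - k)
          + qp (s * (a + 2 * of_nat n)) * qp (?r * (of_nat k - 1)) * q_int D i k)"
      by simp
    then show ?thesis unfolding c1_def c2_def by (simp add: algebra_simps)
  qed
  let ?C = "\<lambda>k. (- 1) ^ k * qp (s * (a + of_nat n) * of_nat k) * ?I k * ?I (Suc n - k)"
  have "q_int D i (Suc n) \<odot> serre (s * (a + of_nat n)) (Suc n) x y
      = (\<Oplus>k\<in>{..Suc n}. q_int D i (Suc n) \<odot> (?C k \<odot> t k))"
    unfolding q_serre_def t_def[symmetric] by (rule smult_finsum) (use t in auto)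
  also have "\<dots> = (\<Oplus>k\<in>{..Suc n}. (c1 k + (- qp (s * (a + 2 * of_nat n))) * c2 k) \<odot> t k)"
  proof (rule finsum_cong'[OF refl])
    show "(\<lambda>k. (c1 k + (- qp (s * (a + 2 * of_nat n))) * c2 k) \<odot> t k) \<in> {..Suc n} \<rightarrow> carrier M"
      using t by auto
    fix k assume "k \<in> {..Suc n}"
    then show "q_int D i (Suc n) \<odot> (?C k \<odot> t k) = (c1 k + (- qp (s * (a + 2 * of_nat n))) * c2 k) \<odot> t k"
      using coeff[of k] t[of k] by (simp only: smult_smult atMost_iff)
  qed
  also have "\<dots> = (\<Oplus>k\<in>{..Suc n}. c1 k \<odot> t k)
      \<oplus> (- qp (s * (a + 2 * of_nat n))) \<odot> (\<Oplus>k\<in>{..Suc n}. c2 k \<odot> t k)"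
    by (rule finsum_smult_combine) (use t in auto)
  finally show ?thesis
    unfolding 1 2 using t by (simp add: smult_minus_left minus_eq Pi_def del: finsum_Suc)
qed

lemma pow_q_commute:
  assumes "x \<in> carrier M" "z \<in> carrier M" and xz: "x \<otimes> z = \<alpha> \<odot> (z \<otimes> x)"
  shows "x [^] (n::nat) \<otimes> z = (\<alpha> ^ n) \<odot> (z \<otimes> x [^] n)"
proof (induction n)
  case (Suc n)
  have "x [^] Suc n \<otimes> z = x [^] n \<otimes> (x \<otimes> z)" using assms by (simp add: m_assoc)
  also have "\<dots> = \<alpha> \<odot> ((x [^] n \<otimes> z) \<otimes> x)" using assms by (simp add: smult_mult_right m_assoc)
  also have "\<dots> = (\<alpha> ^ Suc n) \<odot> (z \<otimes> x [^] Suc n)"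
    unfolding Suc using assms by (simp add: smult_mult_left smult_smult m_assoc)
  finally show ?case .
qed (use assms in simp)

lemma serre_q_commute:
  assumes c: "x \<in> carrier M" "y \<in> carrier M" "z \<in> carrier M"
    and xz: "x \<otimes> z = \<alpha> \<odot> (z \<otimes> x)" and yz: "y \<otimes> z = \<beta> \<odot> (z \<otimes> y)"
  shows "serre r n x y \<otimes> z = (\<beta> * \<alpha> ^ n) \<odot> (z \<otimes> serre r n x y)"
proof -
  have *: "x [^] k \<otimes> y \<otimes> x [^] (n - k) \<otimes> z = (\<beta> * \<alpha> ^ n) \<odot> (z \<otimes> (x [^] k \<otimes> y \<otimes> x [^] (n - k)))"
    if "k \<le> n" for k
  proof -
    have "x [^] k \<otimes> y \<otimes> x [^] (n - k) \<otimes> z = \<alpha> ^ (n - k) \<odot> (x [^] k \<otimes> (y \<otimes> z) \<otimes> x [^] (n - k))"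
      using c by (simp add: m_assoc pow_q_commute[OF c(1,3) xz] smult_mult_right)
    also have "\<dots> = (\<alpha> ^ (n - k) * \<beta>) \<odot> ((x [^] k \<otimes> z) \<otimes> (y \<otimes> x [^] (n - k)))"
      using c by (simp add: yz m_assoc smult_mult_left smult_mult_right smult_smult)
    also have "\<dots> = (\<alpha> ^ (n - k) * \<beta> * \<alpha> ^ k) \<odot> (z \<otimes> (x [^] k \<otimes> y \<otimes> x [^] (n - k)))"
      using c by (simp add: pow_q_commute[OF c(1,3) xz] m_assoc smult_mult_left smult_smult)
    also have "\<alpha> ^ (n - k) * \<beta> * \<alpha> ^ k = \<beta> * \<alpha> ^ n"
      using that by (simp add: mult.commute mult.left_commute flip: power_add)
    finally show ?thesis .
  qed
  show ?thesis
    unfolding q_serre_def using c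
    by (simp add: finsum_ldistr finsum_rdistr smult_finsum Pi_def)
      (auto simp: smult_mult_left smult_mult_right smult_smult * mult.commute intro!: finsum_cong')
qed

lemma add_cancel_minus:
  assumes "u \<in> carrier M" "v \<in> carrier M" "w \<in> carrier M"
  shows "(u \<oplus> v) \<ominus> (w \<oplus> v) = u \<ominus> w"
proof -
  have "(u \<oplus> v) \<ominus> (w \<oplus> v) = u \<oplus> \<ominus> w \<oplus> (v \<oplus> \<ominus> v)"
    using assms by (simp add: minus_eq minus_add a_ac)
  then show ?thesis using assms by (simp add: r_neg minus_eq)
qed

text \<open>
  If \<open>z\<close> \<open>q\<close>-commutes with \<open>x\<close> and \<open>y\<close>, then it \<open>q\<close>-commutes with every partial product \<open>w\<close>, and the
  power of \<open>q\<close> is exactly the one in the next operator. Hence the contribution \<open>w z - q\<^bsup>\<dots>\<^esup> z w\<close> of \<open>z\<close>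
  to that operator is zero at each step.
\<close>

lemma serre_absorb:
  assumes s: "s = 1 \<or> s = - 1" and c: "x \<in> carrier M" "y \<in> carrier M" "z \<in> carrier M"
    and xz: "x \<otimes> z = qp (s * 2) \<odot> (z \<otimes> x)" and yz: "y \<otimes> z = qp (s * a) \<odot> (z \<otimes> y)"
  shows "serre (s * (a + of_nat n - 1)) n (x \<oplus> z) y = serre (s * (a + of_nat n - 1)) n x y"
proof (induction n)
  case 0
  then show ?case using c by (simp add: serre_zero)
next
  case (Suc n)
  let ?w = "serre (s * (a + of_nat n - 1)) n x y" and ?d = "qp (s * (a + 2 * of_nat n))"
  have w: "?w \<in> carrier M" using c by simp
  have wz: "?w \<otimes> z = ?d \<odot> (z \<otimes> ?w)"
    using serre_q_commute[OF c xz yz, of "s * (a + of_nat n - 1)" n]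
    by (simp add: qi_pow_power algebra_simps flip: qi_pow_add)
  have "q_int D i (Suc n) \<odot> serre (s * (a + of_nat n)) (Suc n) (x \<oplus> z) y
      = (?w \<otimes> x \<oplus> ?w \<otimes> z) \<ominus> (?d \<odot> (x \<otimes> ?w) \<oplus> ?d \<odot> (z \<otimes> ?w))"
    using c s by (subst serre_recursion) (simp_all add: Suc l_distr r_distr smult_add_right)
  also have "\<dots> = ?w \<otimes> x \<ominus> ?d \<odot> (x \<otimes> ?w)"
    using c w unfolding wz by (simp add: add_cancel_minus)
  also have "\<dots> = q_int D i (Suc n) \<odot> serre (s * (a + of_nat n)) (Suc n) x y"
    using c s by (subst serre_recursion) simp_all
  finally have "serre (s * (a + of_nat n)) (Suc n) (x \<oplus> z) y = serre (s * (a + of_nat n)) (Suc n) x y"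
    using q_int_unit[OF half_norm, of n] c by (metis smult_unit_cancel serre_closed a_closed)
  then show ?case by (simp add: algebra_simps)
qed

lemma q_commute_inverse:
  assumes "x \<in> carrier M" "z \<in> carrier M" "x \<otimes> z = qp r \<odot> (z \<otimes> x)"
  shows "z \<otimes> x = qp (- r) \<odot> (x \<otimes> z)"
  using assms qi_pow_inverse[of D i r] by (simp add: smult_smult mult.commute)

text \<open>
  The Serre element is linear in its last argument. On \<open>y\<close> the summand \<open>x'\<close> is absorbed by the recursion
  with sign \<open>s\<close>, and on \<open>y'\<close> the summand \<open>x\<close> is absorbed by the recursion with the opposite sign.
\<close>

lemma serre_sum_zero:
  assumes s: "s = 1 \<or> s = - 1" and n: "of_nat n = 1 - a"
    and c: "x \<in> carrier M" "y \<in> carrier M" "x' \<in> carrier M" "y' \<in> carrier M"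
    and xx: "x \<otimes> x' = qp (s * 2) \<odot> (x' \<otimes> x)"
    and yx: "y \<otimes> x' = qp (s * a) \<odot> (x' \<otimes> y)"
    and xy: "x \<otimes> y' = qp (s * a) \<odot> (y' \<otimes> x)"
    and zero: "serre 0 n x y = \<zero>" "serre 0 n x' y' = \<zero>"
  shows "serre 0 n (x \<oplus> x') (y \<oplus> y') = \<zero>"
proof -
  have s': "- s = 1 \<or> - s = - 1" using s by auto
  have "serre 0 n (x \<oplus> x') y = serre 0 n x y"
    using serre_absorb[OF s c(1,2,3) xx yx, of n] n by simp
  moreover have "serre 0 n (x' \<oplus> x) y' = serre 0 n x' y'"
    using serre_absorb[OF s' c(3,4,1), of a n] n q_commute_inverse[OF c(1,3) xx]
      q_commute_inverse[OF c(1,4) xy] by simp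
  ultimately show ?thesis
    using c zero by (simp add: serre_add a_comm)
qed

text \<open>
  Moving \<open>t\<close> and \<open>u\<close> to the left of \<open>x\<close> and \<open>y\<close> costs a scalar that depends only on how often each letter
  occurs, not on the order of the letters: the exchange of \<open>x\<close> with \<open>u\<close> and that of \<open>y\<close> with \<open>t\<close> are
  required to have the same factor \<open>\<beta>\<close>. So the twisted Serre element is a multiple of \<open>t\<^sup>n u\<close> times the
  original one.
\<close>

lemma serre_twist_zero:
  fixes a :: rat
  assumes n: "of_nat n = 1 - a"
    and c: "x \<in> carrier M" "y \<in> carrier M" "t \<in> carrier M" "u \<in> carrier M"
    and xt: "x \<otimes> t = \<alpha> \<odot> (t \<otimes> x)" and yt: "y \<otimes> t = \<beta> \<odot> (t \<otimes> y)"
    and xs: "x \<otimes> u = \<beta> \<odot> (u \<otimes> x)" and ts: "t \<otimes> u = u \<otimes> t"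
    and zero: "serre 0 n x y = \<zero>"
  shows "serre 0 n (t \<otimes> x) (u \<otimes> y) = \<zero>"
proof -
  have "\<exists>C. serre (a + of_nat m - 1) m (t \<otimes> x) (u \<otimes> y)
      = C \<odot> (t [^] m \<otimes> u \<otimes> serre (a + of_nat m - 1) m x y)" for m
  proof (induction m)
    case 0
    show ?case by (rule exI[of _ 1]) (use c in \<open>simp add: serre_zero\<close>)
  next
    case (Suc m)
    let ?w = "serre (a + of_nat m - 1) m x y" and ?d = "qp (a + 2 * of_nat m)"
    let ?v = "serre (a + of_nat m - 1) m (t \<otimes> x) (u \<otimes> y)"
    let ?T = "t [^] Suc m \<otimes> u"
    from Suc obtain C where C: "?v = C \<odot> (t [^] m \<otimes> u \<otimes> ?w)" by blast
    have w: "?w \<in> carrier M" using c by simp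
    have wt: "?w \<otimes> t = (\<beta> * \<alpha> ^ m) \<odot> (t \<otimes> ?w)"
      by (rule serre_q_commute[OF c(1,2,3) xt yt])
    have xtm: "x \<otimes> t [^] k = \<alpha> ^ k \<odot> (t [^] k \<otimes> x)" for k :: nat
    proof (induction k)
      case (Suc k)
      have "x \<otimes> t [^] Suc k = \<alpha> ^ k \<odot> (t [^] k \<otimes> (x \<otimes> t))"
        using c Suc by (simp add: smult_mult_left flip: m_assoc)
      then show ?case using c by (simp add: xt smult_mult_right smult_smult m_assoc mult.commute)
    qed (use c in simp)
    have tms: "t [^] k \<otimes> u = u \<otimes> t [^] k" for k :: nat
      using pow_q_commute[of t u 1 k] c ts by simp
    have v1: "?v \<otimes> (t \<otimes> x) = (C * \<beta> * \<alpha> ^ m) \<odot> (?T \<otimes> (?w \<otimes> x))"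
    proof -
      have "?v \<otimes> (t \<otimes> x) = C \<odot> (t [^] m \<otimes> u \<otimes> (?w \<otimes> t) \<otimes> x)"
        using c by (simp add: C smult_mult_left m_assoc)
      also have "\<dots> = (C * \<beta> * \<alpha> ^ m) \<odot> (t [^] m \<otimes> (u \<otimes> t) \<otimes> (?w \<otimes> x))"
        using c by (simp add: wt smult_mult_left smult_mult_right smult_smult m_assoc mult.assoc)
      also have "t [^] m \<otimes> (u \<otimes> t) = ?T"
        using c by (simp add: ts[symmetric] m_assoc)
      finally show ?thesis .
    qed
    have v2: "(t \<otimes> x) \<otimes> ?v = (C * \<beta> * \<alpha> ^ m) \<odot> (?T \<otimes> (x \<otimes> ?w))"
    proof -
      have "(t \<otimes> x) \<otimes> ?v = C \<odot> (t \<otimes> (x \<otimes> t [^] m) \<otimes> u \<otimes> ?w)"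
        using c by (simp add: C smult_mult_right m_assoc)
      also have "\<dots> = (C * \<alpha> ^ m) \<odot> (t \<otimes> t [^] m \<otimes> (x \<otimes> u) \<otimes> ?w)"
        using c by (simp add: xtm smult_mult_left smult_mult_right smult_smult m_assoc)
      also have "\<dots> = (C * \<beta> * \<alpha> ^ m) \<odot> ((t \<otimes> t [^] m) \<otimes> u \<otimes> (x \<otimes> ?w))"
        using c by (simp add: xs smult_mult_left smult_mult_right smult_smult m_assoc mult_ac)
      also have "t \<otimes> t [^] m = t [^] Suc m"
        using c by (simp only: pow_commute)
      finally show ?thesis .
    qed
    have T: "?T \<in> carrier M" using c by simp
    have "q_int D i (Suc m) \<odot> serre (a + of_nat m) (Suc m) (t \<otimes> x) (u \<otimes> y)
      = (C * \<beta> * \<alpha> ^ m) \<odot> (?T \<otimes> (?w \<otimes> x \<ominus> ?d \<odot> (x \<otimes> ?w)))"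
      using serre_recursion[of 1 "t \<otimes> x" "u \<otimes> y" m a] c w T
      by (simp add: v1 v2 r_minus r_distr minus_eq smult_add_right smult_minus_right smult_smult
          smult_mult_right mult.commute del: nat_pow_Suc)
    also have "\<dots> = q_int D i (Suc m) \<odot> ((C * \<beta> * \<alpha> ^ m) \<odot> (?T \<otimes> serre (a + of_nat m) (Suc m) x y))"
      using serre_recursion[of 1 x y m a, symmetric] c w T
      by (simp add: smult_mult_right smult_smult mult.commute del: nat_pow_Suc)
    finally have "serre (a + of_nat m) (Suc m) (t \<otimes> x) (u \<otimes> y)
        = (C * \<beta> * \<alpha> ^ m) \<odot> (?T \<otimes> serre (a + of_nat m) (Suc m) x y)"
      using q_int_unit[OF half_norm, of m] c T
      by (metis smult_unit_cancel serre_closed m_closed smult_closed)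
    then show ?case by (auto simp: algebra_simps)
  qed
  from this[of n] show ?thesis using n zero c by auto
qed

lemma serre_uminus_zero:
  assumes c: "x \<in> carrier M" "y \<in> carrier M" and zero: "serre 0 n x y = \<zero>"
  shows "serre 0 n (\<ominus> x) (\<ominus> y) = \<zero>"
proof -
  have p: "(\<ominus> x) [^] k = (- 1) ^ k \<odot> x [^] k" for k :: nat
    using c by (induction k) (simp_all add: smult_minus_left smult_mult_left r_minus l_minus)
  have t: "(\<ominus> x) [^] k \<otimes> (\<ominus> y) \<otimes> (\<ominus> x) [^] (n - k) = (- 1) ^ Suc n \<odot> (x [^] k \<otimes> y \<otimes> x [^] (n - k))"
    if "k \<le> n" for k
  proof -
    have "(\<ominus> x) [^] k \<otimes> (\<ominus> y) \<otimes> (\<ominus> x) [^] (n - k)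
        = \<ominus> (((- 1) ^ k * (- 1) ^ (n - k)) \<odot> (x [^] k \<otimes> y \<otimes> x [^] (n - k)))"
      using c by (simp add: p smult_mult_left smult_mult_right smult_smult smult_minus_right
        r_minus l_minus mult.commute)
    also have "\<dots> = (- 1) ^ Suc n \<odot> (x [^] k \<otimes> y \<otimes> x [^] (n - k))"
      using c by (simp add: minus_one_power_split[OF that] smult_minus_left)
    finally show ?thesis .
  qed
  have "serre 0 n (\<ominus> x) (\<ominus> y) = (- 1) ^ Suc n \<odot> serre 0 n x y"
    unfolding q_serre_def using c
    by (subst smult_finsum) (auto simp: t smult_smult mult.commute simp del: power_Suc intro!: finsum_cong')
  then show ?thesis using zero by simp
qed

lemma opposite_pow: "x \<in> carrier M \<Longrightarrow> x [^]\<^bsub>opposite M\<^esub> (n::nat) = x [^] n"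
  by (induction n) (simp_all add: nat_pow_def pow_commute[unfolded nat_pow_def, simplified])

lemma opposite_finsum: "finsum (opposite M) = finsum M"
  by (simp add: finsum_def[abs_def] fun_eq_iff)

text \<open>
  Reversal of words maps the \<open>k\<close>-th term to the one with index \<open>n - k\<close>, up to the common sign
  \<open>(-1)\<^sup>n\<close>.
\<close>

lemma opposite_serre_zero:
  assumes c: "x \<in> carrier M" "y \<in> carrier M" and zero: "serre 0 n x y = \<zero>"
  shows "q_serre (opposite M) D i 0 n x y = \<zero>"
proof -
  let ?I = "\<lambda>k. inverse (q_fact D i k)"
  let ?t = "\<lambda>k. ((- 1) ^ k * ?I k * ?I (n - k)) \<odot> (x [^] (n - k) \<otimes> (y \<otimes> x [^] k))"
  have im: "(\<lambda>k. n - k) ` {..n} = {..n}"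
  proof
    show "{..n} \<subseteq> (\<lambda>k. n - k) ` {..n}"
    proof
      fix k assume "k \<in> {..n}"
      then show "k \<in> (\<lambda>k. n - k) ` {..n}"
        by (intro image_eqI[of _ _ "n - k"]) auto
    qed
  qed auto
  have "q_serre (opposite M) D i 0 n x y = (\<Oplus>k\<in>(\<lambda>k. n - k) ` {..n}. ?t k)"
    unfolding im q_serre_def using c by (simp add: opposite_finsum opposite_pow)
  also have "\<dots> = (\<Oplus>k\<in>{..n}. ?t (n - k))"
    by (rule finsum_reindex) (use c in \<open>auto intro!: inj_onI\<close>)
  also have "\<dots> = (\<Oplus>k\<in>{..n}. (- 1) ^ n \<odot> (((- 1) ^ k * ?I k * ?I (n - k)) \<odot> (x [^] k \<otimes> y \<otimes> x [^] (n - k))))"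
  proof (rule finsum_cong'; (simp add: c; fail)?)
    fix k assume "k \<in> {..n}"
    then have k: "k \<le> n" "n - (n - k) = k" by auto
    have e: "(- 1) ^ n * ((- 1) ^ k * ?I k * ?I (n - k))
        = ((- 1) ^ k * (- 1) ^ k) * ((- 1) ^ (n - k) * ?I k * ?I (n - k))"
      by (simp only: minus_one_power_split[OF k(1), symmetric] mult_ac)
    then show "?t (n - k) = (- 1) ^ n \<odot> (((- 1) ^ k * ?I k * ?I (n - k)) \<odot> (x [^] k \<otimes> y \<otimes> x [^] (n - k)))"
      using c unfolding k(2) by (simp add: smult_smult e m_assoc flip: power_mult_distrib)
        (simp add: mult_ac)
  qed
  also have "\<dots> = (- 1) ^ n \<odot> serre 0 n x y"
    unfolding q_serre_def using c by (subst smult_finsum) auto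
  finally show ?thesis using zero by simp
qed

end

section \<open>Root data\<close>

context symmetrizable_km_datum
begin

lemma scl_vector_space: "vector_space (scl D)"
  using finite_dim by (auto simp: finite_dimensional_vector_space_def)

interpretation V: vector_space "scl D" by (rule scl_vector_space)

lemma root_linear:
  assumes "i \<in> idx D"
  shows "simple_root D i (x + y) = simple_root D i x + simple_root D i y"
    "simple_root D i (scl D r x) = r * simple_root D i x"
    "simple_root D i (- x) = - simple_root D i x"
    "simple_root D i 0 = 0"
proof -
  interpret Vector_Spaces.linear "scl D" "(*)" "simple_root D i"
    using root_dual[OF assms] by (simp add: dual_space_def)
  show "simple_root D i (x + y) = simple_root D i x + simple_root D i y"
    "simple_root D i (scl D r x) = r * simple_root D i x"
    "simple_root D i (- x) = - simple_root D i x"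
    "simple_root D i 0 = 0"
    by (rule add scale neg zero)+
qed

lemma half_norm_nat: "i \<in> idx D \<Longrightarrow> \<exists>n::nat. n > 0 \<and> half_norm D i = of_nat n"
  using form_root_even[of i] by (auto simp: half_norm_def)

lemma half_norm_nonzero: "i \<in> idx D \<Longrightarrow> half_norm D i \<noteq> 0"
  using half_norm_nat by fastforce

definition root_form :: "'i \<Rightarrow> 'i \<Rightarrow> rat" where
  "root_form i j = form D (simple_root D i) (simple_root D j)"

lemma root_form_sym: "\<lbrakk>i \<in> idx D; j \<in> idx D\<rbrakk> \<Longrightarrow> root_form i j = root_form j i"
  unfolding root_form_def by (intro form_sym root_dual)

lemma half_norm_cartan:
  "\<lbrakk>i \<in> idx D; j \<in> idx D\<rbrakk> \<Longrightarrow> half_norm D i * simple_root D j (coroot D i) = root_form i j"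
  using coroot_form[OF _ root_dual, of i j] half_norm_nonzero[of i]
  by (simp add: half_norm_def root_form_def)

lemma cartan_diagonal: "i \<in> idx D \<Longrightarrow> simple_root D i (coroot D i) = 2"
  using half_norm_cartan[of i i] half_norm_nonzero[of i] by (simp add: half_norm_def root_form_def field_simps)

lemma qi_pow_cartan:
  "\<lbrakk>i \<in> idx D; j \<in> idx D\<rbrakk> \<Longrightarrow> qi_pow D i (s * simple_root D j (coroot D i)) = q_pow (s * root_form i j)"
  using half_norm_cartan[of i j] by (simp add: qi_pow_def mult.left_commute)

lemma latticeI: "h = (\<Sum>i\<in>idx D. scl D (of_int (n i)) (coroot D i)) \<Longrightarrow> h \<in> coroot_lattice D"
  unfolding coroot_lattice_def by (rule CollectI, rule exI[of _ n]) simp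

lemma latticeE:
  assumes "h \<in> coroot_lattice D"
  obtains n :: "'i \<Rightarrow> int" where "h = (\<Sum>i\<in>idx D. scl D (of_int (n i)) (coroot D i))"
  using assms unfolding coroot_lattice_def mem_Collect_eq by (elim exE conjE)

lemma lattice_zero: "0 \<in> coroot_lattice D"
  by (rule latticeI[of _ "\<lambda>_. 0"]) simp

lemma lattice_add:
  assumes "h \<in> coroot_lattice D" "h' \<in> coroot_lattice D"
  shows "h + h' \<in> coroot_lattice D"
proof -
  from assms obtain n m :: "'i \<Rightarrow> int" where
    "h = (\<Sum>i\<in>idx D. scl D (of_int (n i)) (coroot D i))"
    "h' = (\<Sum>i\<in>idx D. scl D (of_int (m i)) (coroot D i))"
    by (elim latticeE)
  then show ?thesis
    by (intro latticeI[of _ "\<lambda>i. n i + m i"]) (simp add: V.scale_left_distrib sum.distrib)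
qed

lemma lattice_uminus:
  assumes "h \<in> coroot_lattice D"
  shows "- h \<in> coroot_lattice D"
proof -
  from assms obtain n :: "'i \<Rightarrow> int" where
    "h = (\<Sum>i\<in>idx D. scl D (of_int (n i)) (coroot D i))"
    by (elim latticeE)
  then show ?thesis
    by (intro latticeI[of _ "\<lambda>i. - n i"]) (simp add: sum_negf)
qed

definition t_exp :: "'i \<Rightarrow> 'v" where
  "t_exp i = scl D (half_norm D i) (coroot D i)"

lemma t_exp_lattice: "i \<in> idx D \<Longrightarrow> t_exp i \<in> coroot_lattice D"
proof -
  assume i: "i \<in> idx D"
  then obtain n :: nat where n: "half_norm D i = of_nat n" using half_norm_nat by blast
  have "t_exp i = (\<Sum>j\<in>idx D. if j = i then scl D (of_nat n) (coroot D j) else 0)"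
    using i finite_idx by (simp add: t_exp_def n)
  also have "\<dots> = (\<Sum>j\<in>idx D. scl D (of_int (if j = i then int n else 0)) (coroot D j))"
    by (rule sum.cong) auto
  finally show ?thesis by (rule latticeI)
qed

lemma root_t_exp: "\<lbrakk>i \<in> idx D; j \<in> idx D\<rbrakk> \<Longrightarrow> simple_root D j (t_exp i) = root_form i j"
  by (simp add: t_exp_def root_linear half_norm_cartan)

end

section \<open>Presentation of the Kashiwara algebra\<close>

text \<open>
  The number \<open>1 - a\<close> of factors \<open>x\<^sub>i\<close> in the Serre relation for \<open>x\<^sub>i\<close> and \<open>x\<^sub>j\<close>.
\<close>

definition serre_order :: "('i, 'v) km_datum \<Rightarrow> 'i \<Rightarrow> 'i \<Rightarrow> nat" where
  "serre_order D i j = nat \<lfloor>1 - simple_root D j (coroot D i)\<rfloor>"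

definition kashiwara_relations ::
  "('i, 'v::ab_group_add) km_datum \<Rightarrow> (rat fps, 'b) module \<Rightarrow> ('i \<Rightarrow> 'b) \<Rightarrow> ('i \<Rightarrow> 'b) \<Rightarrow> ('v \<Rightarrow> 'b) \<Rightarrow> bool"
  where "kashiwara_relations D N E F Q \<longleftrightarrow>
    Q 0 = \<one>\<^bsub>N\<^esub> \<and>
    (\<forall>h\<in>coroot_lattice D. \<forall>h'\<in>coroot_lattice D. Q h \<otimes>\<^bsub>N\<^esub> Q h' = Q (h + h')) \<and>
    (\<forall>h\<in>coroot_lattice D. \<forall>i\<in>idx D.
      Q h \<otimes>\<^bsub>N\<^esub> E i \<otimes>\<^bsub>N\<^esub> Q (- h) = q_pow (simple_root D i h) \<odot>\<^bsub>N\<^esub> E i) \<and>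
    (\<forall>h\<in>coroot_lattice D. \<forall>i\<in>idx D.
      Q h \<otimes>\<^bsub>N\<^esub> F i \<otimes>\<^bsub>N\<^esub> Q (- h) = q_pow (- simple_root D i h) \<odot>\<^bsub>N\<^esub> F i) \<and>
    (\<forall>i\<in>idx D. \<forall>j\<in>idx D. E i \<otimes>\<^bsub>N\<^esub> F j =
      qi_pow D i (simple_root D j (coroot D i)) \<odot>\<^bsub>N\<^esub> (F j \<otimes>\<^bsub>N\<^esub> E i)
        \<oplus>\<^bsub>N\<^esub> (if i = j then \<one>\<^bsub>N\<^esub> else \<zero>\<^bsub>N\<^esub>)) \<and>
    (\<forall>i\<in>idx D. \<forall>j\<in>idx D. i \<noteq> j \<longrightarrow>
      q_serre N D i 0 (serre_order D i j) (E i) (E j) = \<zero>\<^bsub>N\<^esub> \<and>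
      q_serre N D i 0 (serre_order D i j) (F i) (F j) = \<zero>\<^bsub>N\<^esub>)"

lemma monoid_algebra_minus:
  assumes "Group.monoid G" "p \<in> carrier (monoid_algebra G)" "q \<in> carrier (monoid_algebra G)"
  shows "p \<ominus>\<^bsub>monoid_algebra G\<^esub> q = p - (q :: _ \<Rightarrow>\<^sub>0 'k::comm_ring_1)"
proof -
  interpret type_algebra "monoid_algebra G :: ('k, _) module"
    by (rule monoid_algebra_type_algebra) fact
  have "q \<oplus>\<^bsub>monoid_algebra G\<^esub> (- 1) \<odot>\<^bsub>monoid_algebra G\<^esub> q = \<zero>\<^bsub>monoid_algebra G\<^esub>"
    unfolding monoid_algebra_simps
    by (rule poly_mapping_eqI) (simp add: lookup_add lookup_map_mult)
  then have "p \<ominus>\<^bsub>monoid_algebra G\<^esub> q = p \<oplus>\<^bsub>monoid_algebra G\<^esub> (- 1) \<odot>\<^bsub>monoid_algebra G\<^esub> q"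
    using assms(2,3) by (simp add: minus_eq smult_minus_left)
  also have "\<dots> = p - q"
    unfolding monoid_algebra_simps
    by (rule poly_mapping_eqI) (simp add: lookup_add lookup_map_mult lookup_minus)
  finally show ?thesis .
qed

lemma word_monoid: "Group.monoid \<lparr>carrier = lists S, monoid.mult = (@), one = []\<rparr>"
  by (rule monoidI) auto

lemma free_algebra_type_algebra: "type_algebra (free_algebra S :: ('k::comm_ring_1, _) module)"
  unfolding free_algebra_def by (rule monoid_algebra_type_algebra[OF word_monoid])

lemma free_gen_closed: "g \<in> S \<Longrightarrow> free_gen g \<in> carrier (free_algebra S)"
  by (simp add: free_gen_def free_algebra_def monoid_algebra_simps)

lemma free_algebra_universal:
  fixes N :: "('k::comm_ring_1, 'b) module"
  assumes N: "type_algebra N" and G: "\<And>g. g \<in> S \<Longrightarrow> G g \<in> carrier N"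
  shows "\<exists>f. algebra_morphism (free_algebra S) N f \<and> (\<forall>g\<in>S. f (free_gen g) = G g)"
proof -
  interpret N: type_algebra N by fact
  let ?ev = "\<lambda>w. foldr (\<lambda>g x. G g \<otimes>\<^bsub>N\<^esub> x) w \<one>\<^bsub>N\<^esub>"
  have ev: "?ev w \<in> carrier N" if "w \<in> lists S" for w
    using that by (induction w) (auto simp: G)
  have ev_append: "?ev (v @ w) = ?ev v \<otimes>\<^bsub>N\<^esub> ?ev w" if "v \<in> lists S" "w \<in> lists S" for v w
    using that by (induction v) (auto simp: G N.m_assoc ev)
  have "algebra_morphism (free_algebra S) N (lincomb N ?ev)"
    unfolding free_algebra_def
    by (rule lincomb_monoid_algebra_hom[OF word_monoid N]) (use ev ev_append in auto)
  moreover have "lincomb N ?ev (free_gen g) = G g" if "g \<in> S" for g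
    unfolding free_gen_def using that G ev
    by (subst N.lincomb_single[of ?ev "lists S"]) auto
  ultimately show ?thesis by blast
qed

lemma free_algebra_induct [consumes 1, case_names one gen mult add smult]:
  fixes p :: "'g list \<Rightarrow>\<^sub>0 'k::comm_ring_1"
  assumes p: "p \<in> carrier (free_algebra S)"
    and one: "P \<one>\<^bsub>free_algebra S\<^esub>" and gen: "\<And>g. g \<in> S \<Longrightarrow> P (free_gen g)"
    and mult: "\<And>p q. \<lbrakk>p \<in> carrier (free_algebra S); q \<in> carrier (free_algebra S); P p; P q\<rbrakk>
      \<Longrightarrow> P (p \<otimes>\<^bsub>free_algebra S\<^esub> q)"
    and add: "\<And>p q. \<lbrakk>p \<in> carrier (free_algebra S); q \<in> carrier (free_algebra S); P p; P q\<rbrakk>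
      \<Longrightarrow> P (p \<oplus>\<^bsub>free_algebra S\<^esub> q)"
    and smult: "\<And>c p. \<lbrakk>p \<in> carrier (free_algebra S); P p\<rbrakk> \<Longrightarrow> P (c \<odot>\<^bsub>free_algebra S\<^esub> p)"
  shows "P p"
proof -
  interpret A: type_algebra "free_algebra S :: ('k, _) module" by (rule free_algebra_type_algebra)
  have carr: "carrier (free_algebra S :: ('k, _) module) = {p. Poly_Mapping.keys p \<subseteq> lists S}"
    by (simp add: free_algebra_def monoid_algebra_simps)
  have word: "P (Poly_Mapping.single w 1)" if "w \<in> lists S" for w
    using that
  proof (induction w)
    case Nil
    then show ?case using one by (simp add: free_algebra_def monoid_algebra_simps)
  next
    case (Cons g w)
    have "free_gen g \<otimes>\<^bsub>free_algebra S\<^esub> Poly_Mapping.single w (1::'k) = Poly_Mapping.single (g # w) 1"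
      by (simp add: free_gen_def free_algebra_def monoid_algebra_single)
    then show ?case
      using mult[OF free_gen_closed[OF Cons(1)], of "Poly_Mapping.single w 1"] gen Cons by (simp add: carr)
  qed
  from p have "Poly_Mapping.keys p \<subseteq> lists S" by (simp add: carr)
  then show ?thesis
  proof (induction p rule: poly_mapping_span_induct)
    case zero
    have "0 \<odot>\<^bsub>free_algebra S\<^esub> \<one>\<^bsub>free_algebra S\<^esub> = (0 :: 'g list \<Rightarrow>\<^sub>0 'k)"
      by (subst A.smult_zero_left) (simp_all add: free_algebra_def monoid_algebra_simps)
    then show ?case using smult[OF _ one, of 0] A.one_closed by metis
  next
    case (add w c p)
    have "P (c \<odot>\<^bsub>free_algebra S\<^esub> Poly_Mapping.single w 1)"
      using add(1) by (intro smult word) (simp_all add: carr)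
    then have "P (Poly_Mapping.single w c)"
      by (simp add: free_algebra_def monoid_algebra_simps map_mult_simps)
    then have "P (Poly_Mapping.single w c \<oplus>\<^bsub>free_algebra S\<^esub> p)"
      using add assms(5) by (simp add: carr)
    then show ?case by (simp add: free_algebra_def monoid_algebra_simps)
  qed
qed

context symmetrizable_km_datum
begin

abbreviation "FA \<equiv> kfree_algebra D"

lemma FA_type_algebra: "type_algebra FA"
  unfolding kfree_algebra_def by (rule free_algebra_type_algebra)

interpretation FA: type_algebra FA by (rule FA_type_algebra)

lemma FA_simps:
  "p \<oplus>\<^bsub>FA\<^esub> q = p + q" "\<zero>\<^bsub>FA\<^esub> = 0"
  "\<lbrakk>p \<in> carrier FA; q \<in> carrier FA\<rbrakk> \<Longrightarrow> p \<ominus>\<^bsub>FA\<^esub> q = p - q"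
  unfolding kfree_algebra_def free_algebra_def
  by (simp_all add: monoid_algebra_simps monoid_algebra_minus[OF word_monoid])

lemma gens:
  "i \<in> idx D \<Longrightarrow> free_gen (Gen_e i) \<in> carrier FA"
  "i \<in> idx D \<Longrightarrow> free_gen (Gen_f i) \<in> carrier FA"
  "h \<in> coroot_lattice D \<Longrightarrow> free_gen (Gen_q h) \<in> carrier FA"
  unfolding kfree_algebra_def by (auto intro!: free_gen_closed simp: kgens_def)

lemma serre_element_eq:
  assumes "free_gen (G i) \<in> carrier FA" "free_gen (G j) \<in> carrier FA"
  shows "serre_element D G i j = q_serre FA D i 0 (serre_order D i j) (free_gen (G i)) (free_gen (G j))"
  unfolding serre_element_def Let_def q_serre_def serre_order_def[symmetric] divided_power_def
    atMost_atLeast0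
  by (rule FA.finsum_cong')
    (use assms in \<open>auto simp: FA.smult_mult_left FA.smult_mult_right FA.smult_smult mult_ac\<close>)

lemma serre_element_closed:
  assumes "free_gen (G i) \<in> carrier FA" "free_gen (G j) \<in> carrier FA"
  shows "serre_element D G i j \<in> carrier FA"
  unfolding serre_element_eq[OF assms] q_serre_def using assms by (auto intro!: FA.finsum_closed)

lemma diff_closed: "\<lbrakk>p \<in> carrier FA; q \<in> carrier FA\<rbrakk> \<Longrightarrow> p - q \<in> carrier FA"
  by (metis FA_simps(3) FA.minus_closed)

lemma e_f_closed:
  assumes "i \<in> idx D" "j \<in> idx D"
  shows "c \<odot>\<^bsub>FA\<^esub> (free_gen (Gen_f j) \<otimes>\<^bsub>FA\<^esub> free_gen (Gen_e i)) + (if i = j then \<one>\<^bsub>FA\<^esub> else 0) \<in> carrier FA"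
  unfolding FA_simps(1,2)[symmetric] using assms gens by simp

lemma kashiwara_rels_carrier: "kashiwara_rels D \<subseteq> carrier FA"
proof
  fix r assume "r \<in> kashiwara_rels D"
  then show "r \<in> carrier FA"
    by cases
      (simp_all add: diff_closed e_f_closed serre_element_closed gens lattice_zero lattice_add lattice_uminus)
qed

lemma rel_zero_iff:
  assumes "algebra_morphism FA N f" "p \<in> carrier FA" "q \<in> carrier FA"
  shows "f (p - q) = \<zero>\<^bsub>N\<^esub> \<longleftrightarrow> f p = f q"
proof -
  interpret algebra_morphism FA N f by fact
  show ?thesis
    using assms(2,3) by (simp add: FA_simps(3)[symmetric] hom_minus B.minus_eq_zero_iff)
qed

text \<open>
  Used in both directions: for the projection onto \<open>B\<close> it says which equations hold in \<open>B\<close>, and for a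
  morphism that is defined on generators it says when that morphism descends to \<open>B\<close>.
\<close>

lemma kashiwara_rels_iff:
  assumes "algebra_morphism FA N f"
  shows "(\<forall>r\<in>kashiwara_rels D. f r = \<zero>\<^bsub>N\<^esub>) \<longleftrightarrow>
    kashiwara_relations D N (\<lambda>i. f (free_gen (Gen_e i))) (\<lambda>i. f (free_gen (Gen_f i)))
      (\<lambda>h. f (free_gen (Gen_q h)))"
    (is "?K \<longleftrightarrow> ?R")
proof -
  interpret algebra_morphism FA N f by fact
  let ?e = "\<lambda>i. free_gen (Gen_e i)" and ?f = "\<lambda>i. free_gen (Gen_f i)" and ?q = "\<lambda>h. free_gen (Gen_q h)"
  note cl = gens lattice_zero lattice_add lattice_uminus
  note m = rel_zero_iff[OF assms] cl hom_mult hom_smult hom_one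
  have q_zero: "f (?q 0 - \<one>\<^bsub>FA\<^esub>) = \<zero>\<^bsub>N\<^esub> \<longleftrightarrow> f (?q 0) = \<one>\<^bsub>N\<^esub>"
    using cl by (simp add: m)
  have q_add: "f (?q h \<otimes>\<^bsub>FA\<^esub> ?q h' - ?q (h + h')) = \<zero>\<^bsub>N\<^esub> \<longleftrightarrow> f (?q h) \<otimes>\<^bsub>N\<^esub> f (?q h') = f (?q (h + h'))"
    if "h \<in> coroot_lattice D" "h' \<in> coroot_lattice D" for h h'
    using that by (simp add: m)
  have q_x: "f (?q h \<otimes>\<^bsub>FA\<^esub> x \<otimes>\<^bsub>FA\<^esub> ?q (- h) - c \<odot>\<^bsub>FA\<^esub> x) = \<zero>\<^bsub>N\<^esub> \<longleftrightarrow>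
      f (?q h) \<otimes>\<^bsub>N\<^esub> f x \<otimes>\<^bsub>N\<^esub> f (?q (- h)) = c \<odot>\<^bsub>N\<^esub> f x"
    if "h \<in> coroot_lattice D" "x \<in> carrier FA" for h x c
    using that by (simp add: m)
  have e_f: "f (?e i \<otimes>\<^bsub>FA\<^esub> ?f j - (c \<odot>\<^bsub>FA\<^esub> (?f j \<otimes>\<^bsub>FA\<^esub> ?e i) + (if i = j then \<one>\<^bsub>FA\<^esub> else 0))) = \<zero>\<^bsub>N\<^esub> \<longleftrightarrow>
     f (?e i) \<otimes>\<^bsub>N\<^esub> f (?f j) = c \<odot>\<^bsub>N\<^esub> (f (?f j) \<otimes>\<^bsub>N\<^esub> f (?e i)) \<oplus>\<^bsub>N\<^esub> (if i = j then \<one>\<^bsub>N\<^esub> else \<zero>\<^bsub>N\<^esub>)"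
    if "i \<in> idx D" "j \<in> idx D" for i j c
  proof -
    have "f (c \<odot>\<^bsub>FA\<^esub> (?f j \<otimes>\<^bsub>FA\<^esub> ?e i) + (if i = j then \<one>\<^bsub>FA\<^esub> else 0)) =
      c \<odot>\<^bsub>N\<^esub> (f (?f j) \<otimes>\<^bsub>N\<^esub> f (?e i)) \<oplus>\<^bsub>N\<^esub> (if i = j then \<one>\<^bsub>N\<^esub> else \<zero>\<^bsub>N\<^esub>)"
      unfolding FA_simps(1,2)[symmetric] using that cl
      by (simp add: hom_add hom_smult hom_mult hom_one hom_zero)
    then show ?thesis
      using that e_f_closed[OF that] cl by (subst rel_zero_iff[OF assms]) (simp_all add: hom_mult)
  qed
  have serre: "f (serre_element D G i j) = \<zero>\<^bsub>N\<^esub> \<longleftrightarrow>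
      q_serre N D i 0 (serre_order D i j) (f (free_gen (G i))) (f (free_gen (G j))) = \<zero>\<^bsub>N\<^esub>"
    if "free_gen (G i) \<in> carrier FA" "free_gen (G j) \<in> carrier FA" for G i j
    using that by (simp add: serre_element_eq hom_q_serre[OF assms])
  show ?thesis
  proof
    assume K: ?K
    note holds = bspec[OF K]
    show ?R
      unfolding kashiwara_relations_def
      using holds[OF kashiwara_rels.q_zero] holds[OF kashiwara_rels.q_add] holds[OF kashiwara_rels.q_e]
        holds[OF kashiwara_rels.q_f] holds[OF kashiwara_rels.e_f] holds[OF kashiwara_rels.serre_e]
        holds[OF kashiwara_rels.serre_f] gens
      by (simp add: q_zero q_add q_x e_f serre del: if_split)
  next
    assume R: ?R
    show ?K
    proof
      fix r assume "r \<in> kashiwara_rels D"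
      then show "f r = \<zero>\<^bsub>N\<^esub>"
        by cases (use R[unfolded kashiwara_relations_def] gens in \<open>simp_all add: q_zero q_add q_x e_f serre del: if_split\<close>)
    qed
  qed
qed

abbreviation "\<B> \<equiv> kashiwara_algebra D"

lemma FA_ideal: "algebra_ideal FA (kashiwara_ideal D)"
  unfolding kashiwara_ideal_def
  by (intro algebra_ideal.intro FA_type_algebra FA.genideal_ideal kashiwara_rels_carrier)

interpretation J: algebra_ideal FA "kashiwara_ideal D" by (rule FA_ideal)

lemma B_type_algebra: "type_algebra \<B>"
  unfolding kashiwara_algebra_def by (rule J.quot_type_algebra)

lemma B_projection: "algebra_morphism FA \<B> (\<lambda>p. kashiwara_ideal D +>\<^bsub>FA\<^esub> p)"
  unfolding kashiwara_algebra_def by (rule J.coset_morphism)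

interpretation pr: algebra_morphism FA \<B> "\<lambda>p. kashiwara_ideal D +>\<^bsub>FA\<^esub> p"
  by (rule B_projection)

lemma B_carrier: "carrier \<B> = (\<lambda>p. kashiwara_ideal D +>\<^bsub>FA\<^esub> p) ` carrier FA"
  unfolding kashiwara_algebra_def quot_algebra_simps ..

lemma B_gens:
  "i \<in> idx D \<Longrightarrow> gen_e D i \<in> carrier \<B>"
  "i \<in> idx D \<Longrightarrow> gen_f D i \<in> carrier \<B>"
  "h \<in> coroot_lattice D \<Longrightarrow> gen_q D h \<in> carrier \<B>"
  unfolding gen_e_def gen_f_def gen_q_def kashiwara_gen_def by (simp_all add: gens)

lemma B_relations: "kashiwara_relations D \<B> (gen_e D) (gen_f D) (gen_q D)"
proof -
  have "kashiwara_ideal D +>\<^bsub>FA\<^esub> r = \<zero>\<^bsub>\<B>\<^esub>" if "r \<in> kashiwara_rels D" for r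
  proof -
    have "r \<in> kashiwara_ideal D"
      using that FA.genideal_self[OF kashiwara_rels_carrier] by (auto simp: kashiwara_ideal_def)
    then show ?thesis
      by (simp add: J.a_rcos_const kashiwara_algebra_def quot_algebra_simps)
  qed
  then show ?thesis
    using kashiwara_rels_iff[OF B_projection]
    by (simp add: gen_e_def[abs_def] gen_f_def[abs_def] gen_q_def[abs_def] kashiwara_gen_def)
qed

text \<open>
  The kernel of the induced morphism on the free algebra is an ideal that contains the relations, hence it
  contains the ideal which they generate.
\<close>

lemma B_universal:
  assumes N: "type_algebra N"
    and E: "\<And>i. i \<in> idx D \<Longrightarrow> E i \<in> carrier N" and F: "\<And>i. i \<in> idx D \<Longrightarrow> F i \<in> carrier N"
    and Q: "\<And>h. h \<in> coroot_lattice D \<Longrightarrow> Q h \<in> carrier N"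
    and rel: "kashiwara_relations D N E F Q"
  obtains f where "algebra_morphism \<B> N f" "\<And>i. i \<in> idx D \<Longrightarrow> f (gen_e D i) = E i"
    "\<And>i. i \<in> idx D \<Longrightarrow> f (gen_f D i) = F i" "\<And>h. h \<in> coroot_lattice D \<Longrightarrow> f (gen_q D h) = Q h"
proof -
  let ?G = "\<lambda>g. case g of Gen_e i \<Rightarrow> E i | Gen_f i \<Rightarrow> F i | Gen_q h \<Rightarrow> Q h"
  have G: "?G g \<in> carrier N" if "g \<in> kgens D" for g
    using that E F Q by (auto simp: kgens_def)
  have "\<exists>f. algebra_morphism FA N f \<and> (\<forall>g\<in>kgens D. f (free_gen g) = ?G g)"
    unfolding kfree_algebra_def by (rule free_algebra_universal[OF N G])
  then obtain f where
    f: "algebra_morphism FA N f" and fg: "\<forall>g\<in>kgens D. f (free_gen g) = ?G g"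
    by (elim exE conjE)
  interpret f: algebra_morphism FA N f by (rule f)
  have fgen: "i \<in> idx D \<Longrightarrow> f (free_gen (Gen_e i)) = E i" "i \<in> idx D \<Longrightarrow> f (free_gen (Gen_f i)) = F i"
    "h \<in> coroot_lattice D \<Longrightarrow> f (free_gen (Gen_q h)) = Q h" for i h
    using fg by (auto simp: kgens_def)
  have "kashiwara_relations D N (\<lambda>i. f (free_gen (Gen_e i))) (\<lambda>i. f (free_gen (Gen_f i)))
      (\<lambda>h. f (free_gen (Gen_q h)))"
    using rel unfolding kashiwara_relations_def
    by (simp add: fgen lattice_zero lattice_add lattice_uminus)
  then have "kashiwara_rels D \<subseteq> {p \<in> carrier FA. f p = \<zero>\<^bsub>N\<^esub>}"
    using kashiwara_rels_iff[OF f] kashiwara_rels_carrier by blast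
  then have "kashiwara_ideal D \<subseteq> {p \<in> carrier FA. f p = \<zero>\<^bsub>N\<^esub>}"
    unfolding kashiwara_ideal_def by (rule FA.genideal_minimal[OF f.kernel_ideal])
  then obtain g where g: "algebra_morphism \<B> N g"
    "\<And>p. p \<in> carrier FA \<Longrightarrow> g (kashiwara_ideal D +>\<^bsub>FA\<^esub> p) = f p"
    using f.factor_through_quotient[OF FA_ideal] unfolding kashiwara_algebra_def by auto
  show ?thesis
    by (rule that[OF g(1)])
      (simp_all add: gen_e_def gen_f_def gen_q_def kashiwara_gen_def g(2) gens fgen)
qed

lemma B_induct [consumes 1, case_names one e f q mult add smult]:
  assumes x: "x \<in> carrier \<B>"
    and one: "P \<one>\<^bsub>\<B>\<^esub>"
    and e: "\<And>i. i \<in> idx D \<Longrightarrow> P (gen_e D i)" and f: "\<And>i. i \<in> idx D \<Longrightarrow> P (gen_f D i)"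
    and q: "\<And>h. h \<in> coroot_lattice D \<Longrightarrow> P (gen_q D h)"
    and mult: "\<And>x y. \<lbrakk>x \<in> carrier \<B>; y \<in> carrier \<B>; P x; P y\<rbrakk> \<Longrightarrow> P (x \<otimes>\<^bsub>\<B>\<^esub> y)"
    and add: "\<And>x y. \<lbrakk>x \<in> carrier \<B>; y \<in> carrier \<B>; P x; P y\<rbrakk> \<Longrightarrow> P (x \<oplus>\<^bsub>\<B>\<^esub> y)"
    and smult: "\<And>c x. \<lbrakk>x \<in> carrier \<B>; P x\<rbrakk> \<Longrightarrow> P (c \<odot>\<^bsub>\<B>\<^esub> x)"
  shows "P x"
proof -
  from x obtain p where p: "p \<in> carrier FA" "x = kashiwara_ideal D +>\<^bsub>FA\<^esub> p" by (auto simp: B_carrier)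
  from p(1) have "P (kashiwara_ideal D +>\<^bsub>FA\<^esub> p)"
  proof (induction rule: free_algebra_induct[where 'k = "rat fps" and S = "kgens D", folded kfree_algebra_def, consumes 1,
        case_names one gen mult add smult])
    case one
    show ?case using assms(2) by (simp only: pr.hom_one)
  next
    case (gen g)
    then show ?case
      using e f q
      by (auto simp: kgens_def gen_e_def gen_f_def gen_q_def kashiwara_gen_def)
  next
    case (mult p q)
    then show ?case by (simp only: pr.hom_mult) (intro assms(6) pr.closed)
  next
    case (add p q)
    then show ?case by (simp only: pr.hom_add) (intro assms(7) pr.closed)
  next
    case (smult c p)
    then show ?case by (simp only: pr.hom_smult) (intro assms(8) pr.closed)
  qed
  then show ?thesis using p by simp
qed

lemma B_hom_eqI:
  assumes "algebra_morphism \<B> N f" "algebra_morphism \<B> N g" "x \<in> carrier \<B>"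
    and "\<And>i. i \<in> idx D \<Longrightarrow> f (gen_e D i) = g (gen_e D i)" "\<And>i. i \<in> idx D \<Longrightarrow> f (gen_f D i) = g (gen_f D i)"
    "\<And>h. h \<in> coroot_lattice D \<Longrightarrow> f (gen_q D h) = g (gen_q D h)"
  shows "f x = g x"
proof -
  interpret f: algebra_morphism \<B> N f by fact
  interpret g: algebra_morphism \<B> N g by fact
  show ?thesis
    using assms(3)
    by (induction rule: B_induct)
      (simp_all add: assms(4-) f.hom_one g.hom_one f.hom_mult g.hom_mult f.hom_add g.hom_add
        f.hom_smult g.hom_smult)
qed

end

section \<open>Homomorphisms out of tensor products\<close>

lemma multilinear_cong:
  assumes "multilinear As N g" "\<And>i. i < length As \<Longrightarrow> type_algebra (As ! i)"
    and eq: "\<And>xs. xs \<in> listset (map carrier As) \<Longrightarrow> h xs = g xs"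
  shows "multilinear As N h"
proof -
  have u: "xs[i := x] \<in> listset (map carrier As)"
    if "xs \<in> listset (map carrier As)" "x \<in> carrier (As ! i)" for xs i x
    using that by (cases "i < length xs") (auto simp: listset_iff_nth nth_list_update)
  have c: "x \<oplus>\<^bsub>As ! i\<^esub> y \<in> carrier (As ! i)" "c \<odot>\<^bsub>As ! i\<^esub> x \<in> carrier (As ! i)"
    if "i < length As" "x \<in> carrier (As ! i)" "y \<in> carrier (As ! i)" for i x y c
  proof -
    interpret type_algebra "As ! i" by (rule assms(2)) fact
    show "x \<oplus>\<^bsub>As ! i\<^esub> y \<in> carrier (As ! i)" "c \<odot>\<^bsub>As ! i\<^esub> x \<in> carrier (As ! i)"
      using that by auto
  qed
  show ?thesis
    using assms(1) unfolding multilinear_def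
    by (intro ballI conjI allI impI) (simp_all add: eq u c)
qed

lemma multilinearD:
  assumes "multilinear As N g" "xs \<in> listset (map carrier As)"
  shows "g xs \<in> carrier N"
    and "\<lbrakk>i < length As; x \<in> carrier (As ! i); y \<in> carrier (As ! i)\<rbrakk> \<Longrightarrow>
      g (xs[i := x \<oplus>\<^bsub>As ! i\<^esub> y]) = g (xs[i := x]) \<oplus>\<^bsub>N\<^esub> g (xs[i := y])"
    and "\<lbrakk>i < length As; x \<in> carrier (As ! i)\<rbrakk> \<Longrightarrow>
      g (xs[i := c \<odot>\<^bsub>As ! i\<^esub> x]) = c \<odot>\<^bsub>N\<^esub> g (xs[i := x])"
  using assms unfolding multilinear_def by blast+

lemma multilinear3I:
  assumes "\<And>x y z. \<lbrakk>x \<in> carrier A; y \<in> carrier B; z \<in> carrier C\<rbrakk> \<Longrightarrow> g [x, y, z] \<in> carrier N"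
    "\<And>x x' y z. \<lbrakk>x \<in> carrier A; x' \<in> carrier A; y \<in> carrier B; z \<in> carrier C\<rbrakk> \<Longrightarrow>
      g [x \<oplus>\<^bsub>A\<^esub> x', y, z] = g [x, y, z] \<oplus>\<^bsub>N\<^esub> g [x', y, z]"
    "\<And>x y y' z. \<lbrakk>x \<in> carrier A; y \<in> carrier B; y' \<in> carrier B; z \<in> carrier C\<rbrakk> \<Longrightarrow>
      g [x, y \<oplus>\<^bsub>B\<^esub> y', z] = g [x, y, z] \<oplus>\<^bsub>N\<^esub> g [x, y', z]"
    "\<And>x y z z'. \<lbrakk>x \<in> carrier A; y \<in> carrier B; z \<in> carrier C; z' \<in> carrier C\<rbrakk> \<Longrightarrow>
      g [x, y, z \<oplus>\<^bsub>C\<^esub> z'] = g [x, y, z] \<oplus>\<^bsub>N\<^esub> g [x, y, z']"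
    "\<And>c x y z. \<lbrakk>x \<in> carrier A; y \<in> carrier B; z \<in> carrier C\<rbrakk> \<Longrightarrow>
      g [c \<odot>\<^bsub>A\<^esub> x, y, z] = c \<odot>\<^bsub>N\<^esub> g [x, y, z]"
    "\<And>c x y z. \<lbrakk>x \<in> carrier A; y \<in> carrier B; z \<in> carrier C\<rbrakk> \<Longrightarrow>
      g [x, c \<odot>\<^bsub>B\<^esub> y, z] = c \<odot>\<^bsub>N\<^esub> g [x, y, z]"
    "\<And>c x y z. \<lbrakk>x \<in> carrier A; y \<in> carrier B; z \<in> carrier C\<rbrakk> \<Longrightarrow>
      g [x, y, c \<odot>\<^bsub>C\<^esub> z] = c \<odot>\<^bsub>N\<^esub> g [x, y, z]"
  shows "multilinear [A, B, C] N g"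
  unfolding multilinear_def
  using assms by (auto simp: set_Cons_def less_Suc_eq)

text \<open>
  For maps that differ from a known multilinear one by a linear map in one slot, such as \<^const>\<open>theta_middle\<close>.
\<close>

lemma multilinear_precompose:
  assumes g: "multilinear As N g" and As: "\<And>i. i < length As \<Longrightarrow> type_algebra (As ! i)"
    and k: "k < length As" and f: "algebra_morphism (As ! k) (As ! k) f"
  shows "multilinear As N (\<lambda>w. g (w[k := f (w ! k)]))"
proof -
  interpret f: algebra_morphism "As ! k" "As ! k" f by (rule f)
  have u: "xs[i := x] \<in> listset (map carrier As)"
    if "xs \<in> listset (map carrier As)" "x \<in> carrier (As ! i)" for xs i x
    using that by (cases "i < length xs") (auto simp: listset_iff_nth nth_list_update)
  have fk: "xs[k := f (xs ! k)] \<in> listset (map carrier As)" if "xs \<in> listset (map carrier As)" for xs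
    using that k by (intro u) (auto simp: listset_iff_nth)
  have len: "length xs = length As" if "xs \<in> listset (map carrier As)" for xs
    using that by (simp add: listset_iff_nth)
  have upd: "xs[i := x, k := f (xs[i := x] ! k)] =
      (if i = k then xs[k := f x] else xs[k := f (xs ! k), i := x])"
    if "xs \<in> listset (map carrier As)" for xs i x
    using that k by (auto simp: len list_update_swap)
  show ?thesis
    unfolding multilinear_def
    using multilinearD[OF g fk] multilinearD[OF g] by (auto simp: upd f.hom_add f.hom_smult k)
qed

context tensor_factors
begin

lemma tensor_lift_morphism:
  assumes N: "type_algebra N" and g: "multilinear As N g"
    and mult: "\<And>xs ys. \<lbrakk>xs \<in> listset (map carrier As); ys \<in> listset (map carrier As)\<rbrakk> \<Longrightarrow>
      g (xs \<otimes>\<^bsub>tuple_monoid As\<^esub> ys) = g xs \<otimes>\<^bsub>N\<^esub> g ys"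
    and one: "g (map one As) = \<one>\<^bsub>N\<^esub>"
  shows "algebra_morphism (tensor_algebra As) N (tensor_lift N g)"
proof -
  interpret N: type_algebra N by (rule N)
  let ?T = "tensor_algebra As" and ?L = "tensor_lift N g"
  note lin = tensor_lift_linear[OF N g] and lift_pure = tensor_lift_pure[OF N g]
  have 1: "?L (pure_tensor As xs \<otimes>\<^bsub>?T\<^esub> V) = ?L (pure_tensor As xs) \<otimes>\<^bsub>N\<^esub> ?L V"
    if "xs \<in> listset (map carrier As)" "V \<in> carrier ?T" for xs V
    using that(2)
  proof (induction rule: tensor_induct)
    case (pure ys)
    then show ?case
      using that(1) by (simp add: pure_mult lift_pure tuple_mult_closed mult)
  next
    case (add U V)
    then show ?case
      using that(1) by (simp add: T.r_distr lin pure_closed N.r_distr)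
  qed
  have "?L (U \<otimes>\<^bsub>?T\<^esub> V) = ?L U \<otimes>\<^bsub>N\<^esub> ?L V" if "U \<in> carrier ?T" "V \<in> carrier ?T" for U V
    using that(1)
  proof (induction rule: tensor_induct)
    case (pure xs)
    then show ?case using that(2) by (rule 1)
  next
    case (add U U')
    then show ?case using that(2) by (simp add: T.l_distr lin N.l_distr)
  qed
  then show ?thesis
    by unfold_locales
      (rule algebra_homI; simp add: lin pure_one lift_pure one_tuple one)
qed

end

lemma tensor_factorsI:
  "As \<noteq> [] \<Longrightarrow> (\<And>A. A \<in> set As \<Longrightarrow> type_algebra A) \<Longrightarrow> tensor_factors As"
  by (rule tensor_factors.intro) auto

lemma commuting_morphisms_multilinear:
  assumes "algebra_morphism A N \<alpha>" "algebra_morphism B N \<beta>" "algebra_morphism C N \<gamma>"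
  shows "multilinear [A, B, C] N (\<lambda>w. \<alpha> (w ! 0) \<otimes>\<^bsub>N\<^esub> \<beta> (w ! 1) \<otimes>\<^bsub>N\<^esub> \<gamma> (w ! 2))"
proof -
  interpret \<alpha>: algebra_morphism A N \<alpha> by fact
  interpret \<beta>: algebra_morphism B N \<beta> by fact
  interpret \<gamma>: algebra_morphism C N \<gamma> by fact
  show ?thesis
    by (rule multilinear3I)
      (simp_all add: \<alpha>.hom_add \<beta>.hom_add \<gamma>.hom_add \<alpha>.hom_smult \<beta>.hom_smult \<gamma>.hom_smult
        \<alpha>.B.l_distr \<alpha>.B.r_distr \<alpha>.B.smult_mult_left \<alpha>.B.smult_mult_right)
qed

text \<open>
  If morphisms from the factors have commuting images, then their product is a morphism on the tensor
  product. The maps between tensor powers in the torsor axioms are all of this form; presenting them so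
  reduces multiplicativity to commutation in the target.
\<close>

lemma commuting_morphisms_tensor:
  assumes \<alpha>: "algebra_morphism A N \<alpha>" and \<beta>: "algebra_morphism B N \<beta>" and \<gamma>: "algebra_morphism C N \<gamma>"
    and ab: "\<And>x y. x \<in> carrier A \<Longrightarrow> y \<in> carrier B \<Longrightarrow> \<beta> y \<otimes>\<^bsub>N\<^esub> \<alpha> x = \<alpha> x \<otimes>\<^bsub>N\<^esub> \<beta> y"
    and ac: "\<And>x z. x \<in> carrier A \<Longrightarrow> z \<in> carrier C \<Longrightarrow> \<gamma> z \<otimes>\<^bsub>N\<^esub> \<alpha> x = \<alpha> x \<otimes>\<^bsub>N\<^esub> \<gamma> z"
    and bc: "\<And>y z. y \<in> carrier B \<Longrightarrow> z \<in> carrier C \<Longrightarrow> \<gamma> z \<otimes>\<^bsub>N\<^esub> \<beta> y = \<beta> y \<otimes>\<^bsub>N\<^esub> \<gamma> z"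
    and g: "\<And>x y z. \<lbrakk>x \<in> carrier A; y \<in> carrier B; z \<in> carrier C\<rbrakk> \<Longrightarrow>
      g [x, y, z] = \<alpha> x \<otimes>\<^bsub>N\<^esub> \<beta> y \<otimes>\<^bsub>N\<^esub> \<gamma> z"
  shows "multilinear [A, B, C] N g"
    and "algebra_morphism (tensor_algebra [A, B, C]) N (tensor_lift N g)"
proof -
  interpret \<alpha>: algebra_morphism A N \<alpha> by fact
  interpret \<beta>: algebra_morphism B N \<beta> by fact
  interpret \<gamma>: algebra_morphism C N \<gamma> by fact
  interpret F: tensor_factors "[A, B, C]"
    by (rule tensor_factorsI)
      (use \<alpha>.A.type_algebra_axioms \<beta>.A.type_algebra_axioms \<gamma>.A.type_algebra_axioms in auto)
  note ml = commuting_morphisms_multilinear[OF \<alpha> \<beta> \<gamma>]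
  show g_ml: "multilinear [A, B, C] N g"
    by (rule multilinear_cong[OF ml F.factor_type_algebra]) (auto simp: g set_Cons_def)
  have "g (xs \<otimes>\<^bsub>tuple_monoid [A, B, C]\<^esub> ys) = g xs \<otimes>\<^bsub>N\<^esub> g ys"
    if t: "xs \<in> listset (map carrier [A, B, C])" "ys \<in> listset (map carrier [A, B, C])" for xs ys
  proof -
    from t obtain x y z x' y' z' where xyz: "xs = [x, y, z]" "ys = [x', y', z']"
      "x \<in> carrier A" "y \<in> carrier B" "z \<in> carrier C" "x' \<in> carrier A" "y' \<in> carrier B" "z' \<in> carrier C"
      by (auto simp: set_Cons_def)
    have "g (xs \<otimes>\<^bsub>tuple_monoid [A, B, C]\<^esub> ys) =
        \<alpha> x \<otimes>\<^bsub>N\<^esub> \<alpha> x' \<otimes>\<^bsub>N\<^esub> (\<beta> y \<otimes>\<^bsub>N\<^esub> \<beta> y') \<otimes>\<^bsub>N\<^esub> (\<gamma> z \<otimes>\<^bsub>N\<^esub> \<gamma> z')"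
      using xyz by (simp add: tuple_monoid_def g \<alpha>.hom_mult \<beta>.hom_mult \<gamma>.hom_mult)
    also have "\<dots> = \<alpha> x \<otimes>\<^bsub>N\<^esub> (\<beta> y \<otimes>\<^bsub>N\<^esub> \<alpha> x') \<otimes>\<^bsub>N\<^esub> (\<gamma> z \<otimes>\<^bsub>N\<^esub> \<beta> y') \<otimes>\<^bsub>N\<^esub> \<gamma> z'"
      using xyz by (simp add: \<alpha>.B.m_assoc ab bc)
    also have "\<dots> = \<alpha> x \<otimes>\<^bsub>N\<^esub> \<beta> y \<otimes>\<^bsub>N\<^esub> (\<gamma> z \<otimes>\<^bsub>N\<^esub> \<alpha> x') \<otimes>\<^bsub>N\<^esub> \<beta> y' \<otimes>\<^bsub>N\<^esub> \<gamma> z'"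
      using xyz by (simp add: \<alpha>.B.m_assoc[symmetric] ac)
    finally show ?thesis using xyz by (simp add: g \<alpha>.B.m_assoc)
  qed
  then show "algebra_morphism (tensor_algebra [A, B, C]) N (tensor_lift N g)"
    by (intro F.tensor_lift_morphism g_ml \<alpha>.B.type_algebra_axioms)
      (simp_all add: g \<alpha>.hom_one \<beta>.hom_one \<gamma>.hom_one)
qed

lemma opposite_opposite: "opposite (opposite A) = A"
  by (simp add: opposite_def)

lemma opposite_morphism:
  assumes "algebra_morphism A B f"
  shows "algebra_morphism (opposite A) (opposite B) f"
proof -
  interpret algebra_morphism A B f by fact
  show ?thesis
    by (intro algebra_morphism.intro algebra_morphism_axioms.intro opposite_type_algebra
        A.type_algebra_axioms B.type_algebra_axioms algebra_homI)
      (simp_all add: hom_add hom_mult hom_one hom_smult)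
qed

section \<open>The tensor powers in the definition of a quantum torsor\<close>

locale torsor_tensors = type_algebra T for T :: "('k::comm_ring_1, 'a) module" (structure)
begin

abbreviation "T2 \<equiv> tensor_algebra [T, T]"
abbreviation "T3 \<equiv> tensor_algebra (torsor_factors3 T)"
abbreviation "T5 \<equiv> tensor_algebra (torsor_factors5 T)"
abbreviation "p2 x y \<equiv> pure_tensor [T, T] [x, y]"
abbreviation "p3 x y z \<equiv> pure_tensor (torsor_factors3 T) [x, y, z]"
abbreviation "p5 x y z u v \<equiv> pure_tensor (torsor_factors5 T) [x, y, z, u, v]"

lemma factors: "tensor_factors [T, T]" "tensor_factors (torsor_factors3 T)" "tensor_factors (torsor_factors5 T)"
  using type_algebra_axioms opposite_type_algebra[OF type_algebra_axioms]
  by (auto intro!: tensor_factorsI)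

lemma T2_type_algebra: "type_algebra T2"
  and T3_type_algebra: "type_algebra T3"
  and T5_type_algebra: "type_algebra T5"
proof -
  interpret F2: tensor_factors "[T, T]" by (rule factors)
  interpret F3: tensor_factors "torsor_factors3 T" by (rule factors)
  interpret F5: tensor_factors "torsor_factors5 T" by (rule factors)
  show "type_algebra T2" "type_algebra T3" "type_algebra T5"
    by (rule F2.T.type_algebra_axioms F3.T.type_algebra_axioms F5.T.type_algebra_axioms)+
qed

sublocale T2: type_algebra T2 by (rule T2_type_algebra)
sublocale T3: type_algebra T3 by (rule T3_type_algebra)
sublocale T5: type_algebra T5 by (rule T5_type_algebra)

lemmas pure_slots = multilinearD[OF tensor_factors.pure_multilinear]

lemma p2_simps:
  assumes "x \<in> carrier T" "y \<in> carrier T"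
  shows p2_closed: "p2 x y \<in> carrier T2"
    and p2_add: "x' \<in> carrier T \<Longrightarrow> p2 (x \<oplus> x') y = p2 x y \<oplus>\<^bsub>T2\<^esub> p2 x' y"
      "y' \<in> carrier T \<Longrightarrow> p2 x (y \<oplus> y') = p2 x y \<oplus>\<^bsub>T2\<^esub> p2 x y'"
    and p2_smult: "p2 (c \<odot> x) y = c \<odot>\<^bsub>T2\<^esub> p2 x y" "p2 x (c \<odot> y) = c \<odot>\<^bsub>T2\<^esub> p2 x y"
    and p2_mult: "\<lbrakk>x' \<in> carrier T; y' \<in> carrier T\<rbrakk> \<Longrightarrow> p2 x y \<otimes>\<^bsub>T2\<^esub> p2 x' y' = p2 (x \<otimes> x') (y \<otimes> y')"
  using assms pure_slots(1)[OF factors(1), of "[x, y]"]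
    pure_slots(2)[OF factors(1), of "[x, y]" 0 x "x'"]
    pure_slots(2)[OF factors(1), of "[x, y]" 1 y "y'"]
    pure_slots(3)[OF factors(1), of "[x, y]" 0 x c]
    pure_slots(3)[OF factors(1), of "[x, y]" 1 y c]
  by (simp_all add: set_Cons_def tensor_factors.pure_mult[OF factors(1)] tuple_monoid_def)

lemma p3_simps:
  assumes "x \<in> carrier T" "y \<in> carrier T" "z \<in> carrier T"
  shows p3_closed: "p3 x y z \<in> carrier T3"
    and p3_add: "x' \<in> carrier T \<Longrightarrow> p3 (x \<oplus> x') y z = p3 x y z \<oplus>\<^bsub>T3\<^esub> p3 x' y z"
      "y' \<in> carrier T \<Longrightarrow> p3 x (y \<oplus> y') z = p3 x y z \<oplus>\<^bsub>T3\<^esub> p3 x y' z"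
      "z' \<in> carrier T \<Longrightarrow> p3 x y (z \<oplus> z') = p3 x y z \<oplus>\<^bsub>T3\<^esub> p3 x y z'"
    and p3_smult: "p3 (c \<odot> x) y z = c \<odot>\<^bsub>T3\<^esub> p3 x y z" "p3 x (c \<odot> y) z = c \<odot>\<^bsub>T3\<^esub> p3 x y z"
      "p3 x y (c \<odot> z) = c \<odot>\<^bsub>T3\<^esub> p3 x y z"
    and p3_mult: "\<lbrakk>x' \<in> carrier T; y' \<in> carrier T; z' \<in> carrier T\<rbrakk> \<Longrightarrow>
      p3 x y z \<otimes>\<^bsub>T3\<^esub> p3 x' y' z' = p3 (x \<otimes> x') (y' \<otimes> y) (z \<otimes> z')"
  using assms pure_slots(1)[OF factors(2), of "[x, y, z]"]
    pure_slots(2)[OF factors(2), of "[x, y, z]" 0 x "x'"]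
    pure_slots(2)[OF factors(2), of "[x, y, z]" 1 y "y'"]
    pure_slots(2)[OF factors(2), of "[x, y, z]" 2 z "z'"]
    pure_slots(3)[OF factors(2), of "[x, y, z]" 0 x c]
    pure_slots(3)[OF factors(2), of "[x, y, z]" 1 y c]
    pure_slots(3)[OF factors(2), of "[x, y, z]" 2 z c]
  by (simp_all add: set_Cons_def tensor_factors.pure_mult[OF factors(2)] tuple_monoid_def)

lemma p5_simps:
  assumes "x \<in> carrier T" "y \<in> carrier T" "z \<in> carrier T" "u \<in> carrier T" "v \<in> carrier T"
  shows p5_closed: "p5 x y z u v \<in> carrier T5"
    and p5_add: "x' \<in> carrier T \<Longrightarrow> p5 (x \<oplus> x') y z u v = p5 x y z u v \<oplus>\<^bsub>T5\<^esub> p5 x' y z u v"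
      "y' \<in> carrier T \<Longrightarrow> p5 x (y \<oplus> y') z u v = p5 x y z u v \<oplus>\<^bsub>T5\<^esub> p5 x y' z u v"
      "z' \<in> carrier T \<Longrightarrow> p5 x y (z \<oplus> z') u v = p5 x y z u v \<oplus>\<^bsub>T5\<^esub> p5 x y z' u v"
      "u' \<in> carrier T \<Longrightarrow> p5 x y z (u \<oplus> u') v = p5 x y z u v \<oplus>\<^bsub>T5\<^esub> p5 x y z u' v"
      "v' \<in> carrier T \<Longrightarrow> p5 x y z u (v \<oplus> v') = p5 x y z u v \<oplus>\<^bsub>T5\<^esub> p5 x y z u v'"
    and p5_smult: "p5 (c \<odot> x) y z u v = c \<odot>\<^bsub>T5\<^esub> p5 x y z u v"
      "p5 x (c \<odot> y) z u v = c \<odot>\<^bsub>T5\<^esub> p5 x y z u v"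
      "p5 x y (c \<odot> z) u v = c \<odot>\<^bsub>T5\<^esub> p5 x y z u v"
      "p5 x y z (c \<odot> u) v = c \<odot>\<^bsub>T5\<^esub> p5 x y z u v"
      "p5 x y z u (c \<odot> v) = c \<odot>\<^bsub>T5\<^esub> p5 x y z u v"
    and p5_mult: "\<lbrakk>x' \<in> carrier T; y' \<in> carrier T; z' \<in> carrier T; u' \<in> carrier T; v' \<in> carrier T\<rbrakk> \<Longrightarrow>
      p5 x y z u v \<otimes>\<^bsub>T5\<^esub> p5 x' y' z' u' v' = p5 (x \<otimes> x') (y' \<otimes> y) (z \<otimes> z') (u' \<otimes> u) (v \<otimes> v')"
  using assms pure_slots(1)[OF factors(3), of "[x, y, z, u, v]"]
    pure_slots(2)[OF factors(3), of "[x, y, z, u, v]" 0 x "x'"]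
    pure_slots(2)[OF factors(3), of "[x, y, z, u, v]" 1 y "y'"]
    pure_slots(2)[OF factors(3), of "[x, y, z, u, v]" 2 z "z'"]
    pure_slots(2)[OF factors(3), of "[x, y, z, u, v]" 3 u "u'"]
    pure_slots(2)[OF factors(3), of "[x, y, z, u, v]" 4 v "v'"]
    pure_slots(3)[OF factors(3), of "[x, y, z, u, v]" 0 x c]
    pure_slots(3)[OF factors(3), of "[x, y, z, u, v]" 1 y c]
    pure_slots(3)[OF factors(3), of "[x, y, z, u, v]" 2 z c]
    pure_slots(3)[OF factors(3), of "[x, y, z, u, v]" 3 u c]
    pure_slots(3)[OF factors(3), of "[x, y, z, u, v]" 4 v c]
  by (simp_all add: set_Cons_def tensor_factors.pure_mult[OF factors(3)] tuple_monoid_def)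

lemma pure_ones: "\<one>\<^bsub>T2\<^esub> = p2 \<one> \<one>" "\<one>\<^bsub>T3\<^esub> = p3 \<one> \<one> \<one>" "\<one>\<^bsub>T5\<^esub> = p5 \<one> \<one> \<one> \<one> \<one>"
  using tensor_factors.pure_one[OF factors(1)] tensor_factors.pure_one[OF factors(2)]
    tensor_factors.pure_one[OF factors(3)] by simp_all

lemma T3_induct [consumes 1, case_names pure add]:
  assumes "U \<in> carrier T3"
    and "\<And>x y z. \<lbrakk>x \<in> carrier T; y \<in> carrier T; z \<in> carrier T\<rbrakk> \<Longrightarrow> P (p3 x y z)"
    and "\<And>U V. \<lbrakk>U \<in> carrier T3; V \<in> carrier T3; P U; P V\<rbrakk> \<Longrightarrow> P (U \<oplus>\<^bsub>T3\<^esub> V)"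
  shows "P U"
  using assms(1)
proof (induction rule: tensor_factors.tensor_induct[OF factors(2), consumes 1, case_names pure add])
  case (pure xs)
  then show ?case by (auto simp: set_Cons_def assms(2))
qed (rule assms(3))

lemma T3_lift:
  assumes N: "type_algebra N" and g: "multilinear (torsor_factors3 T) N g"
  shows T3_lift_pure: "\<lbrakk>x \<in> carrier T; y \<in> carrier T; z \<in> carrier T\<rbrakk> \<Longrightarrow> tensor_lift N g (p3 x y z) = g [x, y, z]"
    and T3_lift_closed: "U \<in> carrier T3 \<Longrightarrow> tensor_lift N g U \<in> carrier N"
    and T3_lift_add: "\<lbrakk>U \<in> carrier T3; V \<in> carrier T3\<rbrakk> \<Longrightarrow>
      tensor_lift N g (U \<oplus>\<^bsub>T3\<^esub> V) = tensor_lift N g U \<oplus>\<^bsub>N\<^esub> tensor_lift N g V"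
    and T3_lift_smult: "U \<in> carrier T3 \<Longrightarrow> tensor_lift N g (c \<odot>\<^bsub>T3\<^esub> U) = c \<odot>\<^bsub>N\<^esub> tensor_lift N g U"
    and T3_lift_minus: "\<lbrakk>U \<in> carrier T3; V \<in> carrier T3\<rbrakk> \<Longrightarrow>
      tensor_lift N g (U \<ominus>\<^bsub>T3\<^esub> V) = tensor_lift N g U \<ominus>\<^bsub>N\<^esub> tensor_lift N g V"
proof -
  interpret N: type_algebra N by (rule N)
  note lin = tensor_factors.tensor_lift_linear[OF factors(2) N g]
  show "\<lbrakk>x \<in> carrier T; y \<in> carrier T; z \<in> carrier T\<rbrakk> \<Longrightarrow> tensor_lift N g (p3 x y z) = g [x, y, z]"
    by (rule tensor_factors.tensor_lift_pure[OF factors(2) N g]) (simp add: set_Cons_def)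
  show "U \<in> carrier T3 \<Longrightarrow> tensor_lift N g U \<in> carrier N"
    and add: "\<lbrakk>U \<in> carrier T3; V \<in> carrier T3\<rbrakk> \<Longrightarrow>
      tensor_lift N g (U \<oplus>\<^bsub>T3\<^esub> V) = tensor_lift N g U \<oplus>\<^bsub>N\<^esub> tensor_lift N g V"
    and smult: "U \<in> carrier T3 \<Longrightarrow> tensor_lift N g (c \<odot>\<^bsub>T3\<^esub> U) = c \<odot>\<^bsub>N\<^esub> tensor_lift N g U" for U V c
    by (rule lin; assumption)+
  show "\<lbrakk>U \<in> carrier T3; V \<in> carrier T3\<rbrakk> \<Longrightarrow>
      tensor_lift N g (U \<ominus>\<^bsub>T3\<^esub> V) = tensor_lift N g U \<ominus>\<^bsub>N\<^esub> tensor_lift N g V"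
    using add[of U "(- 1) \<odot>\<^bsub>T3\<^esub> V"] smult[of V "- 1"] lin(1)
    by (simp add: T3.smult_minus_left N.smult_minus_left T3.minus_eq N.minus_eq)
qed


subsection \<open>The unit axioms\<close>

lemma id_m_multilinear: "multilinear (torsor_factors3 T) T2 (\<lambda>w. p2 (w ! 0) (w ! 1 \<otimes> w ! 2))"
  by (rule multilinear3I)
    (simp_all add: p2_closed p2_add p2_smult l_distr r_distr smult_mult_left smult_mult_right)

lemma m_id_multilinear: "multilinear (torsor_factors3 T) T2 (\<lambda>w. p2 (w ! 0 \<otimes> w ! 1) (w ! 2))"
  by (rule multilinear3I)
    (simp_all add: p2_closed p2_add p2_smult l_distr r_distr smult_mult_left smult_mult_right)

lemmas id_m_simps = T3_lift[OF T2_type_algebra id_m_multilinear, folded id_m_def, simplified]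
lemmas m_id_simps = T3_lift[OF T2_type_algebra m_id_multilinear, folded m_id_def, simplified]

text \<open>
  The product of \<open>u\<close> and \<open>v\<close> in \<open>T \<otimes> T\<^sup>o\<^sup>p \<otimes> T\<close> has image \<open>u\<^sub>0 v\<^sub>0 \<otimes> v\<^sub>1 u\<^sub>1 u\<^sub>2 v\<^sub>2\<close>: the factors of \<open>v\<close>
  surround the image of \<open>u\<close>. When that image is \<open>x \<otimes> 1\<close>, the factors of \<open>v\<close> become adjacent and form
  the image of \<open>v\<close>.
\<close>

lemma id_m_mult:
  assumes U: "U \<in> carrier T3" and V: "V \<in> carrier T3" and x: "x \<in> carrier T"
    and unit: "id_m T U = p2 x \<one>"
  shows "id_m T (U \<otimes>\<^bsub>T3\<^esub> V) = p2 x \<one> \<otimes>\<^bsub>T2\<^esub> id_m T V"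
proof -
  have sandwich: "id_m T (W \<otimes>\<^bsub>T3\<^esub> p3 a b c) = p2 \<one> b \<otimes>\<^bsub>T2\<^esub> id_m T W \<otimes>\<^bsub>T2\<^esub> p2 a c"
    if "W \<in> carrier T3" "a \<in> carrier T" "b \<in> carrier T" "c \<in> carrier T" for W a b c
    using that
    by (induction rule: T3_induct)
      (simp_all add: id_m_simps p3_mult p2_mult m_assoc p3_closed p2_closed T3.l_distr T2.l_distr T2.r_distr)
  show ?thesis
    using V
  proof (induction rule: T3_induct)
    case (pure a b c)
    then show ?case
      using U x by (simp add: sandwich unit id_m_simps p2_mult)
  next
    case (add V W)
    then show ?case
      using U x by (simp add: T3.r_distr T2.r_distr id_m_simps p2_closed)
  qed
qed

text \<open>
  The mirror image of \<open>id_m_mult\<close>: in \<open>u\<^sub>0 v\<^sub>0 v\<^sub>1 u\<^sub>1 \<otimes> u\<^sub>2 v\<^sub>2\<close> the factors of \<open>u\<close> surround the image of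
  \<open>v\<close>, so here the second factor has to satisfy the unit axiom.
\<close>

lemma m_id_mult:
  assumes U: "U \<in> carrier T3" and V: "V \<in> carrier T3" and y: "y \<in> carrier T"
    and unit: "m_id T V = p2 \<one> y"
  shows "m_id T (U \<otimes>\<^bsub>T3\<^esub> V) = m_id T U \<otimes>\<^bsub>T2\<^esub> p2 \<one> y"
proof -
  have sandwich: "m_id T (p3 a b c \<otimes>\<^bsub>T3\<^esub> W) = p2 a c \<otimes>\<^bsub>T2\<^esub> m_id T W \<otimes>\<^bsub>T2\<^esub> p2 b \<one>"
    if "W \<in> carrier T3" "a \<in> carrier T" "b \<in> carrier T" "c \<in> carrier T" for W a b c
    using that
    by (induction rule: T3_induct)
      (simp_all add: m_id_simps p3_mult p2_mult m_assoc p3_closed p2_closed T3.r_distr T2.l_distr T2.r_distr)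
  show ?thesis
    using U
  proof (induction rule: T3_induct)
    case (pure a b c)
    then show ?case
      using V y by (simp add: sandwich unit m_id_simps p2_mult)
  next
    case (add U W)
    then show ?case
      using V y by (simp add: T3.l_distr T2.l_distr m_id_simps p2_closed)
  qed
qed

subsection \<open>Maps into the fivefold tensor product\<close>

lemma slot_morphisms:
  "algebra_morphism T T5 (\<lambda>x. p5 x \<one> \<one> \<one> \<one>)"
  "algebra_morphism (opposite T) T5 (\<lambda>x. p5 \<one> x \<one> \<one> \<one>)"
  "algebra_morphism T T5 (\<lambda>x. p5 \<one> \<one> x \<one> \<one>)"
  "algebra_morphism (opposite T) T5 (\<lambda>x. p5 \<one> \<one> \<one> x \<one>)"
  "algebra_morphism T T5 (\<lambda>x. p5 \<one> \<one> \<one> \<one> x)"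
  by (intro algebra_morphism.intro algebra_morphism_axioms.intro T5_type_algebra type_algebra_axioms
      opposite_type_algebra[OF type_algebra_axioms] algebra_homI;
      simp add: p5_closed p5_add p5_smult p5_mult pure_ones)+

lemma p5_slot_multilinear:
  assumes "x \<in> carrier T" "y \<in> carrier T"
  shows "multilinear (torsor_factors3 T) T5 (\<lambda>u. p5 x y (u ! 0) (u ! 1) (u ! 2))"
    and "multilinear (torsor_factors3 T) T5 (\<lambda>u. p5 (u ! 0) (u ! 1) (u ! 2) x y)"
    and "multilinear (torsor_factors3 T) T5 (\<lambda>u. p5 x (u ! 2) (u ! 1) (u ! 0) y)"
  by (rule multilinear3I; use assms in \<open>simp add: p5_closed p5_add p5_smult\<close>)+

lemmas last_three = T3_lift[OF T5_type_algebra p5_slot_multilinear(1), simplified]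
lemmas first_three = T3_lift[OF T5_type_algebra p5_slot_multilinear(2), simplified]
lemmas middle_three = T3_lift[OF T5_type_algebra p5_slot_multilinear(3), simplified]

lemma last_three_morphism: "algebra_morphism T3 T5 (tensor_lift T5 (\<lambda>u. p5 \<one> \<one> (u ! 0) (u ! 1) (u ! 2)))"
  by (rule commuting_morphisms_tensor(2)[OF slot_morphisms(3,4,5)]) (simp_all add: p5_mult)

lemma first_three_morphism: "algebra_morphism T3 T5 (tensor_lift T5 (\<lambda>u. p5 (u ! 0) (u ! 1) (u ! 2) \<one> \<one>))"
  by (rule commuting_morphisms_tensor(2)[OF slot_morphisms(1,2,3)]) (simp_all add: p5_mult)

lemma lift_opposite: "tensor_lift (opposite N) g = tensor_lift N g"
  by (simp add: tensor_lift_def[abs_def] finsum_def)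

text \<open>
  Reversing the order of the three factors puts elements of \<open>T\<close> into slots that carry \<open>T\<^sup>o\<^sup>p\<close> and vice
  versa, so every slot reverses multiplication. This compensates for \<open>\<mu>\<close> being applied to \<open>T\<^sup>o\<^sup>p\<close> in
  \<^const>\<open>id_muop_id\<close>.
\<close>

lemma middle_three_morphism:
  "algebra_morphism T3 (opposite T5) (tensor_lift T5 (\<lambda>u. p5 \<one> (u ! 2) (u ! 1) (u ! 0) \<one>))"
proof -
  have "algebra_morphism T3 (opposite T5)
      (tensor_lift (opposite T5) (\<lambda>u. p5 \<one> (u ! 2) (u ! 1) (u ! 0) \<one>))"
    by (rule commuting_morphisms_tensor(2)[OF
          opposite_morphism[OF slot_morphisms(4), unfolded opposite_opposite]
          opposite_morphism[OF slot_morphisms(3)]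
          opposite_morphism[OF slot_morphisms(2), unfolded opposite_opposite]])
      (simp_all add: p5_mult)
  then show ?thesis by (simp add: lift_opposite)
qed

context
  fixes \<mu>
  assumes mu: "algebra_morphism T T3 \<mu>"
begin

interpretation mu: algebra_morphism T T3 \<mu> by (rule mu)

text \<open>
  In this and the two following lemmas the map is the product of two slot embeddings and of \<open>\<mu>\<close> followed by
  the embedding of a threefold into the fivefold tensor product. The latter uses the slots that the
  former leave free, which is why the images commute.
\<close>

lemma id_id_mu_morphism: "algebra_morphism T3 T5 (id_id_mu T \<mu>)"
  and id_id_mu_pure: "\<lbrakk>x \<in> carrier T; y \<in> carrier T; z \<in> carrier T\<rbrakk> \<Longrightarrow>
    id_id_mu T \<mu> (p3 x y z) = tensor_lift T5 (\<lambda>u. p5 x y (u ! 0) (u ! 1) (u ! 2)) (\<mu> z)"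
proof -
  let ?\<gamma> = "tensor_lift T5 (\<lambda>u. p5 \<one> \<one> (u ! 0) (u ! 1) (u ! 2))"
  let ?g = "\<lambda>w. tensor_lift T5 (\<lambda>u. p5 (w ! 0) (w ! 1) (u ! 0) (u ! 1) (u ! 2)) (\<mu> (w ! 2))"
  have c1: "?\<gamma> U \<otimes>\<^bsub>T5\<^esub> p5 x \<one> \<one> \<one> \<one> = p5 x \<one> \<one> \<one> \<one> \<otimes>\<^bsub>T5\<^esub> ?\<gamma> U"
    if "U \<in> carrier T3" "x \<in> carrier T" for U x
    using that by (induction rule: T3_induct)
      (simp_all add: last_three p5_mult p5_closed T5.l_distr T5.r_distr)
  have c2: "?\<gamma> U \<otimes>\<^bsub>T5\<^esub> p5 \<one> y \<one> \<one> \<one> = p5 \<one> y \<one> \<one> \<one> \<otimes>\<^bsub>T5\<^esub> ?\<gamma> U"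
    if "U \<in> carrier T3" "y \<in> carrier T" for U y
    using that by (induction rule: T3_induct)
      (simp_all add: last_three p5_mult p5_closed T5.l_distr T5.r_distr)
  have g: "tensor_lift T5 (\<lambda>u. p5 x y (u ! 0) (u ! 1) (u ! 2)) U =
      p5 x \<one> \<one> \<one> \<one> \<otimes>\<^bsub>T5\<^esub> p5 \<one> y \<one> \<one> \<one> \<otimes>\<^bsub>T5\<^esub> ?\<gamma> U"
    if "U \<in> carrier T3" "x \<in> carrier T" "y \<in> carrier T" for U x y
    using that by (induction rule: T3_induct)
      (simp_all add: last_three p5_mult p5_closed T5.r_distr)
  note tm = commuting_morphisms_tensor[OF slot_morphisms(1,2) algebra_morphism_comp[OF mu last_three_morphism],
      where g = ?g]
  have gg: "?g [x, y, z] = p5 x \<one> \<one> \<one> \<one> \<otimes>\<^bsub>T5\<^esub> p5 \<one> y \<one> \<one> \<one> \<otimes>\<^bsub>T5\<^esub> ?\<gamma> (\<mu> z)"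
    if "x \<in> carrier T" "y \<in> carrier T" "z \<in> carrier T" for x y z
    using g[of "\<mu> z" x y] that by (simp del: One_nat_def)
  have ml: "multilinear (torsor_factors3 T) T5 ?g"
    by (rule tm(1)[OF _ _ _ gg]) (simp_all add: c1 c2 p5_mult del: One_nat_def)
  show "algebra_morphism T3 T5 (id_id_mu T \<mu>)"
    unfolding id_id_mu_def by (rule tm(2)[OF _ _ _ gg]) (simp_all add: c1 c2 p5_mult del: One_nat_def)
  show "\<lbrakk>x \<in> carrier T; y \<in> carrier T; z \<in> carrier T\<rbrakk> \<Longrightarrow>
      id_id_mu T \<mu> (p3 x y z) = tensor_lift T5 (\<lambda>u. p5 x y (u ! 0) (u ! 1) (u ! 2)) (\<mu> z)"
    unfolding id_id_mu_def by (subst T3_lift_pure[OF T5_type_algebra ml]) simp_all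
qed

lemma mu_id_id_morphism: "algebra_morphism T3 T5 (mu_id_id T \<mu>)"
  and mu_id_id_pure: "\<lbrakk>x \<in> carrier T; y \<in> carrier T; z \<in> carrier T\<rbrakk> \<Longrightarrow>
    mu_id_id T \<mu> (p3 x y z) = tensor_lift T5 (\<lambda>u. p5 (u ! 0) (u ! 1) (u ! 2) y z) (\<mu> x)"
proof -
  let ?\<gamma> = "tensor_lift T5 (\<lambda>u. p5 (u ! 0) (u ! 1) (u ! 2) \<one> \<one>)"
  let ?g = "\<lambda>w. tensor_lift T5 (\<lambda>u. p5 (u ! 0) (u ! 1) (u ! 2) (w ! 1) (w ! 2)) (\<mu> (w ! 0))"
  have c1: "p5 \<one> \<one> \<one> y \<one> \<otimes>\<^bsub>T5\<^esub> ?\<gamma> U = ?\<gamma> U \<otimes>\<^bsub>T5\<^esub> p5 \<one> \<one> \<one> y \<one>"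
    if "U \<in> carrier T3" "y \<in> carrier T" for U y
    using that by (induction rule: T3_induct)
      (simp_all add: first_three p5_mult p5_closed T5.l_distr T5.r_distr)
  have c2: "p5 \<one> \<one> \<one> \<one> z \<otimes>\<^bsub>T5\<^esub> ?\<gamma> U = ?\<gamma> U \<otimes>\<^bsub>T5\<^esub> p5 \<one> \<one> \<one> \<one> z"
    if "U \<in> carrier T3" "z \<in> carrier T" for U z
    using that by (induction rule: T3_induct)
      (simp_all add: first_three p5_mult p5_closed T5.l_distr T5.r_distr)
  have g: "tensor_lift T5 (\<lambda>u. p5 (u ! 0) (u ! 1) (u ! 2) y z) U =
      ?\<gamma> U \<otimes>\<^bsub>T5\<^esub> p5 \<one> \<one> \<one> y \<one> \<otimes>\<^bsub>T5\<^esub> p5 \<one> \<one> \<one> \<one> z"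
    if "U \<in> carrier T3" "y \<in> carrier T" "z \<in> carrier T" for U y z
    using that by (induction rule: T3_induct)
      (simp_all add: first_three p5_mult p5_closed T5.l_distr)
  note tm = commuting_morphisms_tensor[OF algebra_morphism_comp[OF mu first_three_morphism] slot_morphisms(4,5),
      where g = ?g]
  have gg: "?g [x, y, z] = ?\<gamma> (\<mu> x) \<otimes>\<^bsub>T5\<^esub> p5 \<one> \<one> \<one> y \<one> \<otimes>\<^bsub>T5\<^esub> p5 \<one> \<one> \<one> \<one> z"
    if "x \<in> carrier T" "y \<in> carrier T" "z \<in> carrier T" for x y z
    using g[of "\<mu> x" y z] that by (simp del: One_nat_def)
  have ml: "multilinear (torsor_factors3 T) T5 ?g"
    by (rule tm(1)[OF _ _ _ gg]) (simp_all add: c1 c2 p5_mult del: One_nat_def)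
  show "algebra_morphism T3 T5 (mu_id_id T \<mu>)"
    unfolding mu_id_id_def by (rule tm(2)[OF _ _ _ gg]) (simp_all add: c1 c2 p5_mult del: One_nat_def)
  show "\<lbrakk>x \<in> carrier T; y \<in> carrier T; z \<in> carrier T\<rbrakk> \<Longrightarrow>
      mu_id_id T \<mu> (p3 x y z) = tensor_lift T5 (\<lambda>u. p5 (u ! 0) (u ! 1) (u ! 2) y z) (\<mu> x)"
    unfolding mu_id_id_def by (subst T3_lift_pure[OF T5_type_algebra ml]) simp_all
qed

lemma id_muop_id_morphism: "algebra_morphism T3 T5 (id_muop_id T \<mu>)"
  and id_muop_id_pure: "\<lbrakk>x \<in> carrier T; y \<in> carrier T; z \<in> carrier T\<rbrakk> \<Longrightarrow>
    id_muop_id T \<mu> (p3 x y z) = tensor_lift T5 (\<lambda>u. p5 x (u ! 2) (u ! 1) (u ! 0) z) (\<mu> y)"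
proof -
  let ?\<gamma> = "tensor_lift T5 (\<lambda>u. p5 \<one> (u ! 2) (u ! 1) (u ! 0) \<one>)"
  let ?g = "\<lambda>w. tensor_lift T5 (\<lambda>u. p5 (w ! 0) (u ! 2) (u ! 1) (u ! 0) (w ! 2)) (\<mu> (w ! 1))"
  have c1: "?\<gamma> U \<otimes>\<^bsub>T5\<^esub> p5 x \<one> \<one> \<one> \<one> = p5 x \<one> \<one> \<one> \<one> \<otimes>\<^bsub>T5\<^esub> ?\<gamma> U"
    if "U \<in> carrier T3" "x \<in> carrier T" for U x
    using that by (induction rule: T3_induct)
      (simp_all add: middle_three p5_mult p5_closed T5.l_distr T5.r_distr)
  have c2: "p5 \<one> \<one> \<one> \<one> z \<otimes>\<^bsub>T5\<^esub> ?\<gamma> U = ?\<gamma> U \<otimes>\<^bsub>T5\<^esub> p5 \<one> \<one> \<one> \<one> z"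
    if "U \<in> carrier T3" "z \<in> carrier T" for U z
    using that by (induction rule: T3_induct)
      (simp_all add: middle_three p5_mult p5_closed T5.l_distr T5.r_distr)
  have g: "tensor_lift T5 (\<lambda>u. p5 x (u ! 2) (u ! 1) (u ! 0) z) U =
      p5 x \<one> \<one> \<one> \<one> \<otimes>\<^bsub>T5\<^esub> ?\<gamma> U \<otimes>\<^bsub>T5\<^esub> p5 \<one> \<one> \<one> \<one> z"
    if "U \<in> carrier T3" "x \<in> carrier T" "z \<in> carrier T" for U x z
    using that by (induction rule: T3_induct)
      (simp_all add: middle_three p5_mult p5_closed T5.l_distr T5.r_distr)
  note tm = commuting_morphisms_tensor[OF slot_morphisms(1)
      opposite_morphism[OF algebra_morphism_comp[OF mu middle_three_morphism], unfolded opposite_opposite]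
      slot_morphisms(5), where g = ?g]
  have gg: "?g [x, y, z] = p5 x \<one> \<one> \<one> \<one> \<otimes>\<^bsub>T5\<^esub> ?\<gamma> (\<mu> y) \<otimes>\<^bsub>T5\<^esub> p5 \<one> \<one> \<one> \<one> z"
    if "x \<in> carrier T" "y \<in> carrier T" "z \<in> carrier T" for x y z
    using g[of "\<mu> y" x z] that by (simp del: One_nat_def)
  have ml: "multilinear (torsor_factors3 T) T5 ?g"
    by (rule tm(1)[OF _ _ _ gg]) (simp_all add: c1 c2 p5_mult del: One_nat_def)
  show "algebra_morphism T3 T5 (id_muop_id T \<mu>)"
    unfolding id_muop_id_def by (rule tm(2)[OF _ _ _ gg]) (simp_all add: c1 c2 p5_mult del: One_nat_def)
  show "\<lbrakk>x \<in> carrier T; y \<in> carrier T; z \<in> carrier T\<rbrakk> \<Longrightarrow>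
      id_muop_id T \<mu> (p3 x y z) = tensor_lift T5 (\<lambda>u. p5 x (u ! 2) (u ! 1) (u ! 0) z) (\<mu> y)"
    unfolding id_muop_id_def by (subst T3_lift_pure[OF T5_type_algebra ml]) simp_all
qed

end

context
  fixes \<theta>
  assumes theta: "algebra_morphism T T \<theta>"
begin

interpretation theta: algebra_morphism T T \<theta> by (rule theta)

lemma theta_middle_morphism: "algebra_morphism T5 T5 (theta_middle T \<theta>)"
  and theta_middle_pure: "\<lbrakk>x \<in> carrier T; y \<in> carrier T; z \<in> carrier T; u \<in> carrier T; v \<in> carrier T\<rbrakk> \<Longrightarrow>
    theta_middle T \<theta> (p5 x y z u v) = p5 x y (\<theta> z) u v"
proof -
  interpret F5: tensor_factors "torsor_factors5 T" by (rule factors)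
  let ?g = "\<lambda>w. p5 (w ! 0) (w ! 1) (\<theta> (w ! 2)) (w ! 3) (w ! 4)"
  have "multilinear (torsor_factors5 T) T5 (\<lambda>w. pure_tensor (torsor_factors5 T) (w[2 := \<theta> (w ! 2)]))"
    by (rule multilinear_precompose[OF F5.pure_multilinear F5.factor_type_algebra]) (use theta in simp_all)
  then have ml: "multilinear (torsor_factors5 T) T5 ?g"
    by (rule multilinear_cong[OF _ F5.factor_type_algebra]) (auto simp: set_Cons_def)
  show "algebra_morphism T5 T5 (theta_middle T \<theta>)"
    unfolding theta_middle_def
    by (rule F5.tensor_lift_morphism[OF T5_type_algebra ml])
      (auto simp: set_Cons_def tuple_monoid_def p5_mult theta.hom_mult theta.hom_one pure_ones)
  show "\<lbrakk>x \<in> carrier T; y \<in> carrier T; z \<in> carrier T; u \<in> carrier T; v \<in> carrier T\<rbrakk> \<Longrightarrow>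
    theta_middle T \<theta> (p5 x y z u v) = p5 x y (\<theta> z) u v"
    unfolding theta_middle_def
    by (subst F5.tensor_lift_pure[OF T5_type_algebra ml]) (simp_all add: set_Cons_def)
qed

lemma theta_all_morphism: "algebra_morphism T3 T3 (theta_all T \<theta>)"
  and theta_all_pure: "\<lbrakk>x \<in> carrier T; y \<in> carrier T; z \<in> carrier T\<rbrakk> \<Longrightarrow>
    theta_all T \<theta> (p3 x y z) = p3 (\<theta> x) (\<theta> y) (\<theta> z)"
proof -
  interpret F3: tensor_factors "torsor_factors3 T" by (rule factors)
  let ?g = "\<lambda>w. p3 (\<theta> (w ! 0)) (\<theta> (w ! 1)) (\<theta> (w ! 2))"
  have ml: "multilinear (torsor_factors3 T) T3 ?g"
    by (rule multilinear3I) (simp_all add: p3_closed p3_add p3_smult theta.hom_add theta.hom_smult)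
  show "algebra_morphism T3 T3 (theta_all T \<theta>)"
    unfolding theta_all_def tensor3_def
    by (rule F3.tensor_lift_morphism[OF T3_type_algebra ml])
      (auto simp: set_Cons_def tuple_monoid_def p3_mult theta.hom_mult theta.hom_one pure_ones)
  show "\<lbrakk>x \<in> carrier T; y \<in> carrier T; z \<in> carrier T\<rbrakk> \<Longrightarrow>
    theta_all T \<theta> (p3 x y z) = p3 (\<theta> x) (\<theta> y) (\<theta> z)"
    unfolding theta_all_def tensor3_def by (subst T3_lift_pure[OF T3_type_algebra ml]) simp_all
qed

end

end

section \<open>The relations between the images of the generators\<close>

lemma q_pow_add: "q_pow (r + s) = q_pow r * q_pow s"
  by (simp add: q_pow_def fps_exp_add_mult)

lemma q_pow_zero [simp]: "q_pow 0 = 1"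
  by (simp add: q_pow_def)

text \<open>
  Of the nine products of summands the six mixed ones \<open>q\<close>-commute with the same factor \<open>c\<close>, and the
  defects \<open>w\<close> and \<open>-w\<close> of two diagonal ones cancel.
\<close>

lemma (in type_algebra) commutator_relation_sum:
  assumes a: "a1 \<in> carrier M" "a2 \<in> carrier M" "a3 \<in> carrier M"
    and b: "b1 \<in> carrier M" "b2 \<in> carrier M" "b3 \<in> carrier M"
    and wd: "w \<in> carrier M" "d \<in> carrier M"
    and diag: "a1 \<otimes> b1 = c \<odot> (b1 \<otimes> a1) \<oplus> w" "a2 \<otimes> b2 = c \<odot> (b2 \<otimes> a2) \<ominus> w"
      "a3 \<otimes> b3 = c \<odot> (b3 \<otimes> a3) \<oplus> d"
    and cross: "a1 \<otimes> b2 = c \<odot> (b2 \<otimes> a1)" "a1 \<otimes> b3 = c \<odot> (b3 \<otimes> a1)" "a2 \<otimes> b1 = c \<odot> (b1 \<otimes> a2)"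
      "a2 \<otimes> b3 = c \<odot> (b3 \<otimes> a2)" "a3 \<otimes> b1 = c \<odot> (b1 \<otimes> a3)" "a3 \<otimes> b2 = c \<odot> (b2 \<otimes> a3)"
  shows "(a3 \<ominus> a2 \<oplus> a1) \<otimes> (b3 \<ominus> b2 \<oplus> b1) = c \<odot> ((b3 \<ominus> b2 \<oplus> b1) \<otimes> (a3 \<ominus> a2 \<oplus> a1)) \<oplus> d"
proof -
  have w: "\<ominus> w \<oplus> (w \<oplus> z) = z" "w \<oplus> (\<ominus> w \<oplus> z) = z" if "z \<in> carrier M" for z
    using that wd by (simp_all add: r_neg1 r_neg2)
  have diag12: "a2 \<otimes> b2 \<oplus> a1 \<otimes> b1 = c \<odot> (b2 \<otimes> a2) \<oplus> c \<odot> (b1 \<otimes> a1)"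
    unfolding diag using a b wd by (simp add: minus_eq a_ac w)
  have "(a3 \<ominus> a2 \<oplus> a1) \<otimes> (b3 \<ominus> b2 \<oplus> b1) = (a2 \<otimes> b2 \<oplus> a1 \<otimes> b1) \<oplus> a3 \<otimes> b3
      \<oplus> \<ominus> (a3 \<otimes> b2) \<oplus> a3 \<otimes> b1 \<oplus> \<ominus> (a2 \<otimes> b3) \<oplus> \<ominus> (a2 \<otimes> b1) \<oplus> a1 \<otimes> b3 \<oplus> \<ominus> (a1 \<otimes> b2)"
    using a b by (simp add: minus_eq l_distr r_distr l_minus r_minus minus_add a_ac)
  also have "\<dots> = c \<odot> ((b3 \<ominus> b2 \<oplus> b1) \<otimes> (a3 \<ominus> a2 \<oplus> a1)) \<oplus> d"
    unfolding diag12 diag(3) cross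
    using a b wd by (simp add: minus_eq l_distr r_distr l_minus r_minus smult_add_right smult_minus_right minus_add a_ac)
  finally show ?thesis .
qed

context symmetrizable_km_datum
begin

sublocale B: torsor_tensors \<B>
  by (intro torsor_tensors.intro B_type_algebra)

abbreviation "qh \<equiv> gen_q D"
abbreviation "t i \<equiv> qh (t_exp i)"
abbreviation "t' i \<equiv> qh (- t_exp i)"

lemma lattice_diff: "\<lbrakk>h \<in> coroot_lattice D; h' \<in> coroot_lattice D\<rbrakk> \<Longrightarrow> h - h' \<in> coroot_lattice D"
  using lattice_add[OF _ lattice_uminus, of h h'] by simp

lemmas lattice_closed [simp, intro] = lattice_diff lattice_zero lattice_add lattice_uminus t_exp_lattice
lemmas B_gens_closed [simp, intro] = B_gens

lemma q_zero: "qh 0 = \<one>\<^bsub>\<B>\<^esub>"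
  and q_mult: "\<lbrakk>h \<in> coroot_lattice D; h' \<in> coroot_lattice D\<rbrakk> \<Longrightarrow> qh h \<otimes>\<^bsub>\<B>\<^esub> qh h' = qh (h + h')"
  using B_relations by (simp_all add: kashiwara_relations_def)

lemma q_mult_left:
  "\<lbrakk>h \<in> coroot_lattice D; h' \<in> coroot_lattice D; x \<in> carrier \<B>\<rbrakk> \<Longrightarrow>
    qh h \<otimes>\<^bsub>\<B>\<^esub> (qh h' \<otimes>\<^bsub>\<B>\<^esub> x) = qh (h + h') \<otimes>\<^bsub>\<B>\<^esub> x"
  by (simp add: q_mult flip: B.m_assoc)

text \<open>
  The generators \<open>e'\<close> (with \<open>s = 1\<close>) and \<open>f\<close> (with \<open>s = -1\<close>) differ only in the sign of their weights.
  Everything that does not mix them is proved for both at once.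
\<close>

definition weight_family :: "rat \<Rightarrow> ('i \<Rightarrow> ('i, 'v) kfree set) \<Rightarrow> bool" where
  "weight_family s Y \<longleftrightarrow> (s = 1 \<or> s = - 1) \<and> (\<forall>i\<in>idx D. Y i \<in> carrier \<B> \<and>
    (\<forall>h\<in>coroot_lattice D. qh h \<otimes>\<^bsub>\<B>\<^esub> Y i = q_pow (s * simple_root D i h) \<odot>\<^bsub>\<B>\<^esub> (Y i \<otimes>\<^bsub>\<B>\<^esub> qh h)))"

lemma weight_family_e: "weight_family 1 (gen_e D)"
  and weight_family_f: "weight_family (- 1) (gen_f D)"
proof -
  have *: "qh h \<otimes>\<^bsub>\<B>\<^esub> y = c \<odot>\<^bsub>\<B>\<^esub> (y \<otimes>\<^bsub>\<B>\<^esub> qh h)"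
    if "h \<in> coroot_lattice D" "y \<in> carrier \<B>" "qh h \<otimes>\<^bsub>\<B>\<^esub> y \<otimes>\<^bsub>\<B>\<^esub> qh (- h) = c \<odot>\<^bsub>\<B>\<^esub> y" for h y c
  proof -
    have "qh h \<otimes>\<^bsub>\<B>\<^esub> y = qh h \<otimes>\<^bsub>\<B>\<^esub> y \<otimes>\<^bsub>\<B>\<^esub> qh (- h) \<otimes>\<^bsub>\<B>\<^esub> qh h"
      using that(1,2) by (simp add: B.m_assoc q_mult q_zero)
    then show ?thesis using that by (simp add: B.smult_mult_left)
  qed
  have rel: "\<lbrakk>h \<in> coroot_lattice D; i \<in> idx D\<rbrakk> \<Longrightarrow>
      qh h \<otimes>\<^bsub>\<B>\<^esub> gen_e D i \<otimes>\<^bsub>\<B>\<^esub> qh (- h) = q_pow (simple_root D i h) \<odot>\<^bsub>\<B>\<^esub> gen_e D i"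
    "\<lbrakk>h \<in> coroot_lattice D; i \<in> idx D\<rbrakk> \<Longrightarrow>
      qh h \<otimes>\<^bsub>\<B>\<^esub> gen_f D i \<otimes>\<^bsub>\<B>\<^esub> qh (- h) = q_pow (- simple_root D i h) \<odot>\<^bsub>\<B>\<^esub> gen_f D i" for h i
    using B_relations by (simp_all add: kashiwara_relations_def)
  show "weight_family 1 (gen_e D)" "weight_family (- 1) (gen_f D)"
    unfolding weight_family_def by (simp_all add: *[OF _ _ rel(1)] *[OF _ _ rel(2)])
qed

text \<open>
  The prescribed value of \<open>\<mu>\<close> on a generator \<open>Y i\<close>.
\<close>

definition torsor_sum :: "('i \<Rightarrow> ('i, 'v) kfree set) \<Rightarrow> 'i \<Rightarrow> (('i, 'v) kfree set list \<Rightarrow>\<^sub>0 rat fps) set" where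
  "torsor_sum Y i = B.p3 \<one>\<^bsub>\<B>\<^esub> \<one>\<^bsub>\<B>\<^esub> (Y i) \<ominus>\<^bsub>B.T3\<^esub> B.p3 \<one>\<^bsub>\<B>\<^esub> (Y i \<otimes>\<^bsub>\<B>\<^esub> t i) (t' i)
    \<oplus>\<^bsub>B.T3\<^esub> B.p3 (Y i) (t i) (t' i)"

lemma t_exp_root:
  assumes "i \<in> idx D" "j \<in> idx D"
  shows "simple_root D j (t_exp i) = root_form i j" "simple_root D j (- t_exp i) = - root_form i j"
  using assms by (simp_all add: root_t_exp root_linear)

lemma unit_embeddings:
  "algebra_morphism \<B> B.T3 (\<lambda>x. B.p3 x \<one>\<^bsub>\<B>\<^esub> \<one>\<^bsub>\<B>\<^esub>)"
  "algebra_morphism (opposite \<B>) B.T3 (\<lambda>x. B.p3 \<one>\<^bsub>\<B>\<^esub> x \<one>\<^bsub>\<B>\<^esub>)"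
  "algebra_morphism \<B> B.T3 (\<lambda>x. B.p3 \<one>\<^bsub>\<B>\<^esub> \<one>\<^bsub>\<B>\<^esub> x)"
  by (intro algebra_morphism.intro algebra_morphism_axioms.intro B.T3_type_algebra B_type_algebra
      opposite_type_algebra[OF B_type_algebra] algebra_homI;
      simp add: B.p3_closed B.p3_add B.p3_smult B.p3_mult B.pure_ones)+

lemma serre_order_eq: "\<lbrakk>i \<in> idx D; j \<in> idx D; i \<noteq> j\<rbrakk> \<Longrightarrow>
    of_nat (serre_order D i j) = 1 - simple_root D j (coroot D i)"
  using cartan_off_diagonal[of i j] by (auto simp: serre_order_def elim!: Ints_cases)

context
  fixes s Y assumes Y: "weight_family s Y"
begin

lemma Y_closed [simp, intro]: "i \<in> idx D \<Longrightarrow> Y i \<in> carrier \<B>"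
  using Y by (simp add: weight_family_def)

lemma sign: "s = 1 \<or> s = - 1"
  using Y by (simp add: weight_family_def)

lemma q_past:
  "\<lbrakk>h \<in> coroot_lattice D; i \<in> idx D\<rbrakk> \<Longrightarrow>
    qh h \<otimes>\<^bsub>\<B>\<^esub> Y i = q_pow (s * simple_root D i h) \<odot>\<^bsub>\<B>\<^esub> (Y i \<otimes>\<^bsub>\<B>\<^esub> qh h)"
  using Y by (simp add: weight_family_def)

lemma q_past_left:
  "\<lbrakk>h \<in> coroot_lattice D; i \<in> idx D; x \<in> carrier \<B>\<rbrakk> \<Longrightarrow>
    qh h \<otimes>\<^bsub>\<B>\<^esub> (Y i \<otimes>\<^bsub>\<B>\<^esub> x) = q_pow (s * simple_root D i h) \<odot>\<^bsub>\<B>\<^esub> (Y i \<otimes>\<^bsub>\<B>\<^esub> (qh h \<otimes>\<^bsub>\<B>\<^esub> x))"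
  using q_past[of h i] by (simp add: B.smult_mult_left flip: B.m_assoc)

text \<open>
  As rewrite rules these move all elements \<open>q\<^sup>h\<close> to the right of the generators and collect them into one,
  and pull the resulting scalars to the front.
\<close>

lemmas normal_form = q_past q_past_left q_mult q_mult_left q_zero B.m_assoc B.smult_mult_left
  B.smult_mult_right B.smult_smult t_exp_root q_pow_add[symmetric]

lemma torsor_sum_closed [simp, intro]: "i \<in> idx D \<Longrightarrow> torsor_sum Y i \<in> carrier B.T3"
  by (simp add: torsor_sum_def B.p3_closed)

lemma torsor_sum_q:
  assumes h: "h \<in> coroot_lattice D" and i: "i \<in> idx D"
  shows "B.p3 (qh h) (qh (- h)) (qh h) \<otimes>\<^bsub>B.T3\<^esub> torsor_sum Y i \<otimes>\<^bsub>B.T3\<^esub> B.p3 (qh (- h)) (qh (- (- h))) (qh (- h))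
    = q_pow (s * simple_root D i h) \<odot>\<^bsub>B.T3\<^esub> torsor_sum Y i"
  using assms unfolding torsor_sum_def
  by (simp add: B.T3.minus_eq B.T3.l_distr B.T3.r_distr B.T3.l_minus B.T3.r_minus B.p3_closed B.p3_mult
      normal_form B.p3_smult B.T3.smult_mult_left B.T3.smult_add_right B.T3.smult_minus_right add_ac)

text \<open>
  For two summands of \<open>\<mu>(Y\<^sub>i)\<close> and \<open>\<mu>(Z\<^sub>j)\<close> with different positions of the generators, look at the slot
  that holds the generator of the summand with the larger index: the other summand has a power of \<open>t\<^sub>j\<close> there,
  and in the remaining slots both orders agree. In slot three this is \<open>t\<^sub>j\<^sup>-\<^sup>1\<close>; in slot two it is \<open>t\<^sub>j\<close>, but
  multiplication is reversed. Both give the same power of \<open>q\<close>.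
\<close>

lemma torsor_summands_commute:
  assumes "weight_family s' Z" and ij: "i \<in> idx D" "j \<in> idx D"
  shows "B.p3 \<one>\<^bsub>\<B>\<^esub> \<one>\<^bsub>\<B>\<^esub> (Y i) \<otimes>\<^bsub>B.T3\<^esub> B.p3 \<one>\<^bsub>\<B>\<^esub> (Z j \<otimes>\<^bsub>\<B>\<^esub> t j) (t' j) =
      q_pow (s * root_form i j) \<odot>\<^bsub>B.T3\<^esub>
        (B.p3 \<one>\<^bsub>\<B>\<^esub> (Z j \<otimes>\<^bsub>\<B>\<^esub> t j) (t' j) \<otimes>\<^bsub>B.T3\<^esub> B.p3 \<one>\<^bsub>\<B>\<^esub> \<one>\<^bsub>\<B>\<^esub> (Y i))" (is ?A)
    and "B.p3 \<one>\<^bsub>\<B>\<^esub> \<one>\<^bsub>\<B>\<^esub> (Y i) \<otimes>\<^bsub>B.T3\<^esub> B.p3 (Z j) (t j) (t' j) =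
      q_pow (s * root_form i j) \<odot>\<^bsub>B.T3\<^esub>
        (B.p3 (Z j) (t j) (t' j) \<otimes>\<^bsub>B.T3\<^esub> B.p3 \<one>\<^bsub>\<B>\<^esub> \<one>\<^bsub>\<B>\<^esub> (Y i))" (is ?B)
    and "B.p3 \<one>\<^bsub>\<B>\<^esub> (Y i \<otimes>\<^bsub>\<B>\<^esub> t i) (t' i) \<otimes>\<^bsub>B.T3\<^esub> B.p3 (Z j) (t j) (t' j) =
      q_pow (s * root_form i j) \<odot>\<^bsub>B.T3\<^esub>
        (B.p3 (Z j) (t j) (t' j) \<otimes>\<^bsub>B.T3\<^esub> B.p3 \<one>\<^bsub>\<B>\<^esub> (Y i \<otimes>\<^bsub>\<B>\<^esub> t i) (t' i))" (is ?C)
proof -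
  have Z: "Z j \<in> carrier \<B>" using assms by (simp add: weight_family_def)
  note s = B.p3_mult normal_form B.p3_smult B.p3_closed B.T3.smult_smult root_form_sym[OF ij(2,1)] add.commute
  show ?A ?B ?C using ij Z by (simp_all add: s)
qed

text \<open>
  The family \<open>1 \<otimes> 1 \<otimes> Y\<^sub>i\<close> satisfies the Serre relation because \<open>B\<close> does. The other two are
  \<open>1 \<otimes> Y\<^sub>i \<otimes> 1\<close> and \<open>Y\<^sub>i \<otimes> 1 \<otimes> 1\<close> twisted by \<open>1 \<otimes> t\<^sub>i \<otimes> t\<^sub>i\<^sup>-\<^sup>1\<close>, the former from the opposite algebra.
  They are combined by two applications of \<open>serre_sum_zero\<close>.
\<close>

lemma torsor_sum_serre:
  assumes ij: "i \<in> idx D" "j \<in> idx D" "i \<noteq> j"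
    and zero: "q_serre \<B> D i 0 (serre_order D i j) (Y i) (Y j) = \<zero>\<^bsub>\<B>\<^esub>"
  shows "q_serre B.T3 D i 0 (serre_order D i j) (torsor_sum Y i) (torsor_sum Y j) = \<zero>\<^bsub>B.T3\<^esub>"
proof -
  interpret QB: q_algebra \<B> D i
    by (intro q_algebra.intro q_algebra_axioms.intro B_type_algebra half_norm_nonzero ij)
  interpret Q: q_algebra B.T3 D i
    by (intro q_algebra.intro q_algebra_axioms.intro B.T3_type_algebra half_norm_nonzero ij)
  let ?n = "serre_order D i j"
  note n = serre_order_eq[OF ij]
  let ?a3 = "\<lambda>i. B.p3 \<one>\<^bsub>\<B>\<^esub> \<one>\<^bsub>\<B>\<^esub> (Y i)" and ?a2 = "\<lambda>i. B.p3 \<one>\<^bsub>\<B>\<^esub> (Y i \<otimes>\<^bsub>\<B>\<^esub> t i) (t' i)"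
    and ?a1 = "\<lambda>i. B.p3 (Y i) (t i) (t' i)"
    and ?\<tau> = "\<lambda>i. B.p3 \<one>\<^bsub>\<B>\<^esub> (t i) (t' i)"
  have cl: "?a3 i \<in> carrier B.T3" "?a2 i \<in> carrier B.T3" "?a1 i \<in> carrier B.T3" "?\<tau> i \<in> carrier B.T3"
    "?a3 j \<in> carrier B.T3" "?a2 j \<in> carrier B.T3" "?a1 j \<in> carrier B.T3" "?\<tau> j \<in> carrier B.T3"
    using ij by (simp_all add: B.p3_closed)
  interpret e1: algebra_morphism \<B> B.T3 "\<lambda>x. B.p3 x \<one>\<^bsub>\<B>\<^esub> \<one>\<^bsub>\<B>\<^esub>" by (rule unit_embeddings)
  interpret e2: algebra_morphism "opposite \<B>" B.T3 "\<lambda>x. B.p3 \<one>\<^bsub>\<B>\<^esub> x \<one>\<^bsub>\<B>\<^esub>" by (rule unit_embeddings)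
  interpret e3: algebra_morphism \<B> B.T3 "\<lambda>x. B.p3 \<one>\<^bsub>\<B>\<^esub> \<one>\<^bsub>\<B>\<^esub> x" by (rule unit_embeddings)
  note s = B.p3_mult normal_form B.p3_smult B.p3_closed B.T3.smult_smult add.commute
  have zero3: "Q.serre 0 ?n (?a3 i) (?a3 j) = \<zero>\<^bsub>B.T3\<^esub>"
    using hom_q_serre[OF unit_embeddings(3), of "Y i" "Y j" D i 0 ?n] ij zero e3.hom_zero by simp
  have zero1: "Q.serre 0 ?n (?a1 i) (?a1 j) = \<zero>\<^bsub>B.T3\<^esub>"
  proof -
    have "Q.serre 0 ?n (B.p3 (Y i) \<one>\<^bsub>\<B>\<^esub> \<one>\<^bsub>\<B>\<^esub>) (B.p3 (Y j) \<one>\<^bsub>\<B>\<^esub> \<one>\<^bsub>\<B>\<^esub>) = \<zero>\<^bsub>B.T3\<^esub>"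
      using hom_q_serre[OF unit_embeddings(1), of "Y i" "Y j" D i 0 ?n] ij zero e1.hom_zero by simp
    then have "Q.serre 0 ?n (?\<tau> i \<otimes>\<^bsub>B.T3\<^esub> B.p3 (Y i) \<one>\<^bsub>\<B>\<^esub> \<one>\<^bsub>\<B>\<^esub>) (?\<tau> j \<otimes>\<^bsub>B.T3\<^esub> B.p3 (Y j) \<one>\<^bsub>\<B>\<^esub> \<one>\<^bsub>\<B>\<^esub>) = \<zero>\<^bsub>B.T3\<^esub>"
      by (intro Q.serre_twist_zero[OF n, where \<alpha> = 1 and \<beta> = 1]) (use ij in \<open>simp_all add: s\<close>)
    then show ?thesis using ij by (simp add: B.p3_mult)
  qed
  have zero2: "Q.serre 0 ?n (?a2 i) (?a2 j) = \<zero>\<^bsub>B.T3\<^esub>"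
  proof -
    have "Q.serre 0 ?n (B.p3 \<one>\<^bsub>\<B>\<^esub> (Y i) \<one>\<^bsub>\<B>\<^esub>) (B.p3 \<one>\<^bsub>\<B>\<^esub> (Y j) \<one>\<^bsub>\<B>\<^esub>) = \<zero>\<^bsub>B.T3\<^esub>"
      using hom_q_serre[OF unit_embeddings(2), of "Y i" "Y j" D i 0 ?n] ij e2.hom_zero
        QB.opposite_serre_zero[OF _ _ zero] by simp
    then have "Q.serre 0 ?n (?\<tau> i \<otimes>\<^bsub>B.T3\<^esub> B.p3 \<one>\<^bsub>\<B>\<^esub> (Y i) \<one>\<^bsub>\<B>\<^esub>) (?\<tau> j \<otimes>\<^bsub>B.T3\<^esub> B.p3 \<one>\<^bsub>\<B>\<^esub> (Y j) \<one>\<^bsub>\<B>\<^esub>) = \<zero>\<^bsub>B.T3\<^esub>"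
      by (intro Q.serre_twist_zero[OF n, where \<alpha> = "q_pow (s * root_form i i)"
            and \<beta> = "q_pow (s * root_form i j)"])
        (use ij root_form_sym[OF ij(1,2)] in \<open>simp_all add: s\<close>)
    then show ?thesis using ij by (simp add: B.p3_mult)
  qed
  have qp: "Q.qp (s * 2) = q_pow (s * root_form i i)"
    "Q.qp (s * simple_root D j (coroot D i)) = q_pow (s * root_form i j)"
    using qi_pow_cartan[of i i s] qi_pow_cartan[of i j s] ij by (simp_all add: cartan_diagonal)
  note comm = torsor_summands_commute[OF Y]
  have step: "Q.serre 0 ?n (?a3 i \<oplus>\<^bsub>B.T3\<^esub> \<ominus>\<^bsub>B.T3\<^esub> ?a2 i) (?a3 j \<oplus>\<^bsub>B.T3\<^esub> \<ominus>\<^bsub>B.T3\<^esub> ?a2 j) = \<zero>\<^bsub>B.T3\<^esub>"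
    by (rule Q.serre_sum_zero[OF sign n])
      (use cl ij zero3 Q.serre_uminus_zero[OF _ _ zero2] root_form_sym[OF ij(1,2)] in
        \<open>simp_all add: qp comm B.T3.l_minus B.T3.r_minus B.T3.smult_minus_right\<close>)
  have "Q.serre 0 ?n ((?a3 i \<oplus>\<^bsub>B.T3\<^esub> \<ominus>\<^bsub>B.T3\<^esub> ?a2 i) \<oplus>\<^bsub>B.T3\<^esub> ?a1 i)
      ((?a3 j \<oplus>\<^bsub>B.T3\<^esub> \<ominus>\<^bsub>B.T3\<^esub> ?a2 j) \<oplus>\<^bsub>B.T3\<^esub> ?a1 j) = \<zero>\<^bsub>B.T3\<^esub>"
    by (rule Q.serre_sum_zero[OF sign n])
      (use cl ij zero1 step root_form_sym[OF ij(1,2)] in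
        \<open>simp_all add: qp comm B.T3.l_minus B.T3.r_minus B.T3.l_distr B.T3.r_distr
          B.T3.smult_add_right B.T3.smult_minus_right\<close>)
  then show ?thesis by (simp add: torsor_sum_def B.T3.minus_eq)
qed

end

end

lemma restrict_morphism:
  assumes "algebra_morphism A B f"
  shows "algebra_morphism A B (restrict f (carrier A))"
proof -
  interpret algebra_morphism A B f by fact
  show ?thesis
    by unfold_locales (rule algebra_homI; simp add: hom_add hom_mult hom_one hom_smult)
qed

context symmetrizable_km_datum
begin

lemma e_f_relation:
  assumes ij: "i \<in> idx D" "j \<in> idx D"
  shows "gen_e D i \<otimes>\<^bsub>\<B>\<^esub> gen_f D j = q_pow (root_form i j) \<odot>\<^bsub>\<B>\<^esub> (gen_f D j \<otimes>\<^bsub>\<B>\<^esub> gen_e D i)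
    \<oplus>\<^bsub>\<B>\<^esub> (if i = j then 1 else 0) \<odot>\<^bsub>\<B>\<^esub> \<one>\<^bsub>\<B>\<^esub>"
  using B_relations ij qi_pow_cartan[OF ij, of 1] by (simp add: kashiwara_relations_def)

lemma torsor_sum_e_f:
  assumes ij: "i \<in> idx D" "j \<in> idx D"
  shows "torsor_sum (gen_e D) i \<otimes>\<^bsub>B.T3\<^esub> torsor_sum (gen_f D) j =
    q_pow (root_form i j) \<odot>\<^bsub>B.T3\<^esub> (torsor_sum (gen_f D) j \<otimes>\<^bsub>B.T3\<^esub> torsor_sum (gen_e D) i)
      \<oplus>\<^bsub>B.T3\<^esub> (if i = j then 1 else 0) \<odot>\<^bsub>B.T3\<^esub> \<one>\<^bsub>B.T3\<^esub>"
proof -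
  let ?d = "if i = j then 1 else 0 :: rat fps"
  let ?w = "?d \<odot>\<^bsub>B.T3\<^esub> B.p3 \<one>\<^bsub>\<B>\<^esub> (qh (t_exp i + t_exp j)) (qh (- t_exp i - t_exp j))"
  \<comment> \<open>Treating the constant term as an arbitrary scalar avoids a case distinction in the
    computations below.\<close>
  obtain d where d: "?d = d" by blast
  note ef = e_f_relation[OF ij, unfolded d]
  have ef_left: "gen_e D i \<otimes>\<^bsub>\<B>\<^esub> (gen_f D j \<otimes>\<^bsub>\<B>\<^esub> x) =
      q_pow (root_form i j) \<odot>\<^bsub>\<B>\<^esub> (gen_f D j \<otimes>\<^bsub>\<B>\<^esub> (gen_e D i \<otimes>\<^bsub>\<B>\<^esub> x)) \<oplus>\<^bsub>\<B>\<^esub> d \<odot>\<^bsub>\<B>\<^esub> x"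
    if "x \<in> carrier \<B>" for x
    using that ij by (simp add: ef B.l_distr B.smult_mult_left flip: B.m_assoc)
  note nf = normal_form[OF weight_family_e] normal_form[OF weight_family_f]
  note s = B.p3_mult nf ef ef_left B.p3_smult B.p3_closed B.p3_add B.T3.smult_smult B.T3.smult_add_right
    B.smult_add_right root_form_sym[OF ij(2,1)] add.commute add.left_commute mult.commute
  have inverse: "z \<otimes>\<^bsub>B.T3\<^esub> x = q_pow r \<odot>\<^bsub>B.T3\<^esub> (x \<otimes>\<^bsub>B.T3\<^esub> z)"
    if "x \<otimes>\<^bsub>B.T3\<^esub> z = q_pow (- r) \<odot>\<^bsub>B.T3\<^esub> (z \<otimes>\<^bsub>B.T3\<^esub> x)" "x \<in> carrier B.T3" "z \<in> carrier B.T3" for x z r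
    using that by (simp add: B.T3.smult_smult flip: q_pow_add)
  have cancel: "q_pow r * (x * q_pow (- r)) = x" for r x
    using q_pow_add[of r "- r"] by (simp add: mult.left_commute)
  note comm_e = torsor_summands_commute[OF weight_family_e weight_family_f ij]
    and comm_f = torsor_summands_commute[OF weight_family_f weight_family_e ij(2,1), unfolded mult_minus1]
  show ?thesis
    unfolding torsor_sum_def d
  proof (rule B.T3.commutator_relation_sum[where w = ?w])
    show "B.p3 (gen_e D i) (t i) (t' i) \<otimes>\<^bsub>B.T3\<^esub> B.p3 (gen_f D j) (t j) (t' j) =
      q_pow (root_form i j) \<odot>\<^bsub>B.T3\<^esub> (B.p3 (gen_f D j) (t j) (t' j) \<otimes>\<^bsub>B.T3\<^esub> B.p3 (gen_e D i) (t i) (t' i))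
        \<oplus>\<^bsub>B.T3\<^esub> ?w"
      unfolding d using ij by (simp add: s)
    show "B.p3 \<one>\<^bsub>\<B>\<^esub> (gen_e D i \<otimes>\<^bsub>\<B>\<^esub> t i) (t' i) \<otimes>\<^bsub>B.T3\<^esub> B.p3 \<one>\<^bsub>\<B>\<^esub> (gen_f D j \<otimes>\<^bsub>\<B>\<^esub> t j) (t' j) =
      q_pow (root_form i j) \<odot>\<^bsub>B.T3\<^esub> (B.p3 \<one>\<^bsub>\<B>\<^esub> (gen_f D j \<otimes>\<^bsub>\<B>\<^esub> t j) (t' j)
        \<otimes>\<^bsub>B.T3\<^esub> B.p3 \<one>\<^bsub>\<B>\<^esub> (gen_e D i \<otimes>\<^bsub>\<B>\<^esub> t i) (t' i)) \<ominus>\<^bsub>B.T3\<^esub> ?w"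
      unfolding d using ij by (simp add: s cancel B.T3.minus_eq B.T3.a_assoc B.T3.r_neg)
    show "B.p3 \<one>\<^bsub>\<B>\<^esub> \<one>\<^bsub>\<B>\<^esub> (gen_e D i) \<otimes>\<^bsub>B.T3\<^esub> B.p3 \<one>\<^bsub>\<B>\<^esub> \<one>\<^bsub>\<B>\<^esub> (gen_f D j) =
      q_pow (root_form i j) \<odot>\<^bsub>B.T3\<^esub> (B.p3 \<one>\<^bsub>\<B>\<^esub> \<one>\<^bsub>\<B>\<^esub> (gen_f D j) \<otimes>\<^bsub>B.T3\<^esub> B.p3 \<one>\<^bsub>\<B>\<^esub> \<one>\<^bsub>\<B>\<^esub> (gen_e D i))
        \<oplus>\<^bsub>B.T3\<^esub> d \<odot>\<^bsub>B.T3\<^esub> \<one>\<^bsub>B.T3\<^esub>"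
      using ij by (simp add: s B.pure_ones)
  qed (use ij comm_e comm_f root_form_sym[OF ij(2,1)] inverse[OF comm_f(1)] inverse[OF comm_f(2)] inverse[OF comm_f(3)] in
      \<open>simp_all add: B.p3_closed\<close>)
qed

lemma torsor_sum_relations:
  "kashiwara_relations D B.T3 (torsor_sum (gen_e D)) (torsor_sum (gen_f D))
    (\<lambda>h. B.p3 (qh h) (qh (- h)) (qh h))"
  unfolding kashiwara_relations_def
proof (intro conjI ballI impI)
  show "B.p3 (qh 0) (qh (- 0)) (qh 0) = \<one>\<^bsub>B.T3\<^esub>"
    by (simp add: q_zero B.pure_ones)
next
  fix h h' assume "h \<in> coroot_lattice D" "h' \<in> coroot_lattice D"
  then show "B.p3 (qh h) (qh (- h)) (qh h) \<otimes>\<^bsub>B.T3\<^esub> B.p3 (qh h') (qh (- h')) (qh h') =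
      B.p3 (qh (h + h')) (qh (- (h + h'))) (qh (h + h'))"
    by (simp add: B.p3_mult q_mult add.commute)
next
  fix h i assume "h \<in> coroot_lattice D" "i \<in> idx D"
  then show "B.p3 (qh h) (qh (- h)) (qh h) \<otimes>\<^bsub>B.T3\<^esub> torsor_sum (gen_e D) i
        \<otimes>\<^bsub>B.T3\<^esub> B.p3 (qh (- h)) (qh (- (- h))) (qh (- h)) =
      q_pow (simple_root D i h) \<odot>\<^bsub>B.T3\<^esub> torsor_sum (gen_e D) i"
    "B.p3 (qh h) (qh (- h)) (qh h) \<otimes>\<^bsub>B.T3\<^esub> torsor_sum (gen_f D) i
        \<otimes>\<^bsub>B.T3\<^esub> B.p3 (qh (- h)) (qh (- (- h))) (qh (- h)) =
      q_pow (- simple_root D i h) \<odot>\<^bsub>B.T3\<^esub> torsor_sum (gen_f D) i"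
    using torsor_sum_q[OF weight_family_e] torsor_sum_q[OF weight_family_f] by simp_all
next
  fix i j assume ij: "i \<in> idx D" "j \<in> idx D"
  show "torsor_sum (gen_e D) i \<otimes>\<^bsub>B.T3\<^esub> torsor_sum (gen_f D) j =
      qi_pow D i (simple_root D j (coroot D i)) \<odot>\<^bsub>B.T3\<^esub>
        (torsor_sum (gen_f D) j \<otimes>\<^bsub>B.T3\<^esub> torsor_sum (gen_e D) i)
      \<oplus>\<^bsub>B.T3\<^esub> (if i = j then \<one>\<^bsub>B.T3\<^esub> else \<zero>\<^bsub>B.T3\<^esub>)"
    using torsor_sum_e_f[OF ij] qi_pow_cartan[OF ij, of 1] by simp
  assume ne: "i \<noteq> j"
  show "q_serre B.T3 D i 0 (serre_order D i j) (torsor_sum (gen_e D) i) (torsor_sum (gen_e D) j) = \<zero>\<^bsub>B.T3\<^esub>"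
    by (rule torsor_sum_serre[OF weight_family_e ij ne])
      (use B_relations ij ne in \<open>simp add: kashiwara_relations_def\<close>)
  show "q_serre B.T3 D i 0 (serre_order D i j) (torsor_sum (gen_f D) i) (torsor_sum (gen_f D) j) = \<zero>\<^bsub>B.T3\<^esub>"
    by (rule torsor_sum_serre[OF weight_family_f ij ne])
      (use B_relations ij ne in \<open>simp add: kashiwara_relations_def\<close>)
qed

section \<open>Existence and uniqueness of \<open>\<mu>\<close>\<close>

text \<open>
  The same as \<^const>\<open>kashiwara_mu\<close>, in the notation of this section (\<open>kashiwara_mu_iff\<close>).
\<close>

definition is_mu where
  "is_mu \<mu> \<longleftrightarrow> algebra_morphism \<B> B.T3 \<mu> \<and>
    (\<forall>i\<in>idx D. \<mu> (gen_e D i) = torsor_sum (gen_e D) i) \<and>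
    (\<forall>i\<in>idx D. \<mu> (gen_f D i) = torsor_sum (gen_f D) i) \<and>
    (\<forall>h\<in>coroot_lattice D. \<mu> (qh h) = B.p3 (qh h) (qh (- h)) (qh h))"

lemma algebra_morphism_iff:
  "\<lbrakk>type_algebra A; type_algebra N\<rbrakk> \<Longrightarrow> algebra_morphism A N f \<longleftrightarrow> f \<in> algebra_hom A N"
  by (simp add: algebra_morphism_def algebra_morphism_axioms_def)

lemma kashiwara_mu_iff: "kashiwara_mu D \<mu> \<longleftrightarrow> is_mu \<mu>"
  unfolding kashiwara_mu_def is_mu_def Let_def pure3_def tensor3_def torsor_sum_def gen_t_def gen_t_inv_def
    t_exp_def algebra_morphism_iff[OF B_type_algebra B.T3_type_algebra] ..

lemma is_mu_exists: "\<exists>\<mu>. is_mu \<mu>"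
proof -
  obtain \<mu> where "algebra_morphism \<B> B.T3 \<mu>" "\<And>i. i \<in> idx D \<Longrightarrow> \<mu> (gen_e D i) = torsor_sum (gen_e D) i"
    "\<And>i. i \<in> idx D \<Longrightarrow> \<mu> (gen_f D i) = torsor_sum (gen_f D) i"
    "\<And>h. h \<in> coroot_lattice D \<Longrightarrow> \<mu> (qh h) = B.p3 (qh h) (qh (- h)) (qh h)"
    by (rule B_universal[OF B.T3_type_algebra _ _ _ torsor_sum_relations])
      (simp_all add: torsor_sum_closed[OF weight_family_e] torsor_sum_closed[OF weight_family_f] B.p3_closed)
  then show ?thesis unfolding is_mu_def by blast
qed

lemma unique_extensional_morphism:
  assumes f: "algebra_morphism \<B> N f" "P f"
    and restrict: "\<And>f. P f \<Longrightarrow> P (restrict f (carrier \<B>))"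
    and unique: "\<And>f g x. \<lbrakk>P f; P g; x \<in> carrier \<B>\<rbrakk> \<Longrightarrow> f x = g x"
  shows "\<exists>!f. f \<in> extensional (carrier \<B>) \<and> P f"
proof (rule ex1I)
  show "restrict f (carrier \<B>) \<in> extensional (carrier \<B>) \<and> P (restrict f (carrier \<B>))"
    using f restrict by simp
  fix g assume g: "g \<in> extensional (carrier \<B>) \<and> P g"
  show "g = restrict f (carrier \<B>)"
    by (rule extensionalityI[of _ "carrier \<B>"]) (use g f unique in auto)
qed

lemma kashiwara_mu_unique: "\<exists>!\<mu>. \<mu> \<in> extensional (carrier \<B>) \<and> kashiwara_mu D \<mu>"
proof -
  obtain \<mu> where mu: "is_mu \<mu>" using is_mu_exists by blast
  show ?thesis
    unfolding kashiwara_mu_iff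
  proof (rule unique_extensional_morphism)
    show "algebra_morphism \<B> B.T3 \<mu>" using mu by (simp add: is_mu_def)
    show "is_mu \<mu>" by (rule mu)
    show "is_mu (restrict f (carrier \<B>))" if "is_mu f" for f
      using that by (simp add: is_mu_def restrict_morphism)
    show "f x = g x" if "is_mu f" "is_mu g" "x \<in> carrier \<B>" for f g x
      by (rule B_hom_eqI[of B.T3]) (use that in \<open>simp_all add: is_mu_def\<close>)
  qed
qed

section \<open>Rescaling automorphisms\<close>

text \<open>
  Every relation is homogeneous in each \<open>e'\<^sub>i\<close> and \<open>f\<^sub>i\<close>, except for the constant term in the relation
  between \<open>e'\<^sub>i\<close> and \<open>f\<^sub>i\<close>; the condition on \<open>c\<close> and \<open>d\<close> takes care of that term.
\<close>

lemma rescaling_morphism: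
  assumes unit: "\<And>i. i \<in> idx D \<Longrightarrow> c i * d i = 1"
  obtains f where "algebra_morphism \<B> \<B> f" "\<And>i. i \<in> idx D \<Longrightarrow> f (gen_e D i) = c i \<odot>\<^bsub>\<B>\<^esub> gen_e D i"
    "\<And>i. i \<in> idx D \<Longrightarrow> f (gen_f D i) = d i \<odot>\<^bsub>\<B>\<^esub> gen_f D i" "\<And>h. h \<in> coroot_lattice D \<Longrightarrow> f (qh h) = qh h"
proof -
  have serre: "q_serre \<B> D i 0 (serre_order D i j) (a \<odot>\<^bsub>\<B>\<^esub> x) (b \<odot>\<^bsub>\<B>\<^esub> y) = \<zero>\<^bsub>\<B>\<^esub>"
    if "i \<in> idx D" "j \<in> idx D" "i \<noteq> j" "x \<in> carrier \<B>" "y \<in> carrier \<B>"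
      "q_serre \<B> D i 0 (serre_order D i j) x y = \<zero>\<^bsub>\<B>\<^esub>" for i j a b x y
  proof -
    interpret QB: q_algebra \<B> D i
      by (intro q_algebra.intro q_algebra_axioms.intro B_type_algebra half_norm_nonzero that)
    have "QB.serre 0 (serre_order D i j) ((a \<odot>\<^bsub>\<B>\<^esub> \<one>\<^bsub>\<B>\<^esub>) \<otimes>\<^bsub>\<B>\<^esub> x) ((b \<odot>\<^bsub>\<B>\<^esub> \<one>\<^bsub>\<B>\<^esub>) \<otimes>\<^bsub>\<B>\<^esub> y) = \<zero>\<^bsub>\<B>\<^esub>"
      by (rule QB.serre_twist_zero[OF serre_order_eq[OF that(1-3)], where \<alpha> = 1 and \<beta> = 1])
        (use that in \<open>simp_all add: B.smult_mult_left B.smult_mult_right B.smult_smult mult.commute\<close>)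
    then show ?thesis using that by (simp add: B.smult_mult_left)
  qed
  have unit_left: "c i * (d i * x) = x" if "i \<in> idx D" for i x
    using unit[OF that] by (simp flip: mult.assoc)
  have "kashiwara_relations D \<B> (\<lambda>i. c i \<odot>\<^bsub>\<B>\<^esub> gen_e D i) (\<lambda>i. d i \<odot>\<^bsub>\<B>\<^esub> gen_f D i) qh"
    unfolding kashiwara_relations_def
  proof (intro conjI ballI impI)
    fix i j assume ij: "i \<in> idx D" "j \<in> idx D"
    show "(c i \<odot>\<^bsub>\<B>\<^esub> gen_e D i) \<otimes>\<^bsub>\<B>\<^esub> (d j \<odot>\<^bsub>\<B>\<^esub> gen_f D j) =
        qi_pow D i (simple_root D j (coroot D i)) \<odot>\<^bsub>\<B>\<^esub> ((d j \<odot>\<^bsub>\<B>\<^esub> gen_f D j) \<otimes>\<^bsub>\<B>\<^esub> (c i \<odot>\<^bsub>\<B>\<^esub> gen_e D i))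
        \<oplus>\<^bsub>\<B>\<^esub> (if i = j then \<one>\<^bsub>\<B>\<^esub> else \<zero>\<^bsub>\<B>\<^esub>)"
      using ij unit[OF ij(1)] qi_pow_cartan[OF ij, of 1]
      by (cases "i = j")
        (simp_all add: unit_left e_f_relation B.smult_mult_left B.smult_mult_right B.smult_smult B.smult_add_right mult_ac)
    assume "i \<noteq> j"
    then show "q_serre \<B> D i 0 (serre_order D i j) (c i \<odot>\<^bsub>\<B>\<^esub> gen_e D i) (c j \<odot>\<^bsub>\<B>\<^esub> gen_e D j) = \<zero>\<^bsub>\<B>\<^esub>"
      "q_serre \<B> D i 0 (serre_order D i j) (d i \<odot>\<^bsub>\<B>\<^esub> gen_f D i) (d j \<odot>\<^bsub>\<B>\<^esub> gen_f D j) = \<zero>\<^bsub>\<B>\<^esub>"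
      using B_relations ij by (simp_all add: serre kashiwara_relations_def)
  qed (use B_relations in \<open>simp_all add: kashiwara_relations_def B.smult_mult_left B.smult_mult_right
      B.smult_smult mult.commute\<close>)
  then show ?thesis
    using that by (elim B_universal[OF B_type_algebra, rotated 3]) auto
qed

text \<open>
  Conjugation by \<open>t\<^sub>i\<close> multiplies a generator by a power of \<open>q\<close> (\<open>t_conjugation\<close>), so \<open>\<theta>\<close> is the
  rescaling by these powers.
\<close>

definition is_theta where
  "is_theta \<theta> \<longleftrightarrow> algebra_morphism \<B> \<B> \<theta> \<and>
    (\<forall>i\<in>idx D. \<theta> (gen_e D i) = q_pow (- root_form i i) \<odot>\<^bsub>\<B>\<^esub> gen_e D i) \<and>
    (\<forall>i\<in>idx D. \<theta> (gen_f D i) = q_pow (root_form i i) \<odot>\<^bsub>\<B>\<^esub> gen_f D i) \<and>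
    (\<forall>h\<in>coroot_lattice D. \<theta> (qh h) = qh h)"

lemma t_conjugation:
  assumes "weight_family s Y" "i \<in> idx D"
  shows "t' i \<otimes>\<^bsub>\<B>\<^esub> Y i \<otimes>\<^bsub>\<B>\<^esub> t i = q_pow (- (s * root_form i i)) \<odot>\<^bsub>\<B>\<^esub> Y i"
  using assms(2) Y_closed[OF assms] by (simp add: normal_form[OF assms(1)])

lemma kashiwara_theta_iff: "kashiwara_theta D \<theta> \<longleftrightarrow> is_theta \<theta>"
  unfolding kashiwara_theta_def is_theta_def Let_def gen_t_def gen_t_inv_def t_exp_def[symmetric]
    algebra_morphism_iff[OF B_type_algebra B_type_algebra]
  by (simp add: t_conjugation[OF weight_family_e] t_conjugation[OF weight_family_f])

lemma kashiwara_theta_unique: "\<exists>!\<theta>. \<theta> \<in> extensional (carrier \<B>) \<and> kashiwara_theta D \<theta>"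
proof -
  have "q_pow (- root_form i i) * q_pow (root_form i i) = 1" for i
    by (simp flip: q_pow_add)
  then obtain \<theta> where "algebra_morphism \<B> \<B> \<theta>"
    "\<And>i. i \<in> idx D \<Longrightarrow> \<theta> (gen_e D i) = q_pow (- root_form i i) \<odot>\<^bsub>\<B>\<^esub> gen_e D i"
    "\<And>i. i \<in> idx D \<Longrightarrow> \<theta> (gen_f D i) = q_pow (root_form i i) \<odot>\<^bsub>\<B>\<^esub> gen_f D i"
    "\<And>h. h \<in> coroot_lattice D \<Longrightarrow> \<theta> (qh h) = qh h"
    using rescaling_morphism[of "\<lambda>i. q_pow (- root_form i i)" "\<lambda>i. q_pow (root_form i i)"] by metis
  then have theta: "is_theta \<theta>" by (simp add: is_theta_def)
  show ?thesis
    unfolding kashiwara_theta_iff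
  proof (rule unique_extensional_morphism)
    show "algebra_morphism \<B> \<B> \<theta>" using theta by (simp add: is_theta_def)
    show "is_theta \<theta>" by (rule theta)
    show "is_theta (restrict f (carrier \<B>))" if "is_theta f" for f
      using that by (simp add: is_theta_def restrict_morphism)
    show "f x = g x" if "is_theta f" "is_theta g" "x \<in> carrier \<B>" for f g x
      by (rule B_hom_eqI[of \<B>]) (use that in \<open>simp_all add: is_theta_def\<close>)
  qed
qed

lemma theta_bijective:
  assumes "is_theta \<theta>"
  shows "bij_betw \<theta> (carrier \<B>) (carrier \<B>)"
proof -
  interpret theta: algebra_morphism \<B> \<B> \<theta> using assms by (simp add: is_theta_def)
  have inv: "q_pow (root_form i i) * q_pow (- root_form i i) = 1"
     "q_pow (- root_form i i) * q_pow (root_form i i) = 1" for i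
    by (simp_all flip: q_pow_add)
  obtain \<psi> where psi: "algebra_morphism \<B> \<B> \<psi>"
    "\<And>i. i \<in> idx D \<Longrightarrow> \<psi> (gen_e D i) = q_pow (root_form i i) \<odot>\<^bsub>\<B>\<^esub> gen_e D i"
    "\<And>i. i \<in> idx D \<Longrightarrow> \<psi> (gen_f D i) = q_pow (- root_form i i) \<odot>\<^bsub>\<B>\<^esub> gen_f D i"
    "\<And>h. h \<in> coroot_lattice D \<Longrightarrow> \<psi> (qh h) = qh h"
    using rescaling_morphism[of "\<lambda>i. q_pow (root_form i i)" "\<lambda>i. q_pow (- root_form i i)"] inv by metis
  interpret psi: algebra_morphism \<B> \<B> \<psi> by (rule psi)
  have id: "algebra_morphism \<B> \<B> (\<lambda>x. x)"
    by unfold_locales (rule algebra_homI; simp)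
  have gens: "\<And>i. i \<in> idx D \<Longrightarrow> \<theta> (gen_e D i) = q_pow (- root_form i i) \<odot>\<^bsub>\<B>\<^esub> gen_e D i"
    "\<And>i. i \<in> idx D \<Longrightarrow> \<theta> (gen_f D i) = q_pow (root_form i i) \<odot>\<^bsub>\<B>\<^esub> gen_f D i"
    "\<And>h. h \<in> coroot_lattice D \<Longrightarrow> \<theta> (qh h) = qh h"
    using assms by (simp_all add: is_theta_def)
  have "\<psi> (\<theta> x) = x" "\<theta> (\<psi> x) = x" if "x \<in> carrier \<B>" for x
    by (rule B_hom_eqI[OF algebra_morphism_comp[OF theta.algebra_morphism_axioms psi(1)] id that]
        B_hom_eqI[OF algebra_morphism_comp[OF psi(1) theta.algebra_morphism_axioms] id that];
      simp add: gens psi(2-) psi.hom_smult theta.hom_smult B.smult_smult inv)+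
  then show ?thesis
    by (intro bij_betw_byWitness[where f' = \<psi>]) auto
qed

section \<open>The torsor axioms\<close>

context
  fixes \<mu> \<theta>
  assumes mu: "is_mu \<mu>" and theta: "is_theta \<theta>"
begin

lemma mu_morphism: "algebra_morphism \<B> B.T3 \<mu>"
  and theta_morphism: "algebra_morphism \<B> \<B> \<theta>"
  using mu theta by (simp_all add: is_mu_def is_theta_def)

interpretation mu: algebra_morphism \<B> B.T3 \<mu> by (rule mu_morphism)
interpretation theta: algebra_morphism \<B> \<B> \<theta> by (rule theta_morphism)

lemma mu_q: "h \<in> coroot_lattice D \<Longrightarrow> \<mu> (qh h) = B.p3 (qh h) (qh (- h)) (qh h)"
  using mu by (simp add: is_mu_def)

lemma theta_q: "h \<in> coroot_lattice D \<Longrightarrow> \<theta> (qh h) = qh h"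
  using theta by (simp add: is_theta_def)

definition compatible_family where
  "compatible_family s Y \<longleftrightarrow> weight_family s Y \<and>
    (\<forall>i\<in>idx D. \<mu> (Y i) = torsor_sum Y i \<and> \<theta> (Y i) = q_pow (- (s * root_form i i)) \<odot>\<^bsub>\<B>\<^esub> Y i)"

lemma compatible_e: "compatible_family 1 (gen_e D)"
  and compatible_f: "compatible_family (- 1) (gen_f D)"
  using mu theta weight_family_e weight_family_f
  by (simp_all add: compatible_family_def is_mu_def is_theta_def)

interpretation iim: algebra_morphism B.T3 B.T5 "id_id_mu \<B> \<mu>" by (rule B.id_id_mu_morphism[OF mu_morphism])
interpretation mii: algebra_morphism B.T3 B.T5 "mu_id_id \<B> \<mu>" by (rule B.mu_id_id_morphism[OF mu_morphism])
interpretation imi: algebra_morphism B.T3 B.T5 "id_muop_id \<B> \<mu>" by (rule B.id_muop_id_morphism[OF mu_morphism])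
interpretation tm: algebra_morphism B.T5 B.T5 "theta_middle \<B> \<theta>" by (rule B.theta_middle_morphism[OF theta_morphism])
interpretation ta: algebra_morphism B.T3 B.T3 "theta_all \<B> \<theta>" by (rule B.theta_all_morphism[OF theta_morphism])

lemmas pure_values = B.id_id_mu_pure[OF mu_morphism] B.mu_id_id_pure[OF mu_morphism]
  B.id_muop_id_pure[OF mu_morphism] B.theta_middle_pure[OF theta_morphism] B.theta_all_pure[OF theta_morphism]
  B.last_three B.first_three B.middle_three

context
  fixes s Y i
  assumes Y: "compatible_family s Y" and i: "i \<in> idx D"
begin

lemma weight_Y: "weight_family s Y" using Y by (simp add: compatible_family_def)

lemma Y_carrier: "Y i \<in> carrier \<B>" by (rule Y_closed[OF weight_Y i])

lemma mu_Y: "\<mu> (Y i) = B.p3 \<one>\<^bsub>\<B>\<^esub> \<one>\<^bsub>\<B>\<^esub> (Y i) \<ominus>\<^bsub>B.T3\<^esub> B.p3 \<one>\<^bsub>\<B>\<^esub> (Y i \<otimes>\<^bsub>\<B>\<^esub> t i) (t' i)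
    \<oplus>\<^bsub>B.T3\<^esub> B.p3 (Y i) (t i) (t' i)"
  using Y i by (simp add: compatible_family_def torsor_sum_def)

lemma theta_Y: "\<theta> (Y i) = q_pow (- (s * root_form i i)) \<odot>\<^bsub>\<B>\<^esub> Y i"
  using Y i by (simp add: compatible_family_def)

text \<open>
  The middle factor of \<open>\<mu>(Y\<^sub>i)\<close>, to which \<open>\<mu>\<^sup>o\<^sup>p\<close> is applied in the law that relates \<open>\<theta>\<close> and \<open>\<mu>\<^sup>o\<^sup>p\<close>, is
  \<open>Y\<^sub>i t\<^sub>i\<close>. The term \<open>t\<^sub>i\<^sup>-\<^sup>1 Y\<^sub>i t\<^sub>i = \<theta>(Y\<^sub>i)\<close> appears in the second slot since multiplication is reversed
  there.
\<close>

lemma mu_Y_t: "\<mu> (Y i \<otimes>\<^bsub>\<B>\<^esub> t i) = B.p3 (t i) (t' i) (Y i \<otimes>\<^bsub>\<B>\<^esub> t i)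
    \<ominus>\<^bsub>B.T3\<^esub> q_pow (- (s * root_form i i)) \<odot>\<^bsub>B.T3\<^esub> B.p3 (t i) (Y i) \<one>\<^bsub>\<B>\<^esub>
    \<oplus>\<^bsub>B.T3\<^esub> B.p3 (Y i \<otimes>\<^bsub>\<B>\<^esub> t i) \<one>\<^bsub>\<B>\<^esub> \<one>\<^bsub>\<B>\<^esub>"
  using i Y_carrier
  by (simp add: mu.hom_mult mu_Y mu_q B.T3.l_distr B.T3.l_minus B.T3.minus_eq B.p3_closed B.p3_mult
      normal_form[OF weight_Y] B.p3_smult)

lemma right_unit_gen: "id_m \<B> (\<mu> (Y i)) = B.p2 (Y i) \<one>\<^bsub>\<B>\<^esub>"
  using i Y_carrier
  by (simp add: mu_Y B.id_m_simps B.p3_closed normal_form[OF weight_Y] B.p2_closed B.T2.minus_eq B.T2.r_neg)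

lemma left_unit_gen: "m_id \<B> (\<mu> (Y i)) = B.p2 \<one>\<^bsub>\<B>\<^esub> (Y i)"
  using i Y_carrier
  by (simp add: mu_Y B.m_id_simps B.p3_closed normal_form[OF weight_Y] B.p2_closed B.T2.minus_eq B.T2.a_assoc B.T2.l_neg)

lemma coassoc_gen: "id_id_mu \<B> \<mu> (\<mu> (Y i)) = mu_id_id \<B> \<mu> (\<mu> (Y i))"
  using i Y_carrier
  by (simp add: mu_Y iim.hom_add iim.hom_minus mii.hom_add mii.hom_minus B.p3_closed pure_values mu_q
      mu.hom_one B.pure_ones B.p5_closed B.T5.minus_eq B.T5.a_assoc)

lemma theta_law_gen:
  "theta_middle \<B> \<theta> (mu_id_id \<B> \<mu> (\<mu> (Y i))) = id_muop_id \<B> \<mu> (\<mu> (Y i))"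
proof -
  have "theta_middle \<B> \<theta> (mu_id_id \<B> \<mu> (\<mu> (Y i))) =
      B.p5 \<one>\<^bsub>\<B>\<^esub> \<one>\<^bsub>\<B>\<^esub> \<one>\<^bsub>\<B>\<^esub> \<one>\<^bsub>\<B>\<^esub> (Y i)
      \<ominus>\<^bsub>B.T5\<^esub> B.p5 \<one>\<^bsub>\<B>\<^esub> \<one>\<^bsub>\<B>\<^esub> \<one>\<^bsub>\<B>\<^esub> (Y i \<otimes>\<^bsub>\<B>\<^esub> t i) (t' i)
      \<oplus>\<^bsub>B.T5\<^esub> (q_pow (- (s * root_form i i)) \<odot>\<^bsub>B.T5\<^esub> B.p5 \<one>\<^bsub>\<B>\<^esub> \<one>\<^bsub>\<B>\<^esub> (Y i) (t i) (t' i)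
        \<ominus>\<^bsub>B.T5\<^esub> B.p5 \<one>\<^bsub>\<B>\<^esub> (Y i \<otimes>\<^bsub>\<B>\<^esub> t i) (t' i) (t i) (t' i)
        \<oplus>\<^bsub>B.T5\<^esub> B.p5 (Y i) (t i) (t' i) (t i) (t' i))"
    using i Y_carrier
    by (simp add: mu_Y mii.hom_add mii.hom_minus B.p3_closed pure_values mu.hom_one B.pure_ones
        tm.hom_add tm.hom_minus B.p5_closed theta.hom_one theta_Y theta_q B.p5_smult)
  also have "\<dots> = id_muop_id \<B> \<mu> (\<mu> (Y i))"
    using i Y_carrier
    by (simp add: mu_Y imi.hom_add imi.hom_minus B.p3_closed pure_values mu.hom_one B.pure_ones mu_Y_t mu_q
        B.p5_closed B.T5.minus_eq B.T5.minus_add B.T5.a_ac)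
  finally show ?thesis .
qed

lemma theta_mu_gen: "theta_all \<B> \<theta> (\<mu> (Y i)) = \<mu> (\<theta> (Y i))"
  using i Y_carrier
  by (simp add: mu_Y theta_Y mu.hom_smult ta.hom_add ta.hom_minus B.p3_closed pure_values theta.hom_one
      theta.hom_mult theta_q B.smult_mult_left B.p3_smult B.T3.smult_add_right B.T3.smult_diff_right)

end

lemma right_unit: "x \<in> carrier \<B> \<Longrightarrow> id_m \<B> (\<mu> x) = B.p2 x \<one>\<^bsub>\<B>\<^esub>"
proof (induction rule: B_induct)
  case (mult x y)
  then show ?case
    by (simp add: mu.hom_mult B.id_m_mult[OF _ _ mult(1) mult(3)] B.p2_mult)
qed (simp_all add: right_unit_gen[OF compatible_e] right_unit_gen[OF compatible_f] mu_q B.id_m_simps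
    q_mult q_zero mu.hom_one B.pure_ones mu.hom_add mu.hom_smult B.p2_add B.p2_smult)

lemma left_unit: "x \<in> carrier \<B> \<Longrightarrow> m_id \<B> (\<mu> x) = B.p2 \<one>\<^bsub>\<B>\<^esub> x"
proof (induction rule: B_induct)
  case (mult x y)
  then show ?case
    by (simp add: mu.hom_mult B.m_id_mult[OF _ _ mult(2) mult(4)] B.p2_mult)
qed (simp_all add: left_unit_gen[OF compatible_e] left_unit_gen[OF compatible_f] mu_q B.m_id_simps
    q_mult q_zero mu.hom_one B.pure_ones mu.hom_add mu.hom_smult B.p2_add B.p2_smult)

lemma coassoc: "x \<in> carrier \<B> \<Longrightarrow> id_id_mu \<B> \<mu> (\<mu> x) = mu_id_id \<B> \<mu> (\<mu> x)"
  by (rule B_hom_eqI[OF algebra_morphism_comp[OF mu_morphism iim.algebra_morphism_axioms]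
        algebra_morphism_comp[OF mu_morphism mii.algebra_morphism_axioms]])
    (simp_all add: coassoc_gen[OF compatible_e] coassoc_gen[OF compatible_f] mu_q pure_values)

lemma theta_law: "x \<in> carrier \<B> \<Longrightarrow> theta_middle \<B> \<theta> (mu_id_id \<B> \<mu> (\<mu> x)) = id_muop_id \<B> \<mu> (\<mu> x)"
  by (rule B_hom_eqI[OF algebra_morphism_comp[OF algebra_morphism_comp[OF mu_morphism mii.algebra_morphism_axioms]
          tm.algebra_morphism_axioms] algebra_morphism_comp[OF mu_morphism imi.algebra_morphism_axioms]])
    (simp_all add: theta_law_gen[OF compatible_e] theta_law_gen[OF compatible_f] mu_q pure_values theta_q)

lemma theta_mu: "x \<in> carrier \<B> \<Longrightarrow> theta_all \<B> \<theta> (\<mu> x) = \<mu> (\<theta> x)"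
  by (rule B_hom_eqI[OF algebra_morphism_comp[OF mu_morphism ta.algebra_morphism_axioms]
        algebra_morphism_comp[OF theta_morphism mu_morphism]])
    (simp_all add: theta_mu_gen[OF compatible_e] theta_mu_gen[OF compatible_f] mu_q pure_values theta_q)

lemma kashiwara_autonomous_torsor: "autonomous_quantum_torsor \<B> \<mu> \<theta>"
proof (intro autonomous_quantum_torsor.intro quantum_torsor.intro quantum_torsor_axioms.intro
    autonomous_quantum_torsor_axioms.intro)
  show "assoc_algebra (ring_of_type_algebra :: rat fps ring) \<B>"
    using B_type_algebra by (simp add: type_algebra_iff)
  show "\<mu> \<in> algebra_hom \<B> (tensor3 \<B>)"
    unfolding tensor3_def by (rule mu.in_algebra_hom)
qed (use theta.in_algebra_hom right_unit left_unit coassoc theta_law theta_mu theta_bijective[OF theta] in auto)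

end

end

theorem theorem4:
  fixes D :: "('i, 'v::ab_group_add) km_datum"
  assumes "symmetrizable_km_datum D"
  shows "(\<exists>!\<mu>. \<mu> \<in> extensional (carrier (kashiwara_algebra D)) \<and> kashiwara_mu D \<mu>) \<and>
    (\<exists>!\<theta>. \<theta> \<in> extensional (carrier (kashiwara_algebra D)) \<and> kashiwara_theta D \<theta>) \<and>
    (\<forall>\<mu> \<theta>. kashiwara_mu D \<mu> \<longrightarrow> kashiwara_theta D \<theta> \<longrightarrow>
      autonomous_quantum_torsor (kashiwara_algebra D) \<mu> \<theta>)"
proof -
  interpret symmetrizable_km_datum D by fact
  show ?thesis
    using kashiwara_mu_unique kashiwara_theta_unique kashiwara_autonomous_torsor
    by (simp add: kashiwara_mu_iff kashiwara_theta_iff)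
qed

end
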